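(* Let $G=(\mathrm G)$ be the Hessian group of order 648. With notation as in the context, $$\det M_0(t)=\frac{(1-t^3)^4(1-t^6)(1-t^9)}{1-t^{18}}\,\Delta^+_{2,3,3,3}(t^6),\qquad \det M(t)=\frac{(1-t^3)^4(1-t^6)(1-t^9)^2}{1-t^{18}}\,\Delta_{2,3,3,3}(t^6).$$
   Context: For a finite group $G\subset\mathrm{SL}_3(\mathbb{C})$: let $\gamma$ be its natural 3-dimensional representation, $\gamma^*$ the contragredient representation, $\gamma_0,\dots,\gamma_l$ the irreducible complex representations of $G$ with $\gamma_0$ trivial. Define $(l+1)\times(l+1)$ integer matrices $B=(b_{ij})$, $B^*=(b^*_{ij})$ by $\gamma_j\otimes\gamma=\bigoplus_i b_{ij}\gamma_i$, $\gamma_j\otimes\gamma^*=\bigoplus_i b^*_{ij}\gamma_i$. Let $M(t)=(1-t^3)I-tB+t^2B^*$ and let $M_0(t)$ be obtained from $M(t)$ by replacing the column indexed by $\gamma_0$ with $(1,0,\dots,0)^t$ ($\gamma_0$ first). For positive integers $\alpha_1,\dots,\alpha_m$ write $[\alpha]_t=(1-t^\alpha)/(1-t)$ and define $\Delta_{\alpha_1,\dots,\alpha_m}(t)=(1-t)^{2-m}\prod_{i=1}^m(1-t^{\alpha_i})$, $\Delta^+_{\alpha_1,\dots,\alpha_m}(t)=(1-2t-2t^2+t^3)\prod_{i=1}^m[\alpha_i]_t+t^2\sum_{i=1}^m[\alpha_i-1]_t\prod_{j\ne i}[\alpha_j]_t$. The group (G): with $\omega=e^{2\pi i/3}$, $S_1=\mathrm{diag}(1,\omega,\omega^2)$,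 $T_0=\begin{pmatrix}0&1&0\\0&0&1\\1&0&0\end{pmatrix}$, $V=\frac{1}{\sqrt{3}\,i}\begin{pmatrix}1&1&1\\1&\omega&\omega^2\\1&\omega^2&\omega\end{pmatrix}$, $U=\mathrm{diag}(\varepsilon,\varepsilon,\varepsilon\omega)$ with $\varepsilon^3=\omega^2$, (G) is the subgroup of $\mathrm{SL}_3(\mathbb{C})$ of order 648 generated by $S_1,T_0,V,U$. *)

theory Defs
  imports Complex_Main "Jordan_Normal_Form.Determinant"
begin

definition mtrace :: "complex mat \<Rightarrow> complex" where
  "mtrace A = (\<Sum>i<dim_row A. A $$ (i,i))"

definition omega :: complex where "omega = cis (2*pi/3)"

(* a cube root of omega^2 *)
definition eps :: complex where "eps = cis (4*pi/9)"

definition mat3 :: "complex list list \<Rightarrow> complex mat" where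
  "mat3 xs = mat 3 3 (\<lambda>(i,j). xs ! i ! j)"

definition S1 :: "complex mat" where
  "S1 = mat3 [[1,0,0],[0,omega,0],[0,0,omega^2]]"
definition T0 :: "complex mat" where
  "T0 = mat3 [[0,1,0],[0,0,1],[1,0,0]]"
definition V :: "complex mat" where
  "V = (1 / (complex_of_real (sqrt 3) * \<i>)) \<cdot>\<^sub>m mat3 [[1,1,1],[1,omega,omega^2],[1,omega^2,omega]]"
definition U :: "complex mat" where
  "U = mat3 [[eps,0,0],[0,eps,0],[0,0,eps*omega]]"

text \<open>The subgroup generated by S1, T0, V, U (a finite group, so the multiplicative
  closure containing the identity is the generated subgroup).\<close>
inductive_set HessG :: "complex mat set" where
  one: "1\<^sub>m 3 \<in> HessG"
| gen: "g \<in> {S1, T0, V, U} \<Longrightarrow> h \<in> HessG \<Longrightarrow> g * h \<in> HessG"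

definition grp_inv :: "complex mat \<Rightarrow> complex mat" where
  "grp_inv g = (THE h. h \<in> HessG \<and> g * h = 1\<^sub>m 3)"

definition is_subspace :: "nat \<Rightarrow> complex vec set \<Rightarrow> bool" where
  "is_subspace n W \<longleftrightarrow> W \<subseteq> carrier_vec n \<and> 0\<^sub>v n \<in> W \<and>
     (\<forall>v\<in>W. \<forall>w\<in>W. v + w \<in> W) \<and> (\<forall>c. \<forall>v\<in>W. c \<cdot>\<^sub>v v \<in> W)"

definition is_rep :: "complex mat set \<Rightarrow> nat \<Rightarrow> (complex mat \<Rightarrow> complex mat) \<Rightarrow> bool" where
  "is_rep G n \<rho> \<longleftrightarrow> (\<forall>g\<in>G. \<rho> g \<in> carrier_mat n n) \<and>
     (\<forall>g\<in>G. \<forall>h\<in>G. \<rho> (g * h) = \<rho> g * \<rho> h) \<and> \<rho> (1\<^sub>m 3) = 1\<^sub>m n"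

definition is_irrep :: "complex mat set \<Rightarrow> nat \<Rightarrow> (complex mat \<Rightarrow> complex mat) \<Rightarrow> bool" where
  "is_irrep G n \<rho> \<longleftrightarrow> is_rep G n \<rho> \<and> n > 0 \<and>
     (\<forall>W. is_subspace n W \<and> (\<forall>g\<in>G. \<forall>v\<in>W. \<rho> g *\<^sub>v v \<in> W)
          \<longrightarrow> W = {0\<^sub>v n} \<or> W = carrier_vec n)"

text \<open>Irreducible characters (characters of irreducible complex representations),
  extended by 0 outside the group; they are in bijection with the isomorphism classes
  of irreducible representations.\<close>
definition irr_chars :: "complex mat set \<Rightarrow> (complex mat \<Rightarrow> complex) set" where
  "irr_chars G = {\<chi>. \<exists>n \<rho>. is_irrep G n \<rho> \<and> \<chi> = (\<lambda>g. if g \<in> G then mtrace (\<rho> g) else 0)}"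

definition triv_char :: "complex mat set \<Rightarrow> complex mat \<Rightarrow> complex" where
  "triv_char G = (\<lambda>g. if g \<in> G then 1 else 0)"

definition mult_in :: "complex mat set \<Rightarrow> (complex mat \<Rightarrow> complex) \<Rightarrow> (complex mat \<Rightarrow> complex) \<Rightarrow> complex" where
  "mult_in G chi_i psi = (\<Sum>g\<in>G. psi g * cnj (chi_i g)) / of_nat (card G)"

(* b_ij : gamma_j tensor gamma = sum b_ij gamma_i ;  character of gamma is trace, of gamma^* is g |-> trace(g^{-1}) *)
definition bB :: "(complex mat \<Rightarrow> complex) \<Rightarrow> (complex mat \<Rightarrow> complex) \<Rightarrow> complex" where
  "bB chi_i chi_j = mult_in HessG chi_i (\<lambda>g. chi_j g * mtrace g)"
definition bBs :: "(complex mat \<Rightarrow> complex) \<Rightarrow> (complex mat \<Rightarrow> complex) \<Rightarrow> complex" where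
  "bBs chi_i chi_j = mult_in HessG chi_i (\<lambda>g. chi_j g * mtrace (grp_inv g))"

definition Mt :: "nat \<Rightarrow> (nat \<Rightarrow> complex mat \<Rightarrow> complex) \<Rightarrow> complex \<Rightarrow> complex mat" where
  "Mt N e t = mat N N (\<lambda>(i,j). (if i = j then 1 - t^3 else 0) - t * bB (e i) (e j) + t^2 * bBs (e i) (e j))"

definition M0t :: "nat \<Rightarrow> (nat \<Rightarrow> complex mat \<Rightarrow> complex) \<Rightarrow> complex \<Rightarrow> complex mat" where
  "M0t N e t = mat N N (\<lambda>(i,j). if j = 0 then (if i = 0 then 1 else 0) else Mt N e t $$ (i,j))"

definition qint :: "nat \<Rightarrow> complex \<Rightarrow> complex" where
  "qint a t = (1 - t^a) / (1 - t)"

definition Delta :: "nat list \<Rightarrow> complex \<Rightarrow> complex" where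
  "Delta as t = (1 - t) powi (2 - int (length as)) * (\<Prod>a\<leftarrow>as. (1 - t^a))"

definition DeltaP :: "nat list \<Rightarrow> complex \<Rightarrow> complex" where
  "DeltaP as t = (1 - 2*t - 2*t^2 + t^3) * (\<Prod>a\<leftarrow>as. qint a t)
     + t^2 * (\<Sum>i<length as. qint (as!i - 1) t * (\<Prod>j\<in>{..<length as} - {i}. qint (as!j) t))"

end

theory Submission
  imports Defs "Jordan_Normal_Form.Spectral_Radius" "Jordan_Normal_Form.Schur_Decomposition"
begin

text \<open>
  Let \<open>p g = 1 - t\<^sup>3 - t tr g + t\<^sup>2 tr g\<^sup>-\<^sup>1 = det (1 - t g)\<close>. In the basis of irreducible characters,
  \<open>M(t)\<close> is the transposed matrix of multiplication by \<open>p\<close> on class functions, so the character table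
  diagonalises it: \<open>det M(t)\<close> is the product of \<open>p\<close> over the conjugacy classes, and a Laplace expansion
  along the trivial character gives \<open>det M\<^sub>0(t)\<close> as the sum over the classes \<open>C\<close> of \<open>|C| / |G|\<close>
  times the product of \<open>p\<close> over the classes other than \<open>C\<close>.
  For the group (G), the elements are \<open>\<epsilon>\<^sup>m D(v) r(\<sigma>)\<close> with \<open>D\<close> the Heisenberg group of order 27, \<open>r\<close>
  the Weil representation of SL(2,3), and \<open>m\<close> determined modulo 3 by \<open>\<sigma>\<close>; this normal form
  yields the 24 classes with their sizes and traces.
\<close>

text \<open>The theorem quantifies over an arbitrary enumeration \<open>e\<close> of
  \<open>irr_chars\<close>, so no character table is ever written down. It suffices that the table
  is square and invertible. Row orthogonality gives a right inverse; squareness holds because a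
  class function orthogonal to all irreducible characters is zero, which is read off from the
  regular representation. The entries of the table then cancel.

  The classes are not found by exhaustive conjugation. Each of 24 representatives comes with a list
  of distinct conjugates; the trace and the exponent \<open>m\<close> modulo 3 keep the classes
  apart; and as the lists contain 648 elements altogether, they are the complete classes.

  Multiplication by the scalar cube roots of unity, which lie in the group, permutes the classes: it
  forms seven triples and fixes the three classes of trace 0. The three values of \<open>p\<close>
  on a triple multiply to a polynomial in \<open>t^3\<close>, and so does their sum of pairwise
  products, which is why the result depends on \<open>t\<close> only through
  \<open>t^3\<close>.\<close>

lemma mtrace_mult_comm:
  assumes "A \<in> carrier_mat n m" "B \<in> carrier_mat m n"
  shows "mtrace (A * B) = mtrace (B * A)"
proof -
  have "mtrace (A * B) = (\<Sum>i<n. \<Sum>k<m. A $$ (i,k) * B $$ (k,i))"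
    unfolding mtrace_def using assms by (auto simp: scalar_prod_def atLeast0LessThan intro!: sum.cong)
  also have "\<dots> = (\<Sum>k<m. \<Sum>i<n. B $$ (k,i) * A $$ (i,k))"
    by (subst sum.swap) (simp add: mult.commute)
  also have "\<dots> = mtrace (B * A)"
    unfolding mtrace_def using assms by (auto simp: scalar_prod_def atLeast0LessThan intro!: sum.cong)
  finally show ?thesis .
qed

text \<open>Cyclicity of the trace. \<open>A\<close> may be rectangular, so that equivalent
  representations can be compared before their dimensions are known to agree.\<close>

lemma mtrace_conj:
  assumes "A \<in> carrier_mat n m" "B \<in> carrier_mat m n" "B * A = 1\<^sub>m m" "S \<in> carrier_mat m m"
  shows "mtrace (A * S * B) = mtrace S"
proof -
  have "mtrace (A * S * B) = mtrace (B * (A * S))"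
    using assms by (intro mtrace_mult_comm[of _ n m]) auto
  also have "B * (A * S) = S"
    using assms by (simp flip: assoc_mult_mat[of B m n A m S m])
  finally show ?thesis .
qed

lemma mtrace_smult_one: "mtrace (c \<cdot>\<^sub>m 1\<^sub>m n) = of_nat n * c"
  by (simp add: mtrace_def)

section \<open>One-sided inverses, injective matrices and bases of subspaces\<close>

lemma mat_eqI_mult_vec:
  assumes A: "(A :: 'a :: semiring_1 mat) \<in> carrier_mat n m" and B: "B \<in> carrier_mat n m"
    and eq: "\<And>v. v \<in> carrier_vec m \<Longrightarrow> A *\<^sub>v v = B *\<^sub>v v"
  shows "A = B"
proof (rule eq_matI)
  fix i j assume "i < dim_row B" "j < dim_col B"
  with A B have ij: "i < n" "j < m" by auto
  have "(A *\<^sub>v unit_vec m j) $ i = (B *\<^sub>v unit_vec m j) $ i" by (simp add: eq)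
  with A B ij show "A $$ (i,j) = B $$ (i,j)" by (simp add: row_def scalar_prod_def if_distrib cong: if_cong)
qed (use A B in auto)

lemma surj_imp_right_inverse:
  assumes A: "(A :: 'a :: semiring_1 mat) \<in> carrier_mat n m"
    and surj: "\<And>v. v \<in> carrier_vec n \<Longrightarrow> \<exists>w\<in>carrier_vec m. A *\<^sub>v w = v"
  shows "\<exists>B\<in>carrier_mat m n. A * B = 1\<^sub>m n"
proof -
  obtain w where w: "\<And>j. j < n \<Longrightarrow> w j \<in> carrier_vec m \<and> A *\<^sub>v w j = unit_vec n j"
    using surj[OF unit_vec_carrier] by metis
  define B where "B = mat m n (\<lambda>(i,j). w j $ i)"
  have B: "B \<in> carrier_mat m n" by (simp add: B_def)
  have colB: "col B j = w j" if "j < n" for j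
    using w[OF that] that by (auto simp: B_def)
  have "A * B = 1\<^sub>m n"
  proof (rule eq_matI)
    fix i j assume "i < dim_row (1\<^sub>m n :: 'a mat)" "j < dim_col (1\<^sub>m n :: 'a mat)"
    hence ij: "i < n" "j < n" by auto
    have "(A * B) $$ (i,j) = (A *\<^sub>v w j) $ i" using A B ij colB by simp
    thus "(A * B) $$ (i,j) = 1\<^sub>m n $$ (i,j)" using w[OF ij(2)] ij by auto
  qed (use A B in auto)
  with B show ?thesis by blast
qed

text \<open>For \<open>mat_of_cols n ws\<close> this is linear independence of \<open>ws\<close>;
  bases are handled as matrices throughout.\<close>

definition inj_mat :: "'a :: comm_ring_1 mat \<Rightarrow> bool" where
  "inj_mat A \<longleftrightarrow> (\<forall>v\<in>carrier_vec (dim_col A). A *\<^sub>v v = 0\<^sub>v (dim_row A) \<longrightarrow> v = 0\<^sub>v (dim_col A))"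

lemma left_inverse_imp_inj_mat:
  assumes A: "A \<in> carrier_mat n m" and B: "B \<in> carrier_mat m n" and BA: "B * A = 1\<^sub>m m"
  shows "inj_mat A"
  unfolding inj_mat_def
proof (intro ballI impI)
  fix v assume v: "v \<in> carrier_vec (dim_col A)" and "A *\<^sub>v v = 0\<^sub>v (dim_row A)"
  hence "B *\<^sub>v (A *\<^sub>v v) = 0\<^sub>v m" using B A by auto
  thus "v = 0\<^sub>v (dim_col A)" using A B v BA by (simp flip: assoc_mult_mat_vec[OF B A])
qed

text \<open>Because \<open>A * B\<close> is the identity, \<open>A\<close> sends
  \<open>B A v\<close> and \<open>v\<close> to the same vector, and injectivity cancels
  \<open>A\<close>. Rectangular \<open>A\<close> is the situation in \<open>schur\<close> and
  \<open>rep_split\<close>, where the two dimensions are a priori different.\<close>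

lemma inj_mat_right_imp_left_inverse:
  assumes A: "A \<in> carrier_mat n m" and B: "B \<in> carrier_mat m n" and AB: "A * B = 1\<^sub>m n"
    and inj: "inj_mat A"
  shows "B * A = 1\<^sub>m m"
proof (rule mat_eqI_mult_vec)
  fix v :: "'a vec" assume v: "v \<in> carrier_vec m"
  have "A *\<^sub>v ((B * A) *\<^sub>v v - v) = A *\<^sub>v ((B * A) *\<^sub>v v) - A *\<^sub>v v"
    using A B v by (intro mult_minus_distrib_mat_vec) auto
  also have "A *\<^sub>v ((B * A) *\<^sub>v v) = (A * B) *\<^sub>v (A *\<^sub>v v)"
    using A B v by (metis assoc_mult_mat_vec mult_carrier_mat mult_mat_vec_carrier)
  also have "\<dots> - A *\<^sub>v v = 0\<^sub>v n" using A B v AB by auto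
  finally have "(B * A) *\<^sub>v v - v = 0\<^sub>v m"
    using inj A minus_carrier_vec[OF mult_mat_vec_carrier[OF mult_carrier_mat[OF B A] v] v]
    by (simp add: inj_mat_def)
  have "((B * A) *\<^sub>v v) $ i = v $ i" if "i < m" for i
  proof -
    have "((B * A) *\<^sub>v v - v) $ i = 0" using \<open>(B * A) *\<^sub>v v - v = 0\<^sub>v m\<close> that by simp
    thus ?thesis using v that by simp
  qed
  thus "(B * A) *\<^sub>v v = 1\<^sub>m m *\<^sub>v v" using v A B by (intro eq_vecI) auto
qed (use A B in auto)

text \<open>With more columns than rows, padding \<open>A\<close> by zero rows gives a square matrix
  of determinant 0, hence a nonzero vector in the kernel.\<close>

lemma inj_mat_dim_le:
  assumes A: "(A :: 'a :: field mat) \<in> carrier_mat n m" and inj: "inj_mat A"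
  shows "m \<le> n"
proof (rule ccontr)
  assume "\<not> m \<le> n"
  hence nm: "n < m" by simp
  define B where "B = mat m m (\<lambda>(i,j). if i < n then A $$ (i,j) else 0)"
  have B: "B \<in> carrier_mat m m" by (simp add: B_def)
  have "row B n = 0\<^sub>v m" using nm by (intro eq_vecI) (auto simp: B_def)
  hence "det B = 0" using det_row_0[OF nm, of "row B"] B
    by (metis (no_types, lifting) carrier_matD(1) carrier_matD(2) det_0_iff_vec_prod_zero[OF B]
        det_transpose[OF B] index_mult_mat_vec nm row_carrier scalar_prod_left_zero transpose_carrier_mat
        laplace_expansion_row[OF B nm] index_row(1) index_zero_vec(1) mult_zero_left sum.neutral lessThan_iff)
  then obtain v where v: "v \<in> carrier_vec m" "v \<noteq> 0\<^sub>v m" "B *\<^sub>v v = 0\<^sub>v m"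
    using det_0_iff_vec_prod_zero[OF B] by auto
  have "A *\<^sub>v v = 0\<^sub>v n"
  proof (rule eq_vecI)
    fix i assume "i < dim_vec (0\<^sub>v n :: 'a vec)"
    hence i: "i < n" by simp
    have "(B *\<^sub>v v) $ i = 0" using v(3) i nm by simp
    moreover have "row B i = row A i" using A i nm by (intro eq_vecI) (auto simp: B_def)
    ultimately show "(A *\<^sub>v v) $ i = 0\<^sub>v n $ i" using A i nm B by simp
  qed (use A in auto)
  thus False using inj A v unfolding inj_mat_def by auto
qed

lemma mat_of_cols_append_mult:
  assumes "x \<in> carrier_vec (length ws)" "y \<in> carrier_vec (length us)"
  shows "mat_of_cols n (ws @ us) *\<^sub>v (x @\<^sub>v y) = mat_of_cols n ws *\<^sub>v x + mat_of_cols n us *\<^sub>v (y :: 'a :: comm_ring_1 vec)"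
proof (rule eq_vecI)
  fix i assume "i < dim_vec (mat_of_cols n ws *\<^sub>v x + mat_of_cols n us *\<^sub>v y)"
  hence i: "i < n" by simp
  have "row (mat_of_cols n (ws @ us)) i = row (mat_of_cols n ws) i @\<^sub>v row (mat_of_cols n us) i"
    using i by (intro eq_vecI) (auto simp: mat_of_cols_def nth_append)
  thus "(mat_of_cols n (ws @ us) *\<^sub>v (x @\<^sub>v y)) $ i = (mat_of_cols n ws *\<^sub>v x + mat_of_cols n us *\<^sub>v y) $ i"
    using i assms by (simp add: scalar_prod_append[of _ "length ws" _ "length us"])
qed simp

lemma mat_of_cols_single_mult:
  assumes "y \<in> carrier_vec 1" "u \<in> carrier_vec n"
  shows "mat_of_cols n [u] *\<^sub>v y = y $ 0 \<cdot>\<^sub>v (u :: 'a :: comm_ring_1 vec)"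
  using assms by (intro eq_vecI) (auto simp: mat_of_cols_def scalar_prod_def)

lemma inj_mat_append:
  assumes inj: "inj_mat (mat_of_cols n ws)" and w: "(w :: 'a :: field vec) \<in> carrier_vec n"
    and new: "\<And>x. x \<in> carrier_vec (length ws) \<Longrightarrow> mat_of_cols n ws *\<^sub>v x \<noteq> w"
  shows "inj_mat (mat_of_cols n (ws @ [w]))"
  unfolding inj_mat_def
proof (intro ballI impI)
  fix v :: "'a vec" assume "v \<in> carrier_vec (dim_col (mat_of_cols n (ws @ [w])))"
    and 0: "mat_of_cols n (ws @ [w]) *\<^sub>v v = 0\<^sub>v (dim_row (mat_of_cols n (ws @ [w])))"
  hence v: "v \<in> carrier_vec (length ws + 1)" by simp
  define x y where "x = vec_first v (length ws)" and "y = vec_last v 1"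
  have xy: "x \<in> carrier_vec (length ws)" "y \<in> carrier_vec 1" "v = x @\<^sub>v y"
    using v by (auto simp: x_def y_def)
  have eq: "mat_of_cols n ws *\<^sub>v x + y $ 0 \<cdot>\<^sub>v w = 0\<^sub>v n"
    using 0 xy w by (simp add: mat_of_cols_append_mult mat_of_cols_single_mult)
  have eq': "(mat_of_cols n ws *\<^sub>v x) $ i + y $ 0 * w $ i = 0" if "i < n" for i
    using arg_cong[OF eq, of "\<lambda>u. u $ i"] that w by simp
  have y0: "y $ 0 = 0"
  proof (rule ccontr)
    \<comment> \<open>A nonzero coefficient of \<open>w\<close> in the relation could be divided
      out, which would put \<open>w\<close> into the span of \<open>ws\<close>.\<close>
    assume "y $ 0 \<noteq> 0"
    have "mat_of_cols n ws *\<^sub>v (- (1 / y $ 0) \<cdot>\<^sub>v x) = - (1 / y $ 0) \<cdot>\<^sub>v (mat_of_cols n ws *\<^sub>v x)"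
      using xy by (intro mult_mat_vec[of _ n "length ws"]) auto
    also have "\<dots> = w"
    proof (rule eq_vecI)
      fix i assume "i < dim_vec w"
      with w have i: "i < n" by simp
      have "(mat_of_cols n ws *\<^sub>v x) $ i = - (y $ 0 * w $ i)" using eq'[OF i] by (simp add: eq_neg_iff_add_eq_0)
      thus "(- (1 / y $ 0) \<cdot>\<^sub>v (mat_of_cols n ws *\<^sub>v x)) $ i = w $ i"
        using i \<open>y $ 0 \<noteq> 0\<close> by simp
    qed (use w in simp)
    finally show False using new[of "- (1 / y $ 0) \<cdot>\<^sub>v x"] xy by simp
  qed
  have "mat_of_cols n ws *\<^sub>v x = 0\<^sub>v n" using eq' y0 by (intro eq_vecI) auto
  hence "x = 0\<^sub>v (length ws)" using inj xy unfolding inj_mat_def by simp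
  moreover have "y = 0\<^sub>v 1" using y0 xy(2) by (intro eq_vecI) auto
  ultimately show "v = 0\<^sub>v (dim_col (mat_of_cols n (ws @ [w])))" using xy(3) by (auto intro!: eq_vecI)
qed

lemma mat_of_cols_mult_in_subspace:
  assumes W: "is_subspace n W" and "set ws \<subseteq> W" and "x \<in> carrier_vec (length ws)"
  shows "mat_of_cols n ws *\<^sub>v x \<in> W"
  using assms(2,3)
proof (induction ws arbitrary: x rule: rev_induct)
  case Nil
  have "mat_of_cols n [] *\<^sub>v x = 0\<^sub>v n" using Nil by (intro eq_vecI) (auto simp: mat_of_cols_def scalar_prod_def)
  thus ?case using W by (simp add: is_subspace_def)
next
  case (snoc w ws)
  define y z where "y = vec_first x (length ws)" and "z = vec_last x 1"
  have yz: "y \<in> carrier_vec (length ws)" "z \<in> carrier_vec 1" "x = y @\<^sub>v z"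
    using snoc.prems by (auto simp: y_def z_def)
  have w: "w \<in> carrier_vec n" "w \<in> W" using W snoc.prems by (auto simp: is_subspace_def)
  have "mat_of_cols n ws *\<^sub>v y \<in> W" using snoc yz by auto
  moreover have "z $ 0 \<cdot>\<^sub>v w \<in> W" using W w by (simp add: is_subspace_def)
  ultimately show ?case
    using W w yz by (simp add: mat_of_cols_append_mult mat_of_cols_single_mult is_subspace_def)
qed

text \<open>Among the lists that keep the columns independent, whose lengths are bounded by
  \<open>n\<close>, one of maximal length must span \<open>W\<close>. The prescribed start
  \<open>vs0\<close> makes it possible to continue a basis of an invariant subspace to the whole
  space.\<close>

lemma extend_to_basis:
  assumes W: "is_subspace n W" and vs0: "set vs0 \<subseteq> W" "inj_mat (mat_of_cols n vs0)"
  shows "\<exists>vs. set vs \<subseteq> W \<and> inj_mat (mat_of_cols n (vs0 @ vs)) \<and>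
    (\<forall>w\<in>W. \<exists>x\<in>carrier_vec (length (vs0 @ vs)). mat_of_cols n (vs0 @ vs) *\<^sub>v x = w)"
proof -
  define P where "P vs \<longleftrightarrow> set vs \<subseteq> W \<and> inj_mat (mat_of_cols n (vs0 @ vs))" for vs
  have bound: "length vs < Suc n" if "P vs" for vs
    using inj_mat_dim_le[OF mat_of_cols_carrier(1), of n "vs0 @ vs"] that by (simp add: P_def)
  have "P []" using vs0 by (simp add: P_def)
  then obtain vs where vs: "P vs" and max: "\<And>us. P us \<Longrightarrow> length us \<le> length vs"
    using ex_has_greatest_nat[of P "[]" length "Suc n"] bound by (metis less_imp_le)
  have "\<exists>x\<in>carrier_vec (length (vs0 @ vs)). mat_of_cols n (vs0 @ vs) *\<^sub>v x = w" if w: "w \<in> W" for w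
  proof (rule ccontr)
    assume "\<not> ?thesis"
    hence "inj_mat (mat_of_cols n ((vs0 @ vs) @ [w]))"
      using vs w W by (intro inj_mat_append) (auto simp: P_def is_subspace_def)
    hence "P (vs @ [w])" using vs w by (simp add: P_def)
    thus False using max by fastforce
  qed
  thus ?thesis using vs P_def by blast
qed

section \<open>Schur orthogonality for finite matrix groups\<close>

lemma zero_mat_mult_vec: "v \<in> carrier_vec m \<Longrightarrow> 0\<^sub>m n m *\<^sub>v v = (0\<^sub>v n :: 'a :: semiring_1 vec)"
  by (intro eq_vecI) auto

text \<open>The type of matrices comprises all sizes and so has no single zero; the sum is taken
  entrywise with explicit dimensions.\<close>

definition msum :: "nat \<Rightarrow> nat \<Rightarrow> ('a \<Rightarrow> complex mat) \<Rightarrow> 'a set \<Rightarrow> complex mat" where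
  "msum n m F S = mat n m (\<lambda>(i,j). \<Sum>g\<in>S. F g $$ (i,j))"

lemma msum_carrier [simp]: "msum n m F S \<in> carrier_mat n m"
  by (simp add: msum_def)

lemma msum_index: "i < n \<Longrightarrow> j < m \<Longrightarrow> msum n m F S $$ (i,j) = (\<Sum>g\<in>S. F g $$ (i,j))"
  by (simp add: msum_def)

lemma msum_cong: "(\<And>g. g \<in> S \<Longrightarrow> F g = F' g) \<Longrightarrow> msum n m F S = msum n m F' S"
  by (simp add: msum_def)

lemma mult_msum:
  assumes "A \<in> carrier_mat k n" "\<And>g. g \<in> S \<Longrightarrow> F g \<in> carrier_mat n m"
  shows "A * msum n m F S = msum k m (\<lambda>g. A * F g) S"
proof (rule eq_matI)
  have d: "dim_row (F g) = n" "dim_col (F g) = m" if "g \<in> S" for g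
    using assms(2)[OF that] by auto
  fix i j assume "i < dim_row (msum k m (\<lambda>g. A * F g) S)" "j < dim_col (msum k m (\<lambda>g. A * F g) S)"
  hence ij: "i < k" "j < m" by (auto simp: msum_def)
  have "(A * msum n m F S) $$ (i,j) = (\<Sum>p\<in>{0..<n}. \<Sum>g\<in>S. A $$ (i,p) * F g $$ (p,j))"
    using assms ij by (simp add: msum_def scalar_prod_def sum_distrib_left)
  also have "\<dots> = (\<Sum>g\<in>S. (A * F g) $$ (i,j))"
    using assms ij by (subst sum.swap) (auto simp: scalar_prod_def d intro!: sum.cong)
  finally show "(A * msum n m F S) $$ (i,j) = msum k m (\<lambda>g. A * F g) S $$ (i,j)"
    using ij by (simp add: msum_def)
qed (use assms in \<open>auto simp: msum_def\<close>)

lemma msum_mult: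
  assumes "A \<in> carrier_mat m k" "\<And>g. g \<in> S \<Longrightarrow> F g \<in> carrier_mat n m"
  shows "msum n m F S * A = msum n k (\<lambda>g. F g * A) S"
proof (rule eq_matI)
  have d: "dim_row (F g) = n" "dim_col (F g) = m" if "g \<in> S" for g
    using assms(2)[OF that] by auto
  fix i j assume "i < dim_row (msum n k (\<lambda>g. F g * A) S)" "j < dim_col (msum n k (\<lambda>g. F g * A) S)"
  hence ij: "i < n" "j < k" by (auto simp: msum_def)
  have "(msum n m F S * A) $$ (i,j) = (\<Sum>p\<in>{0..<m}. \<Sum>g\<in>S. F g $$ (i,p) * A $$ (p,j))"
    using assms ij by (simp add: msum_def scalar_prod_def sum_distrib_right)
  also have "\<dots> = (\<Sum>g\<in>S. (F g * A) $$ (i,j))"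
    using assms ij by (subst sum.swap) (auto simp: scalar_prod_def d intro!: sum.cong)
  finally show "(msum n m F S * A) $$ (i,j) = msum n k (\<lambda>g. F g * A) S $$ (i,j)"
    using ij by (simp add: msum_def)
qed (use assms in \<open>auto simp: msum_def\<close>)

lemma mtrace_msum:
  assumes "\<And>g. g \<in> S \<Longrightarrow> F g \<in> carrier_mat n n"
  shows "mtrace (msum n n F S) = (\<Sum>g\<in>S. mtrace (F g))"
proof -
  have "mtrace (msum n n F S) = (\<Sum>i<n. \<Sum>g\<in>S. F g $$ (i,i))"
    by (simp add: mtrace_def msum_def)
  also have "\<dots> = (\<Sum>g\<in>S. mtrace (F g))"
    using carrier_matD(1)[OF assms] by (subst sum.swap) (simp add: mtrace_def)
  finally show ?thesis .
qed

locale finite_matrix_group =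
  fixes G :: "complex mat set"
  assumes finite_G: "finite G"
    and carrier_G: "g \<in> G \<Longrightarrow> g \<in> carrier_mat 3 3"
    and one_G: "1\<^sub>m 3 \<in> G"
    and mult_G: "g \<in> G \<Longrightarrow> h \<in> G \<Longrightarrow> g * h \<in> G"
    and ex_inv: "g \<in> G \<Longrightarrow> \<exists>h\<in>G. g * h = 1\<^sub>m 3"
begin

text \<open>The same description as in \<open>grp_inv\<close>, for a general group, so that both
  agree literally for \<open>HessG\<close>.\<close>

definition ginv :: "complex mat \<Rightarrow> complex mat" where
  "ginv g = (THE h. h \<in> G \<and> g * h = 1\<^sub>m 3)"

lemma ginv_unique:
  assumes "g \<in> G" "h \<in> G" "g * h = 1\<^sub>m 3" "h' \<in> G" "g * h' = 1\<^sub>m 3"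
  shows "h = h'"
proof -
  have c: "g \<in> carrier_mat 3 3" "h \<in> carrier_mat 3 3" "h' \<in> carrier_mat 3 3"
    using assms carrier_G by auto
  have "h * g = 1\<^sub>m 3" using c assms mat_mult_left_right_inverse by blast
  hence "h * (g * h') = h'" using c by (simp flip: assoc_mult_mat[of h 3 3 g 3 h' 3])
  thus ?thesis using c assms by simp
qed

lemma ginv_eqI: "g \<in> G \<Longrightarrow> h \<in> G \<Longrightarrow> g * h = 1\<^sub>m 3 \<Longrightarrow> ginv g = h"
  unfolding ginv_def using ginv_unique by blast

lemma ginv:
  assumes "g \<in> G"
  shows "ginv g \<in> G" "g * ginv g = 1\<^sub>m 3" "ginv g * g = 1\<^sub>m 3"
proof -
  obtain h where h: "h \<in> G" "g * h = 1\<^sub>m 3" using ex_inv assms by blast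
  hence "ginv g = h" using assms ginv_eqI by blast
  thus "ginv g \<in> G" "g * ginv g = 1\<^sub>m 3" "ginv g * g = 1\<^sub>m 3"
    using h mat_mult_left_right_inverse[OF carrier_G[OF assms] carrier_G[OF h(1)] h(2)] by auto
qed

lemma assoc_G: "a \<in> G \<Longrightarrow> b \<in> G \<Longrightarrow> c \<in> G \<Longrightarrow> (a * b) * c = a * (b * c)"
  using carrier_G assoc_mult_mat by blast

lemma one_mult_G [simp]: "g \<in> G \<Longrightarrow> 1\<^sub>m 3 * g = g" "g \<in> G \<Longrightarrow> g * 1\<^sub>m 3 = g"
  using left_mult_one_mat[OF carrier_G] right_mult_one_mat[OF carrier_G] by blast+

lemma ginv_mult_cancel [simp]:
  "g \<in> G \<Longrightarrow> h \<in> G \<Longrightarrow> ginv g * (g * h) = h"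
  "g \<in> G \<Longrightarrow> h \<in> G \<Longrightarrow> g * (ginv g * h) = h"
  by (simp_all add: ginv flip: assoc_G)

lemma mult_ginv_cancel [simp]:
  "g \<in> G \<Longrightarrow> h \<in> G \<Longrightarrow> (h * g) * ginv g = h"
  "g \<in> G \<Longrightarrow> h \<in> G \<Longrightarrow> (h * ginv g) * g = h"
  by (simp_all add: ginv assoc_G)

lemma bij_mult_left: "h \<in> G \<Longrightarrow> bij_betw (\<lambda>g. h * g) G G"
  by (rule bij_betw_byWitness[of _ "\<lambda>g. ginv h * g"]) (auto intro: mult_G ginv)

lemma bij_mult_right: "h \<in> G \<Longrightarrow> bij_betw (\<lambda>g. g * h) G G"
  by (rule bij_betw_byWitness[of _ "\<lambda>g. g * ginv h"]) (auto intro: mult_G ginv)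

lemma sum_mult_left: "h \<in> G \<Longrightarrow> (\<Sum>g\<in>G. F (h * g)) = (\<Sum>g\<in>G. F g)"
  using sum.reindex_bij_betw[OF bij_mult_left] .

lemma msum_mult_left: "h \<in> G \<Longrightarrow> msum n m (\<lambda>g. F (h * g)) G = msum n m F G"
  unfolding msum_def using sum_mult_left[of h "\<lambda>g. F g $$ _"] by simp

lemma ginv_mult: "g \<in> G \<Longrightarrow> h \<in> G \<Longrightarrow> ginv (g * h) = ginv h * ginv g"
  by (rule ginv_eqI) (auto simp: mult_G ginv assoc_G)

lemma card_G_pos: "card G > 0"
  using finite_G one_G card_gt_0_iff by blast

lemma rep_carrier: "is_rep G n \<rho> \<Longrightarrow> g \<in> G \<Longrightarrow> \<rho> g \<in> carrier_mat n n"
  by (simp add: is_rep_def)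

lemma rep_mult: "is_rep G n \<rho> \<Longrightarrow> g \<in> G \<Longrightarrow> h \<in> G \<Longrightarrow> \<rho> (g * h) = \<rho> g * \<rho> h"
  by (simp add: is_rep_def)

lemma rep_one: "is_rep G n \<rho> \<Longrightarrow> \<rho> (1\<^sub>m 3) = 1\<^sub>m n"
  by (simp add: is_rep_def)

lemma irrep_imp_rep: "is_irrep G n \<rho> \<Longrightarrow> is_rep G n \<rho>"
  by (simp add: is_irrep_def)

lemma irrep_subspace:
  "is_irrep G n \<rho> \<Longrightarrow> is_subspace n W \<Longrightarrow> (\<And>g v. g \<in> G \<Longrightarrow> v \<in> W \<Longrightarrow> \<rho> g *\<^sub>v v \<in> W)
    \<Longrightarrow> W = {0\<^sub>v n} \<or> W = carrier_vec n"
  by (simp add: is_irrep_def)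

text \<open>Kernel and image of an intertwiner are invariant subspaces, so irreducibility of source
  and target leaves only the zero map and bijections.\<close>

lemma schur:
  assumes \<rho>: "is_irrep G n \<rho>" and \<sigma>: "is_irrep G m \<sigma>" and A: "A \<in> carrier_mat n m"
    and comm: "\<And>g. g \<in> G \<Longrightarrow> \<rho> g * A = A * \<sigma> g"
  shows "A = 0\<^sub>m n m \<or> (\<exists>B\<in>carrier_mat m n. A * B = 1\<^sub>m n \<and> B * A = 1\<^sub>m m)"
proof -
  note c\<rho> = rep_carrier[OF irrep_imp_rep[OF \<rho>]] and c\<sigma> = rep_carrier[OF irrep_imp_rep[OF \<sigma>]]
  have cv: "\<rho> g *\<^sub>v (A *\<^sub>v v) = A *\<^sub>v (\<sigma> g *\<^sub>v v)" if "g \<in> G" "v \<in> carrier_vec m" for g v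
    using comm[OF that(1)] assoc_mult_mat_vec[OF c\<rho>[OF that(1)] A that(2)]
      assoc_mult_mat_vec[OF A c\<sigma>[OF that(1)] that(2)] by simp
  have z: "\<rho> g *\<^sub>v 0\<^sub>v n = 0\<^sub>v n" if "g \<in> G" for g
    using c\<rho>[OF that] by (intro eq_vecI) auto
  define K where "K = {v \<in> carrier_vec m. A *\<^sub>v v = 0\<^sub>v n}"
  have "is_subspace m K"
    using A unfolding is_subspace_def K_def
    by (auto simp: mult_add_distrib_mat_vec[OF A] mult_mat_vec[OF A])
  moreover have "\<sigma> g *\<^sub>v v \<in> K" if "g \<in> G" "v \<in> K" for g v
    using that c\<sigma>[of g] cv[of g v] z[of g] by (auto simp: K_def)
  ultimately have "K = {0\<^sub>v m} \<or> K = carrier_vec m" using irrep_subspace[OF \<sigma>] by blast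
  thus ?thesis
  proof
    assume "K = carrier_vec m"
    hence "A *\<^sub>v v = 0\<^sub>v n" if "v \<in> carrier_vec m" for v using that unfolding K_def by blast
    hence "A = 0\<^sub>m n m" using A by (intro mat_eqI_mult_vec) (auto simp: zero_mat_mult_vec)
    thus ?thesis ..
  next
    assume "K = {0\<^sub>v m}"
    hence inj: "inj_mat A" using A by (auto simp: inj_mat_def K_def)
    define I where "I = (\<lambda>v. A *\<^sub>v v) ` carrier_vec m"
    have "is_subspace n I"
      unfolding is_subspace_def
    proof (intro conjI ballI allI)
      show "I \<subseteq> carrier_vec n" using A by (auto simp: I_def)
      have "A *\<^sub>v 0\<^sub>v m = 0\<^sub>v n" using A by auto
      thus "0\<^sub>v n \<in> I" unfolding I_def by (metis imageI zero_carrier_vec)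
      show "v + w \<in> I" if "v \<in> I" "w \<in> I" for v w
      proof -
        from that obtain x y where "x \<in> carrier_vec m" "y \<in> carrier_vec m" "v = A *\<^sub>v x" "w = A *\<^sub>v y"
          by (auto simp: I_def)
        thus ?thesis using mult_add_distrib_mat_vec[OF A, of x y]
          unfolding I_def by (metis add_carrier_vec imageI)
      qed
      show "c \<cdot>\<^sub>v v \<in> I" if "v \<in> I" for c v
      proof -
        from that obtain x where "x \<in> carrier_vec m" "v = A *\<^sub>v x" by (auto simp: I_def)
        thus ?thesis using mult_mat_vec[OF A, of x c]
          unfolding I_def by (metis smult_carrier_vec imageI)
      qed
    qed
    moreover have "\<rho> g *\<^sub>v v \<in> I" if "g \<in> G" "v \<in> I" for g v
      using that c\<sigma>[of g] cv[of g] by (auto simp: I_def intro!: imageI)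
    ultimately have "I = {0\<^sub>v n} \<or> I = carrier_vec n" using irrep_subspace[OF \<rho>] by blast
    thus ?thesis
    proof
      assume "I = {0\<^sub>v n}"
      hence "A *\<^sub>v v = 0\<^sub>v n" if "v \<in> carrier_vec m" for v using that unfolding I_def by blast
      hence "A = 0\<^sub>m n m" using A by (intro mat_eqI_mult_vec) (auto simp: zero_mat_mult_vec)
      thus ?thesis ..
    next
      assume "I = carrier_vec n"
      hence "\<exists>w\<in>carrier_vec m. A *\<^sub>v w = v" if "v \<in> carrier_vec n" for v
        using that unfolding I_def by (metis imageE)
      from surj_imp_right_inverse[OF A this] obtain B
        where "B \<in> carrier_mat m n" "A * B = 1\<^sub>m n" by blast
      thus ?thesis using inj_mat_right_imp_left_inverse[OF A _ _ inj] by blast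
    qed
  qed
qed

lemma schur_equiv:
  assumes \<rho>: "is_irrep G n \<rho>" and \<sigma>: "is_irrep G m \<sigma>" and A: "A \<in> carrier_mat n m"
    and comm: "\<And>g. g \<in> G \<Longrightarrow> \<rho> g * A = A * \<sigma> g" and "A \<noteq> 0\<^sub>m n m" and g: "g \<in> G"
  shows "mtrace (\<rho> g) = mtrace (\<sigma> g)"
proof -
  obtain B where B: "B \<in> carrier_mat m n" "A * B = 1\<^sub>m n" "B * A = 1\<^sub>m m"
    using schur[OF assms(1-4)] assms(5) by blast
  note c\<rho> = rep_carrier[OF irrep_imp_rep[OF \<rho>] g] and c\<sigma> = rep_carrier[OF irrep_imp_rep[OF \<sigma>] g]
  have "\<rho> g = \<rho> g * (A * B)" using c\<rho> B by simp
  also have "\<dots> = \<rho> g * A * B" by (rule assoc_mult_mat[symmetric]) (use A B c\<rho> in auto)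
  also have "\<dots> = A * \<sigma> g * B" using comm[OF g] by simp
  finally show ?thesis using mtrace_conj[OF A B(1) B(3) c\<sigma>] by simp
qed

text \<open>Over the complex numbers \<open>A\<close> has an eigenvalue \<open>k\<close>; the
  intertwiner \<open>A - k\<close> has a kernel and so vanishes. Taking traces expresses
  \<open>k\<close> by \<open>mtrace A\<close>.\<close>

lemma schur_scalar:
  assumes \<rho>: "is_irrep G n \<rho>" and A: "A \<in> carrier_mat n n"
    and comm: "\<And>g. g \<in> G \<Longrightarrow> \<rho> g * A = A * \<rho> g"
  shows "A = (mtrace A / of_nat n) \<cdot>\<^sub>m 1\<^sub>m n"
proof -
  note c\<rho> = rep_carrier[OF irrep_imp_rep[OF \<rho>]]
  have n: "n > 0" using \<rho> by (simp add: is_irrep_def)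
  obtain k where "eigenvalue A k" using spectrum_non_empty[OF A n] by (auto simp: spectrum_def)
  then obtain v where v: "v \<in> carrier_vec n" "v \<noteq> 0\<^sub>v n" "A *\<^sub>v v = k \<cdot>\<^sub>v v"
    using A by (auto simp: eigenvalue_def eigenvector_def)
  define C where "C = A - k \<cdot>\<^sub>m 1\<^sub>m n"
  have C: "C \<in> carrier_mat n n" unfolding C_def by (intro minus_carrier_mat) simp
  have "\<rho> g * C = C * \<rho> g" if "g \<in> G" for g
    using A c\<rho>[OF that] comm[OF that]
    by (simp add: C_def mult_minus_distrib_mat[OF c\<rho>[OF that] A smult_carrier_mat[OF one_carrier_mat]] minus_mult_distrib_mat[OF A smult_carrier_mat[OF one_carrier_mat] c\<rho>[OF that]]
        mult_smult_distrib[OF c\<rho>[OF that] one_carrier_mat] mult_smult_assoc_mat[OF one_carrier_mat c\<rho>[OF that]])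
  moreover have Cv: "C *\<^sub>v v = 0\<^sub>v n"
  proof -
    have "C *\<^sub>v v = A *\<^sub>v v - (k \<cdot>\<^sub>m 1\<^sub>m n) *\<^sub>v v"
      unfolding C_def using A v by (intro minus_mult_distrib_mat_vec) auto
    also have "(k \<cdot>\<^sub>m 1\<^sub>m n) *\<^sub>v v = k \<cdot>\<^sub>v v" using v by (intro eq_vecI) auto
    finally show ?thesis using v by (auto simp: minus_cancel_vec)
  qed
  moreover have "\<not> (\<exists>B\<in>carrier_mat n n. C * B = 1\<^sub>m n \<and> B * C = 1\<^sub>m n)"
    using left_inverse_imp_inj_mat[OF C] C Cv v unfolding inj_mat_def by auto
  ultimately have C0: "C = 0\<^sub>m n n" using schur[OF \<rho> \<rho> C] by blast
  have Ak: "A = k \<cdot>\<^sub>m 1\<^sub>m n"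
  proof (rule eq_matI)
    fix i j assume "i < dim_row (k \<cdot>\<^sub>m 1\<^sub>m n)" "j < dim_col (k \<cdot>\<^sub>m 1\<^sub>m n)"
    moreover from this have "C $$ (i,j) = 0" using C0 by simp
    ultimately show "A $$ (i,j) = (k \<cdot>\<^sub>m 1\<^sub>m n) $$ (i,j)" using A by (simp add: C_def)
  qed (use A in auto)
  thus ?thesis using n by (metis mtrace_smult_one nonzero_mult_div_cancel_left of_nat_0_eq_iff not_gr0)
qed

end

section \<open>Matrix units and traces of matrices of finite order\<close>

definition unit_mat :: "nat \<Rightarrow> nat \<Rightarrow> nat \<Rightarrow> nat \<Rightarrow> complex mat" where
  "unit_mat n m i k = mat n m (\<lambda>(a,b). if a = i \<and> b = k then 1 else 0)"

lemma unit_mat_carrier [simp]: "unit_mat n m i k \<in> carrier_mat n m"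
  by (simp add: unit_mat_def)

text \<open>A matrix unit placed between two representation matrices exposes a product of two matrix
  coefficients; this links sums of such products to entries of averaged intertwiners.\<close>

lemma mult_unit_mat_mult:
  assumes A: "A \<in> carrier_mat n n" and B: "B \<in> carrier_mat m m" and "i < n" "k < m" "p < n" "q < m"
  shows "(A * unit_mat n m i k * B) $$ (p,q) = A $$ (p,i) * B $$ (k,q)"
proof -
  have AE: "(A * unit_mat n m i k) $$ (p,b) = (if b = k then A $$ (p,i) else 0)" if "b < m" for b
    using A assms that by (simp add: unit_mat_def scalar_prod_def if_distrib cong: if_cong)
  have "(A * unit_mat n m i k * B) $$ (p,q) = (\<Sum>b\<in>{0..<m}. (A * unit_mat n m i k) $$ (p,b) * B $$ (b,q))"
    using A B assms by (simp add: scalar_prod_def unit_mat_def)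
  also have "\<dots> = (\<Sum>b\<in>{0..<m}. if b = k then A $$ (p,i) * B $$ (b,q) else 0)"
    by (rule sum.cong) (auto simp: AE)
  also have "\<dots> = A $$ (p,i) * B $$ (k,q)" using assms by simp
  finally show ?thesis .
qed

lemma mtrace_unit_mat: "i < n \<Longrightarrow> mtrace (unit_mat n n i k) = (if i = k then 1 else 0)"
proof -
  assume i: "i < n"
  have "mtrace (unit_mat n n i k) = (\<Sum>j<n. if j = i then (if i = k then 1 else 0) else 0)"
    unfolding mtrace_def unit_mat_def by (auto intro!: sum.cong)
  thus ?thesis using i by simp
qed

lemma upper_triangular_mult:
  assumes B: "(B :: 'a :: semiring_1 mat) \<in> carrier_mat n n" "upper_triangular B"
    and C: "C \<in> carrier_mat n n" "upper_triangular C"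
  shows "upper_triangular (C * B)" "i < n \<Longrightarrow> (C * B) $$ (i,i) = C $$ (i,i) * B $$ (i,i)"
proof -
  have zero: "C $$ (i,p) * B $$ (p,j) = 0" if "p < n" "i < n" "j < n" "j < i \<or> (j = i \<and> p \<noteq> i)" for i j p
    using that upper_triangularD[OF C(2), of p i] upper_triangularD[OF B(2), of j p] B(1) C(1)
    by (cases "p < i") auto
  show "upper_triangular (C * B)"
    using B C by (auto intro!: upper_triangularI sum.neutral simp: scalar_prod_def zero)
  assume i: "i < n"
  have "(C * B) $$ (i,i) = (\<Sum>p\<in>{0..<n}. C $$ (i,p) * B $$ (p,i))"
    using B C i by (simp add: scalar_prod_def)
  also have "\<dots> = C $$ (i,i) * B $$ (i,i)"
    using i by (subst sum.remove[of _ i]) (auto intro!: sum.neutral simp: zero)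
  finally show "(C * B) $$ (i,i) = C $$ (i,i) * B $$ (i,i)" .
qed

lemma upper_triangular_pow:
  assumes B: "(B :: 'a :: comm_semiring_1 mat) \<in> carrier_mat n n" "upper_triangular B"
  shows "upper_triangular (B ^\<^sub>m k) \<and> (\<forall>i<n. (B ^\<^sub>m k) $$ (i,i) = B $$ (i,i) ^ k)"
proof (induction k)
  case 0
  show ?case using B by (auto intro!: upper_triangularI)
next
  case (Suc k)
  have "B ^\<^sub>m k \<in> carrier_mat n n" using B by simp
  with Suc upper_triangular_mult[OF B this] show ?case by (auto simp: mult.commute)
qed

text \<open>\<open>A ^\<^sub>m k\<close> is the inverse of \<open>A\<close>. After triangularisation
  the diagonal entries are roots of unity, for which inverse and complex conjugate coincide.\<close>

lemma mtrace_pow_inverse: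
  assumes A: "(A :: complex mat) \<in> carrier_mat n n" and Ak: "A ^\<^sub>m Suc k = 1\<^sub>m n"
  shows "mtrace (A ^\<^sub>m k) = cnj (mtrace A)"
proof -
  obtain as where "char_poly A = (\<Prod>a\<leftarrow>as. [:- a, 1:])" using char_poly_factorized[OF A] by blast
  then obtain B where B: "B \<in> carrier_mat n n" "upper_triangular B" "similar_mat A B"
    using schur_decomposition_exists[OF A] by blast
  then obtain P Q where w: "similar_mat_wit A B P Q" unfolding similar_mat_def by blast
  note PQ = similar_mat_witD2[OF A w]
  have pow: "A ^\<^sub>m j = P * B ^\<^sub>m j * Q" for j using similar_mat_wit_pow_id[OF w] .
  have tr: "mtrace (A ^\<^sub>m j) = (\<Sum>i<n. B $$ (i,i) ^ j)" for j
  proof -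
    have "mtrace (A ^\<^sub>m j) = mtrace (B ^\<^sub>m j)"
      unfolding pow using PQ B by (intro mtrace_conj[of _ n n]) auto
    also have "\<dots> = (\<Sum>i<n. B $$ (i,i) ^ j)"
      unfolding mtrace_def using B upper_triangular_pow[OF B(1,2), of j] by (auto intro!: sum.cong)
    finally show ?thesis .
  qed
  have "B ^\<^sub>m Suc k = 1\<^sub>m n"
  proof -
    have "similar_mat_wit B A Q P" using w similar_mat_wit_sym by blast
    hence "B ^\<^sub>m Suc k = Q * A ^\<^sub>m Suc k * P" by (rule similar_mat_wit_pow_id)
    thus ?thesis unfolding Ak using PQ by simp
  qed
  hence root: "B $$ (i,i) ^ Suc k = 1" if "i < n" for i
    using upper_triangular_pow[OF B(1,2), of "Suc k"] that by (metis index_one_mat(1))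
  have "B $$ (i,i) ^ k = cnj (B $$ (i,i))" if "i < n" for i
  proof -
    define b where "b = B $$ (i,i)"
    have b: "b ^ Suc k = 1" using root[OF that] by (simp add: b_def)
    hence "norm b = 1" using power_eq_1_iff by blast
    hence "b * cnj b = 1" by (simp add: complex_norm_square[symmetric])
    moreover have "b * b ^ k = 1" using b by simp
    ultimately show ?thesis by (metis b_def mult_cancel_left mult_zero_left zero_neq_one)
  qed
  moreover have "mtrace A = (\<Sum>i<n. B $$ (i,i))" using tr[of 1] A by simp
  ultimately show ?thesis using tr[of k] by simp
qed

section \<open>Averaging over the group and row orthogonality\<close>

context finite_matrix_group
begin

text \<open>The group average of a linear map \<open>E\<close>, without division by the order. It
  always intertwines, so Schur's lemma applies to it.\<close>

definition avg :: "(complex mat \<Rightarrow> complex mat) \<Rightarrow> (complex mat \<Rightarrow> complex mat) \<Rightarrow> nat \<Rightarrow> nat \<Rightarrow> complex mat \<Rightarrow> complex mat" where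
  "avg \<rho> \<sigma> n m E = msum n m (\<lambda>g. \<rho> g * E * \<sigma> (ginv g)) G"

lemma avg_carrier [simp]: "avg \<rho> \<sigma> n m E \<in> carrier_mat n m"
  by (simp add: avg_def)

lemma avg_intertwines:
  assumes \<rho>: "is_rep G n \<rho>" and \<sigma>: "is_rep G m \<sigma>" and E: "E \<in> carrier_mat n m" and h: "h \<in> G"
  shows "\<rho> h * avg \<rho> \<sigma> n m E = avg \<rho> \<sigma> n m E * \<sigma> h"
proof -
  note c\<rho> = rep_carrier[OF \<rho>] and c\<sigma> = rep_carrier[OF \<sigma>]
  have c: "\<rho> g * E * \<sigma> (ginv g) \<in> carrier_mat n m" if "g \<in> G" for g
    using c\<rho>[OF that] c\<sigma>[OF ginv(1)[OF that]] E by auto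
  have "\<rho> h * avg \<rho> \<sigma> n m E = msum n m (\<lambda>g. \<rho> h * (\<rho> g * E * \<sigma> (ginv g))) G"
    unfolding avg_def using c c\<rho>[OF h] by (intro mult_msum) auto
  also have "\<dots> = msum n m (\<lambda>g. \<rho> (h * g) * E * \<sigma> (ginv (h * g) * h)) G"
  proof (rule msum_cong)
    fix g assume g: "g \<in> G"
    note cs = c\<rho>[OF g] c\<rho>[OF h] c\<sigma>[OF ginv(1)[OF g]] E
    have "ginv (h * g) * h = ginv g" using g h by (simp add: ginv_mult ginv)
    moreover have "\<rho> h * (\<rho> g * E * \<sigma> (ginv g)) = \<rho> h * (\<rho> g * E) * \<sigma> (ginv g)"
      using cs by (intro assoc_mult_mat[symmetric, of _ n n _ m _ m]) auto
    moreover have "\<rho> h * (\<rho> g * E) = \<rho> h * \<rho> g * E"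
      using cs by (intro assoc_mult_mat[symmetric, of _ n n _ n _ m]) auto
    ultimately show "\<rho> h * (\<rho> g * E * \<sigma> (ginv g)) = \<rho> (h * g) * E * \<sigma> (ginv (h * g) * h)"
      using rep_mult[OF \<rho> h g] by simp
  qed
  also have "\<dots> = msum n m (\<lambda>g. \<rho> g * E * \<sigma> (ginv g * h)) G"
    using msum_mult_left[OF h, of n m "\<lambda>g. \<rho> g * E * \<sigma> (ginv g * h)"] .
  also have "\<dots> = msum n m (\<lambda>g. \<rho> g * E * \<sigma> (ginv g) * \<sigma> h) G"
  proof (rule msum_cong)
    fix g assume g: "g \<in> G"
    have "\<rho> g * E * (\<sigma> (ginv g) * \<sigma> h) = \<rho> g * E * \<sigma> (ginv g) * \<sigma> h"
      using c\<rho>[OF g] c\<sigma>[OF h] c\<sigma>[OF ginv(1)[OF g]] E by (intro assoc_mult_mat[symmetric, of _ n m _ m _ m]) auto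
    thus "\<rho> g * E * \<sigma> (ginv g * h) = \<rho> g * E * \<sigma> (ginv g) * \<sigma> h"
      using rep_mult[OF \<sigma> ginv(1)[OF g] h] by simp
  qed
  also have "\<dots> = avg \<rho> \<sigma> n m E * \<sigma> h"
    unfolding avg_def using c c\<sigma>[OF h] by (intro msum_mult[symmetric]) auto
  finally show ?thesis .
qed

text \<open>Expanding both traces over diagonal entries, each product of matrix coefficients is one
  entry of the average of a matrix unit.\<close>

lemma char_inner_avg:
  assumes \<rho>: "is_rep G n \<rho>" and \<sigma>: "is_rep G m \<sigma>"
  shows "(\<Sum>g\<in>G. mtrace (\<rho> g) * mtrace (\<sigma> (ginv g))) =
    (\<Sum>i<n. \<Sum>k<m. avg \<rho> \<sigma> n m (unit_mat n m i k) $$ (i,k))"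
proof -
  note c\<rho> = rep_carrier[OF \<rho>] and c\<sigma> = rep_carrier[OF \<sigma>]
  have "(\<Sum>g\<in>G. mtrace (\<rho> g) * mtrace (\<sigma> (ginv g))) =
      (\<Sum>g\<in>G. \<Sum>i<n. \<Sum>k<m. \<rho> g $$ (i,i) * \<sigma> (ginv g) $$ (k,k))"
  proof (rule sum.cong)
    fix g assume g: "g \<in> G"
    have "dim_row (\<rho> g) = n" "dim_row (\<sigma> (ginv g)) = m"
      using c\<rho>[OF g] c\<sigma>[OF ginv(1)[OF g]] by auto
    thus "mtrace (\<rho> g) * mtrace (\<sigma> (ginv g)) = (\<Sum>i<n. \<Sum>k<m. \<rho> g $$ (i,i) * \<sigma> (ginv g) $$ (k,k))"
      by (simp add: mtrace_def sum_product)
  qed simp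
  also have "\<dots> = (\<Sum>i<n. \<Sum>k<m. \<Sum>g\<in>G. \<rho> g $$ (i,i) * \<sigma> (ginv g) $$ (k,k))"
    by (subst sum.swap, rule sum.cong[OF refl], subst sum.swap) simp
  also have "\<dots> = (\<Sum>i<n. \<Sum>k<m. avg \<rho> \<sigma> n m (unit_mat n m i k) $$ (i,k))"
  proof (intro sum.cong refl)
    fix i k assume "i \<in> {..<n}" "k \<in> {..<m}"
    thus "(\<Sum>g\<in>G. \<rho> g $$ (i,i) * \<sigma> (ginv g) $$ (k,k)) = avg \<rho> \<sigma> n m (unit_mat n m i k) $$ (i,k)"
      unfolding avg_def by (simp add: msum_index mult_unit_mat_mult c\<rho> c\<sigma> ginv cong: sum.cong)
  qed
  finally show ?thesis .
qed

text \<open>Inequivalence is expressed by a differing trace: a nonzero intertwiner would force equal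
  traces, so every average is zero. This form fits \<open>irr_chars\<close>, whose elements are
  functions rather than isomorphism classes.\<close>

lemma char_orthogonal:
  assumes \<rho>: "is_irrep G n \<rho>" and \<sigma>: "is_irrep G m \<sigma>"
    and h: "h \<in> G" "mtrace (\<rho> h) \<noteq> mtrace (\<sigma> h)"
  shows "(\<Sum>g\<in>G. mtrace (\<rho> g) * mtrace (\<sigma> (ginv g))) = 0"
proof -
  have "avg \<rho> \<sigma> n m E = 0\<^sub>m n m" if "E \<in> carrier_mat n m" for E
    using schur_equiv[OF \<rho> \<sigma> _ _ _ h(1), of "avg \<rho> \<sigma> n m E"]
      avg_intertwines[OF irrep_imp_rep[OF \<rho>] irrep_imp_rep[OF \<sigma>] that] h(2) by force
  thus ?thesis
    by (simp add: char_inner_avg[OF irrep_imp_rep[OF \<rho>] irrep_imp_rep[OF \<sigma>]])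
qed

text \<open>The average of a matrix unit is scalar, and its trace is the group order times the trace
  of the unit. So the entry in question is \<open>card G / n\<close> for each of the
  \<open>n\<close> diagonal units and 0 for the others.\<close>

lemma char_norm:
  assumes \<rho>: "is_irrep G n \<rho>"
  shows "(\<Sum>g\<in>G. mtrace (\<rho> g) * mtrace (\<rho> (ginv g))) = of_nat (card G)"
proof -
  note rep = irrep_imp_rep[OF \<rho>]
  note c\<rho> = rep_carrier[OF rep]
  have n: "n > 0" using \<rho> by (simp add: is_irrep_def)
  have "avg \<rho> \<rho> n n (unit_mat n n i k) $$ (i,k) = (if i = k then of_nat (card G) / of_nat n else 0)"
    if i: "i < n" and k: "k < n" for i k
  proof -
    define A where "A = avg \<rho> \<rho> n n (unit_mat n n i k)"
    have "mtrace A = (\<Sum>g\<in>G. mtrace (\<rho> g * unit_mat n n i k * \<rho> (ginv g)))"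
      unfolding A_def avg_def
      by (intro mtrace_msum mult_carrier_mat[OF mult_carrier_mat[OF c\<rho> unit_mat_carrier] c\<rho>[OF ginv(1)]])
    also have "\<dots> = (\<Sum>g\<in>G. mtrace (unit_mat n n i k))"
    proof (rule sum.cong)
      fix g assume g: "g \<in> G"
      have "\<rho> (ginv g) * \<rho> g = 1\<^sub>m n"
        using rep_mult[OF rep ginv(1)[OF g] g] rep_one[OF rep] ginv(3)[OF g] by simp
      thus "mtrace (\<rho> g * unit_mat n n i k * \<rho> (ginv g)) = mtrace (unit_mat n n i k)"
        using c\<rho>[OF g] c\<rho>[OF ginv(1)[OF g]] by (intro mtrace_conj[of _ n n]) auto
    qed simp
    also have "\<dots> = (if i = k then of_nat (card G) else 0)" using i by (simp add: mtrace_unit_mat)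
    finally have tr: "mtrace A = (if i = k then of_nat (card G) else 0)" .
    have "A = (mtrace A / of_nat n) \<cdot>\<^sub>m 1\<^sub>m n"
      using schur_scalar[OF \<rho>, of A] avg_intertwines[OF rep rep] by (simp add: A_def)
    hence "A $$ (i,k) = ((mtrace A / of_nat n) \<cdot>\<^sub>m 1\<^sub>m n) $$ (i,k)" by simp
    thus ?thesis using i k tr unfolding A_def[symmetric] by auto
  qed
  thus ?thesis using n by (simp add: char_inner_avg[OF rep rep])
qed

lemma pow_G: "g \<in> G \<Longrightarrow> g ^\<^sub>m k \<in> G"
  using carrier_G[of g] by (induction k) (auto intro: one_G mult_G)

lemma rep_pow: "is_rep G n \<rho> \<Longrightarrow> g \<in> G \<Longrightarrow> \<rho> (g ^\<^sub>m k) = \<rho> g ^\<^sub>m k"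
  using carrier_G[of g] rep_carrier[of n \<rho> g] by (induction k) (auto simp: rep_one rep_mult pow_G)

lemma finite_order:
  assumes g: "g \<in> G"
  shows "\<exists>k. g ^\<^sub>m Suc k = 1\<^sub>m 3"
proof -
  have "\<not> inj (\<lambda>k. g ^\<^sub>m k)"
    using finite_subset[OF _ finite_G, of "range (\<lambda>k. g ^\<^sub>m k)"] pow_G[OF g] finite_imageD
    by (metis image_subsetI infinite_UNIV_nat)
  then obtain i j where "i < j" "g ^\<^sub>m i = g ^\<^sub>m j"
    unfolding inj_def by (metis linorder_neqE_nat)
  then obtain d where d: "g ^\<^sub>m i = g ^\<^sub>m (i + Suc d)" by (metis less_imp_Suc_add add_Suc_right)
  have cancel: "g ^\<^sub>m i = g ^\<^sub>m (i + Suc d) \<Longrightarrow> g ^\<^sub>m Suc d = 1\<^sub>m 3" for i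
  proof (induction i)
    case 0
    thus ?case using carrier_G[OF g] by simp
  next
    case (Suc i)
    hence "g ^\<^sub>m i * g * ginv g = g ^\<^sub>m (i + Suc d) * g * ginv g" by simp
    hence "g ^\<^sub>m i = g ^\<^sub>m (i + Suc d)" using g pow_G[OF g] by (simp only: mult_ginv_cancel)
    thus ?case by (rule Suc.IH)
  qed
  thus ?thesis using d by blast
qed

lemma mtrace_rep_ginv:
  assumes \<rho>: "is_rep G n \<rho>" and g: "g \<in> G"
  shows "mtrace (\<rho> (ginv g)) = cnj (mtrace (\<rho> g))"
proof -
  obtain k where k: "g ^\<^sub>m Suc k = 1\<^sub>m 3" using finite_order[OF g] by blast
  hence "g ^\<^sub>m k * g = 1\<^sub>m 3" by simp
  hence "g * g ^\<^sub>m k = 1\<^sub>m 3" using carrier_G[OF g] mat_mult_left_right_inverse pow_G[OF g] carrier_G by blast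
  hence "ginv g = g ^\<^sub>m k" using ginv_eqI g pow_G by blast
  moreover have "\<rho> g ^\<^sub>m Suc k = 1\<^sub>m n"
    using k rep_pow[OF \<rho> g, of "Suc k"] rep_one[OF \<rho>] by simp
  ultimately show ?thesis
    using rep_pow[OF \<rho> g] mtrace_pow_inverse[OF rep_carrier[OF \<rho> g]] by simp
qed

lemma irr_charsE:
  assumes "\<chi> \<in> irr_chars G"
  obtains n \<rho> where "is_irrep G n \<rho>" "\<And>g. g \<in> G \<Longrightarrow> \<chi> g = mtrace (\<rho> g)" "\<And>g. g \<notin> G \<Longrightarrow> \<chi> g = 0"
  using assms unfolding irr_chars_def by auto

lemma irr_chars_orthonormal:
  assumes \<chi>: "\<chi> \<in> irr_chars G" and \<psi>: "\<psi> \<in> irr_chars G"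
  shows "mult_in G \<chi> \<psi> = (if \<chi> = \<psi> then 1 else 0)"
proof -
  obtain n \<rho> where \<rho>: "is_irrep G n \<rho>" "\<And>g. g \<in> G \<Longrightarrow> \<chi> g = mtrace (\<rho> g)" "\<And>g. g \<notin> G \<Longrightarrow> \<chi> g = 0"
    using irr_charsE[OF \<chi>] by metis
  obtain m \<sigma> where \<sigma>: "is_irrep G m \<sigma>" "\<And>g. g \<in> G \<Longrightarrow> \<psi> g = mtrace (\<sigma> g)" "\<And>g. g \<notin> G \<Longrightarrow> \<psi> g = 0"
    using irr_charsE[OF \<psi>] by metis
  have eq: "mult_in G \<chi> \<psi> = (\<Sum>g\<in>G. \<psi> g * mtrace (\<rho> (ginv g))) / of_nat (card G)"
    unfolding mult_in_def using \<rho> mtrace_rep_ginv[OF irrep_imp_rep[OF \<rho>(1)]] by (simp cong: sum.cong)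
  show ?thesis
  proof (cases "\<chi> = \<psi>")
    case True
    hence "mult_in G \<chi> \<psi> = (\<Sum>g\<in>G. mtrace (\<rho> g) * mtrace (\<rho> (ginv g))) / of_nat (card G)"
      using eq \<rho>(2) by (simp cong: sum.cong)
    thus ?thesis using True char_norm[OF \<rho>(1)] card_G_pos by simp
  next
    case False
    \<comment> \<open>Both functions vanish outside \<open>G\<close>, so distinct characters already
      differ at an element of \<open>G\<close>.\<close>
    then obtain h where "h \<in> G" "mtrace (\<sigma> h) \<noteq> mtrace (\<rho> h)"
      using \<rho> \<sigma> by (metis ext)
    from char_orthogonal[OF \<sigma>(1) \<rho>(1) this] show ?thesis
      using False eq \<sigma>(2) by (simp cong: sum.cong)
  qed
qed

end

section \<open>Completeness of the irreducible characters\<close>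

context finite_matrix_group
begin

text \<open>In a basis adapted to a proper invariant subspace \<open>W\<close> all matrices are
  block upper triangular; the two diagonal blocks are the representations on \<open>W\<close> and on
  the quotient.\<close>

lemma rep_split:
  assumes \<rho>: "is_rep G n \<rho>" and n: "n > 0" and red: "\<not> is_irrep G n \<rho>"
  shows "\<exists>a b \<alpha> \<beta>. a < n \<and> b < n \<and> is_rep G a \<alpha> \<and> is_rep G b \<beta> \<and>
    (\<forall>g\<in>G. mtrace (\<rho> g) = mtrace (\<alpha> g) + mtrace (\<beta> g))"
proof -
  note c\<rho> = rep_carrier[OF \<rho>]
  obtain W where W: "is_subspace n W" and inv: "\<And>g v. g \<in> G \<Longrightarrow> v \<in> W \<Longrightarrow> \<rho> g *\<^sub>v v \<in> W"
    and proper: "W \<noteq> {0\<^sub>v n}" "W \<noteq> carrier_vec n"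
    using red \<rho> n unfolding is_irrep_def by blast
  have Wc: "W \<subseteq> carrier_vec n" using W by (simp add: is_subspace_def)
  have "inj_mat (mat_of_cols n ([] :: complex vec list))"
    unfolding inj_mat_def by (auto intro!: eq_vecI)
  from extend_to_basis[OF W _ this] obtain ws where ws: "set ws \<subseteq> W" "inj_mat (mat_of_cols n ws)"
    "\<And>w. w \<in> W \<Longrightarrow> \<exists>x\<in>carrier_vec (length ws). mat_of_cols n ws *\<^sub>v x = w" by auto
  have full: "is_subspace n (carrier_vec n :: complex vec set)" by (simp add: is_subspace_def)
  from extend_to_basis[OF full _ ws(2)] ws(1) Wc obtain us where us: "set us \<subseteq> carrier_vec n"
    "inj_mat (mat_of_cols n (ws @ us))"
    "\<And>w. w \<in> carrier_vec n \<Longrightarrow> \<exists>x\<in>carrier_vec (length (ws @ us)). mat_of_cols n (ws @ us) *\<^sub>v x = w" by blast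
  define d e where "d = length ws" and "e = length us"
  define P where "P = mat_of_cols n (ws @ us)"
  have P': "P \<in> carrier_mat n (d + e)" unfolding P_def d_def e_def using mat_of_cols_carrier(1)[of n "ws @ us"] by simp
  have "\<exists>w\<in>carrier_vec (d + e). P *\<^sub>v w = v" if "v \<in> carrier_vec n" for v
    using us(3)[OF that] by (simp add: P_def d_def e_def)
  from surj_imp_right_inverse[OF P' this] obtain B where B': "B \<in> carrier_mat (d + e) n" and PB: "P * B = 1\<^sub>m n"
    by blast
  have BP': "B * P = 1\<^sub>m (d + e)"
    using inj_mat_right_imp_left_inverse[OF P' B' PB] us(2) by (simp add: P_def)
  have "d + e \<le> n" using inj_mat_dim_le[OF P'] us(2) by (simp add: P_def)
  moreover have "n \<le> d + e" using inj_mat_dim_le[OF B' left_inverse_imp_inj_mat[OF B' P' PB]] .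
  ultimately have de: "d + e = n" by simp
  note P = P'[unfolded de] and B = B'[unfolded de] and BP = BP'[unfolded de]
  \<comment> \<open>Properness of \<open>W\<close> makes both blocks nonempty, hence both strictly
    smaller than \<open>n\<close>, as the later induction on the dimension requires.\<close>
  have "d > 0"
  proof (rule ccontr)
    assume "\<not> d > 0"
    hence "ws = []" by (simp add: d_def)
    have "w = 0\<^sub>v n" if w: "w \<in> W" for w
    proof -
      obtain x where "x \<in> carrier_vec 0" "mat_of_cols n [] *\<^sub>v x = w" using ws(3)[OF w] \<open>ws = []\<close> by auto
      thus ?thesis by (intro eq_vecI) (auto simp: scalar_prod_def)
    qed
    moreover have "0\<^sub>v n \<in> W" using W by (simp add: is_subspace_def)
    ultimately show False using proper(1) by blast
  qed
  have "e > 0"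
  proof (rule ccontr)
    assume "\<not> e > 0"
    hence "us = []" by (simp add: e_def)
    have "v \<in> W" if v: "v \<in> carrier_vec n" for v
    proof -
      obtain x where "x \<in> carrier_vec (length ws)" "mat_of_cols n ws *\<^sub>v x = v" using us(3)[OF v] \<open>us = []\<close> by auto
      thus ?thesis using mat_of_cols_mult_in_subspace[OF W ws(1)] by blast
    qed
    thus False using proper(2) Wc by blast
  qed
  define C where "C g = B * \<rho> g * P" for g
  have C: "C g \<in> carrier_mat n n" if "g \<in> G" for g using c\<rho>[OF that] B P by (simp add: C_def)
  have C_mult: "C (g * h) = C g * C h" if g: "g \<in> G" and h: "h \<in> G" for g h
  proof -
    have "C g * C h = B * \<rho> g * (P * (B * \<rho> h * P))"
      unfolding C_def using c\<rho>[OF g] c\<rho>[OF h] B P by (intro assoc_mult_mat[of _ n n _ n _ n]) auto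
    also have "P * (B * \<rho> h * P) = P * (B * \<rho> h) * P"
      using c\<rho>[OF h] B P by (intro assoc_mult_mat[symmetric, of _ n n _ n _ n]) auto
    also have "P * (B * \<rho> h) = P * B * \<rho> h"
      using c\<rho>[OF h] B P by (intro assoc_mult_mat[symmetric, of _ n n _ n _ n]) auto
    also have "\<dots> = \<rho> h" using PB c\<rho>[OF h] by simp
    also have "B * \<rho> g * (\<rho> h * P) = B * \<rho> g * \<rho> h * P"
      using c\<rho>[OF g] c\<rho>[OF h] B P by (intro assoc_mult_mat[symmetric, of _ n n _ n _ n]) auto
    also have "B * \<rho> g * \<rho> h = B * (\<rho> g * \<rho> h)"
      using c\<rho>[OF g] c\<rho>[OF h] B P by (intro assoc_mult_mat[of _ n n _ n _ n]) auto
    finally show ?thesis by (simp add: C_def rep_mult[OF \<rho> g h])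
  qed
  have C_one: "C (1\<^sub>m 3) = 1\<^sub>m n" using B P BP by (simp add: C_def rep_one[OF \<rho>])
  have C_tr: "mtrace (C g) = mtrace (\<rho> g)" if "g \<in> G" for g
    unfolding C_def using mtrace_conj[OF B P PB c\<rho>[OF that]] .
  \<comment> \<open>The first \<open>d\<close> columns of \<open>P\<close> lie in \<open>W\<close>,
    and so do their images under \<open>\<rho> g\<close>; in the new basis such vectors have zero
    coordinates from position \<open>d\<close> on.\<close>
  have C_zero: "C g $$ (i,j) = 0" if g: "g \<in> G" and i: "d \<le> i" "i < n" and j: "j < d" for g i j
  proof -
    have jn: "j < n" using i j by simp
    have colP: "col P j = ws ! j" using j jn ws(1) Wc
      by (auto simp: P_def d_def nth_append subset_iff)
    hence "col P j \<in> W" using ws(1) j by (auto simp: d_def)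
    hence "\<rho> g *\<^sub>v col P j \<in> W" using inv[OF g] by blast
    then obtain x where x: "x \<in> carrier_vec d" "mat_of_cols n ws *\<^sub>v x = \<rho> g *\<^sub>v col P j"
      using ws(3) d_def by blast
    have "P *\<^sub>v (x @\<^sub>v 0\<^sub>v e) = \<rho> g *\<^sub>v col P j"
      using x c\<rho>[OF g] unfolding P_def d_def e_def
      by (subst mat_of_cols_append_mult) (auto intro!: eq_vecI)
    hence "B *\<^sub>v (\<rho> g *\<^sub>v col P j) = B *\<^sub>v (P *\<^sub>v (x @\<^sub>v 0\<^sub>v e))" by simp
    also have "\<dots> = (B * P) *\<^sub>v (x @\<^sub>v 0\<^sub>v e)"
      by (rule assoc_mult_mat_vec[symmetric]) (use B P x de append_carrier_vec[of x d "0\<^sub>v e" e] in auto)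
    also have "\<dots> = x @\<^sub>v 0\<^sub>v e" using BP x de append_carrier_vec[of x d "0\<^sub>v e" e] by simp
    finally have "(B *\<^sub>v (\<rho> g *\<^sub>v col P j)) $ i = 0" using i x de by simp
    moreover have "col (C g) j = B *\<^sub>v (\<rho> g *\<^sub>v col P j)"
    proof -
      have "col (C g) j = B * \<rho> g *\<^sub>v col P j"
        unfolding C_def using B P c\<rho>[OF g] jn by (intro col_mult2[of _ n n _ n]) auto
      also have "\<dots> = B *\<^sub>v (\<rho> g *\<^sub>v col P j)"
        using B P c\<rho>[OF g] jn by (intro assoc_mult_mat_vec[of _ n n _ n]) auto
      finally show ?thesis .
    qed
    ultimately have "col (C g) j $ i = 0" by simp
    thus ?thesis using C[OF g] i jn by simp
  qed
  define \<alpha> where "\<alpha> g = mat d d (\<lambda>(i,j). C g $$ (i,j))" for g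
  define \<beta> where "\<beta> g = mat e e (\<lambda>(i,j). C g $$ (i + d, j + d))" for g
  have split_sum: "(\<Sum>k\<in>{0..<n}. F k) = (\<Sum>k\<in>{0..<d}. F k) + (\<Sum>k\<in>{0..<e}. F (k + d))" for F :: "nat \<Rightarrow> complex"
  proof -
    have "(\<Sum>k\<in>{0..<n}. F k) = (\<Sum>k\<in>{0..<d}. F k) + (\<Sum>k\<in>{d..<n}. F k)"
      using de by (intro sum.atLeastLessThan_concat[symmetric]) auto
    also have "(\<Sum>k\<in>{d..<n}. F k) = (\<Sum>k\<in>{0..<e}. F (k + d))"
      using sum.shift_bounds_nat_ivl[of F 0 d e] de by (simp add: add.commute)
    finally show ?thesis .
  qed
  have prod_entry: "C (g * h) $$ (i,j) = (\<Sum>k\<in>{0..<d}. C g $$ (i,k) * C h $$ (k,j)) +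
      (\<Sum>k\<in>{0..<e}. C g $$ (i,k+d) * C h $$ (k+d,j))"
    if "g \<in> G" "h \<in> G" "i < n" "j < n" for g h i j
    using C[OF that(1)] C[OF that(2)] that by (simp add: C_mult scalar_prod_def split_sum)
  have "is_rep G d \<alpha>"
    unfolding is_rep_def
  proof (intro conjI ballI)
    fix g h assume g: "g \<in> G" and h: "h \<in> G"
    show "\<alpha> (g * h) = \<alpha> g * \<alpha> h"
    proof (rule eq_matI)
      fix i j assume "i < dim_row (\<alpha> g * \<alpha> h)" "j < dim_col (\<alpha> g * \<alpha> h)"
      hence ij: "i < d" "j < d" by (auto simp: \<alpha>_def)
      thus "\<alpha> (g * h) $$ (i,j) = (\<alpha> g * \<alpha> h) $$ (i,j)"
        using prod_entry[OF g h, of i j] C_zero[OF h] de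
        by (simp add: \<alpha>_def scalar_prod_def)
    qed (auto simp: \<alpha>_def)
  next
    show "\<alpha> (1\<^sub>m 3) = 1\<^sub>m d" using C_one de by (intro eq_matI) (auto simp: \<alpha>_def)
  qed (simp add: \<alpha>_def)
  moreover have "is_rep G e \<beta>"
    unfolding is_rep_def
  proof (intro conjI ballI)
    fix g h assume g: "g \<in> G" and h: "h \<in> G"
    show "\<beta> (g * h) = \<beta> g * \<beta> h"
    proof (rule eq_matI)
      fix i j assume "i < dim_row (\<beta> g * \<beta> h)" "j < dim_col (\<beta> g * \<beta> h)"
      hence ij: "i < e" "j < e" by (auto simp: \<beta>_def)
      thus "\<beta> (g * h) $$ (i,j) = (\<beta> g * \<beta> h) $$ (i,j)"
        using prod_entry[OF g h, of "i + d" "j + d"] C_zero[OF g] de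
        by (simp add: \<beta>_def scalar_prod_def)
    qed (auto simp: \<beta>_def)
  next
    show "\<beta> (1\<^sub>m 3) = 1\<^sub>m e" using C_one de by (intro eq_matI) (auto simp: \<beta>_def)
  qed (simp add: \<beta>_def)
  moreover have "mtrace (\<rho> g) = mtrace (\<alpha> g) + mtrace (\<beta> g)" if g: "g \<in> G" for g
    using C[OF g] split_sum[of "\<lambda>i. C g $$ (i,i)"]
    unfolding C_tr[OF g, symmetric] by (simp add: mtrace_def \<alpha>_def \<beta>_def atLeast0LessThan)
  moreover have "d < n" "e < n" using de \<open>d > 0\<close> \<open>e > 0\<close> by auto
  ultimately show ?thesis by blast
qed

text \<open>Permutation matrices of left multiplication on an enumeration of \<open>G\<close>; only
  the identity has fixed points.\<close>

lemma exists_regular_rep: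
  "\<exists>\<rho>. is_rep G (card G) \<rho> \<and> (\<forall>g\<in>G. mtrace (\<rho> g) = (if g = 1\<^sub>m 3 then of_nat (card G) else 0))"
proof -
  define N where "N = card G"
  obtain x where x: "bij_betw x {0..<N} G" unfolding N_def using ex_bij_betw_nat_finite[OF finite_G] by blast
  define \<rho> where "\<rho> g = mat N N (\<lambda>(i,j). if g * x j = x i then 1 else 0 :: complex)" for g
  have xG: "x i \<in> G" if "i < N" for i using x that by (auto simp: bij_betw_def)
  have xeq: "x i = x j \<longleftrightarrow> i = j" if "i < N" "j < N" for i j
    using x that by (auto simp: bij_betw_def inj_on_def)
  have "is_rep G N \<rho>"
    unfolding is_rep_def
  proof (intro conjI ballI)
    fix g h assume g: "g \<in> G" and h: "h \<in> G"
    show "\<rho> (g * h) = \<rho> g * \<rho> h"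
    proof (rule eq_matI)
      fix i j assume "i < dim_row (\<rho> g * \<rho> h)" "j < dim_col (\<rho> g * \<rho> h)"
      hence ij: "i < N" "j < N" by (auto simp: \<rho>_def)
      obtain k where k: "k < N" "x k = h * x j"
        using x mult_G[OF h xG[OF ij(2)]] unfolding bij_betw_def by (metis atLeastLessThan_iff imageE)
      have "(\<rho> g * \<rho> h) $$ (i,j) = (\<Sum>l\<in>{0..<N}. (if g * x l = x i then 1 else 0) * (if h * x j = x l then 1 else 0))"
        using ij by (simp add: \<rho>_def scalar_prod_def)
      also have "\<dots> = (\<Sum>l\<in>{0..<N}. if l = k then (if g * x k = x i then 1 else 0) else 0)"
        using k xeq by (intro sum.cong) (auto simp flip: k(2))
      also have "\<dots> = (if g * x k = x i then 1 else 0)" using k by simp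
      also have "\<dots> = \<rho> (g * h) $$ (i,j)" using ij k g h xG by (simp add: \<rho>_def assoc_G)
      finally show "\<rho> (g * h) $$ (i,j) = (\<rho> g * \<rho> h) $$ (i,j)" by simp
    qed (auto simp: \<rho>_def)
  next
    show "\<rho> (1\<^sub>m 3) = 1\<^sub>m N" by (intro eq_matI) (auto simp: \<rho>_def xG xeq)
  qed (simp add: \<rho>_def)
  moreover have "mtrace (\<rho> g) = (if g = 1\<^sub>m 3 then of_nat N else 0)" if g: "g \<in> G" for g
  proof -
    have "g * x i = x i \<longleftrightarrow> g = 1\<^sub>m 3" if "i < N" for i
    proof
      assume "g * x i = x i"
      hence "g * x i * ginv (x i) = x i * ginv (x i)" by simp
      thus "g = 1\<^sub>m 3" using xG[OF that] g by (simp add: ginv)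
    qed (use xG[OF that] in simp)
    hence "mtrace (\<rho> g) = (\<Sum>i<N. if g = 1\<^sub>m 3 then 1 else 0)"
      unfolding mtrace_def \<rho>_def by (intro sum.cong) auto
    thus ?thesis by simp
  qed
  ultimately show ?thesis unfolding N_def by blast
qed

lemma msum_mult_right: "h \<in> G \<Longrightarrow> msum n m (\<lambda>g. F (g * h)) G = msum n m F G"
  unfolding msum_def using sum.reindex_bij_betw[OF bij_mult_right, of h "\<lambda>g. F g $$ _"] by simp

text \<open>By Schur's lemma the operator \<open>\<Sum>\<^sub>g f g \<cdot> \<rho> g\<close> vanishes for every irreducible \<open>\<rho>\<close>. Traces are
  additive along block triangular decompositions, so no complements of invariant subspaces are
  needed to pass to the regular character, which recovers the values of \<open>f\<close>.\<close>

lemma class_function_eq_0: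
  assumes cl: "\<And>g h. g \<in> G \<Longrightarrow> h \<in> G \<Longrightarrow> f (h * g) = f (g * h)"
    and orth: "\<And>\<chi>. \<chi> \<in> irr_chars G \<Longrightarrow> (\<Sum>g\<in>G. f g * \<chi> g) = 0" and k: "k \<in> G"
  shows "f k = 0"
proof -
  have irr: "(\<Sum>g\<in>G. f g * mtrace (\<rho> (g * k))) = 0" if \<rho>: "is_irrep G n \<rho>" and k: "k \<in> G" for n \<rho> k
  proof -
    note rep = irrep_imp_rep[OF \<rho>]
    note c\<rho> = rep_carrier[OF rep]
    define A where "A = msum n n (\<lambda>g. f g \<cdot>\<^sub>m \<rho> g) G"
    have A: "A \<in> carrier_mat n n" by (simp add: A_def)
    have Ak: "A * \<rho> h = msum n n (\<lambda>g. f g \<cdot>\<^sub>m \<rho> (g * h)) G" if h: "h \<in> G" for h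
    proof -
      have "A * \<rho> h = msum n n (\<lambda>g. (f g \<cdot>\<^sub>m \<rho> g) * \<rho> h) G"
        unfolding A_def using c\<rho>[OF h] c\<rho> by (intro msum_mult) auto
      also have "\<dots> = msum n n (\<lambda>g. f g \<cdot>\<^sub>m \<rho> (g * h)) G"
        using h by (intro msum_cong) (simp add: mult_smult_assoc_mat[OF c\<rho> c\<rho>] rep_mult[OF rep])
      finally show ?thesis .
    qed
    have "\<rho> h * A = A * \<rho> h" if h: "h \<in> G" for h
    proof -
      have "\<rho> h * A = msum n n (\<lambda>g. \<rho> h * (f g \<cdot>\<^sub>m \<rho> g)) G"
        unfolding A_def using c\<rho>[OF h] c\<rho> by (intro mult_msum) auto
      \<comment> \<open>Writing \<open>g\<close> as \<open>ginv h * (h * g)\<close> turns the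
        summand into a function of \<open>h * g\<close>, so the sum can be shifted; the class
        property then moves \<open>ginv h\<close> to the other side.\<close>
      also have "\<dots> = msum n n (\<lambda>g. f (ginv h * (h * g)) \<cdot>\<^sub>m \<rho> (h * g)) G"
        using h by (intro msum_cong) (simp add: mult_smult_distrib[OF c\<rho> c\<rho>] rep_mult[OF rep])
      also have "\<dots> = msum n n (\<lambda>g. f (ginv h * g) \<cdot>\<^sub>m \<rho> g) G"
        by (rule msum_mult_left[OF h, of n n "\<lambda>g. f (ginv h * g) \<cdot>\<^sub>m \<rho> g"])
      also have "\<dots> = msum n n (\<lambda>g. f (g * ginv h) \<cdot>\<^sub>m \<rho> g) G"
        using h by (intro msum_cong) (simp add: cl ginv)
      also have "\<dots> = msum n n (\<lambda>g. f (g * h * ginv h) \<cdot>\<^sub>m \<rho> (g * h)) G"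
        by (rule msum_mult_right[OF h, of n n "\<lambda>g. f (g * ginv h) \<cdot>\<^sub>m \<rho> g", symmetric])
      also have "\<dots> = A * \<rho> h"
        unfolding Ak[OF h] using h by (intro msum_cong) simp
      finally show ?thesis .
    qed
    hence A_scalar: "A = (mtrace A / of_nat n) \<cdot>\<^sub>m 1\<^sub>m n" using schur_scalar[OF \<rho> A] by blast
    have tr: "mtrace (f g \<cdot>\<^sub>m \<rho> h) = f g * mtrace (\<rho> h)" if "h \<in> G" for g h
      using c\<rho>[OF that] by (simp add: mtrace_def sum_distrib_left)
    have "mtrace A = (\<Sum>g\<in>G. mtrace (f g \<cdot>\<^sub>m \<rho> g))"
      unfolding A_def using c\<rho> by (intro mtrace_msum) auto
    also have "\<dots> = (\<Sum>g\<in>G. f g * (if g \<in> G then mtrace (\<rho> g) else 0))"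
      by (intro sum.cong) (auto simp: tr)
    also have "\<dots> = 0" using \<rho> by (intro orth) (auto simp: irr_chars_def)
    finally have "A = 0 \<cdot>\<^sub>m 1\<^sub>m n" using A_scalar by simp
    hence "A * \<rho> k = 0 \<cdot>\<^sub>m \<rho> k" using mult_smult_assoc_mat[OF one_carrier_mat c\<rho>[OF k]] c\<rho>[OF k] by simp
    hence "mtrace (A * \<rho> k) = 0" using c\<rho>[OF k] by (simp add: mtrace_def)
    moreover have "mtrace (A * \<rho> k) = (\<Sum>g\<in>G. mtrace (f g \<cdot>\<^sub>m \<rho> (g * k)))"
      unfolding Ak[OF k] using c\<rho> k mult_G by (intro mtrace_msum) auto
    ultimately show ?thesis using k by (simp add: tr mult_G cong: sum.cong)
  qed
  have all: "(\<Sum>g\<in>G. f g * mtrace (\<rho> (g * k))) = 0" if "is_rep G n \<rho>" "k \<in> G" for n \<rho> k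
    using that
  proof (induction n arbitrary: \<rho> rule: less_induct)
    case (less n)
    consider "n = 0" | "is_irrep G n \<rho>" | "n > 0" "\<not> is_irrep G n \<rho>" by blast
    thus ?case
    proof cases
      case 1
      have "dim_row (\<rho> (g * k)) = 0" if "g \<in> G" for g
        using rep_carrier[OF less.prems(1) mult_G[OF that less.prems(2)]] 1 by simp
      thus ?thesis by (simp add: mtrace_def)
    next
      case 2
      thus ?thesis using irr less.prems by blast
    next
      case 3
      then obtain a b \<alpha> \<beta> where ab: "a < n" "b < n" "is_rep G a \<alpha>" "is_rep G b \<beta>"
        "\<And>g. g \<in> G \<Longrightarrow> mtrace (\<rho> g) = mtrace (\<alpha> g) + mtrace (\<beta> g)"
        using rep_split[OF less.prems(1)] by metis
      have "(\<Sum>g\<in>G. f g * mtrace (\<rho> (g * k))) =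
          (\<Sum>g\<in>G. f g * mtrace (\<alpha> (g * k))) + (\<Sum>g\<in>G. f g * mtrace (\<beta> (g * k)))"
        using ab(5) mult_G less.prems by (simp add: sum.distrib distrib_left cong: sum.cong)
      thus ?thesis using less.IH ab less.prems by simp
    qed
  qed
  obtain \<rho> where \<rho>: "is_rep G (card G) \<rho>"
    "\<And>g. g \<in> G \<Longrightarrow> mtrace (\<rho> g) = (if g = 1\<^sub>m 3 then of_nat (card G) else 0)"
    using exists_regular_rep by blast
  have iff: "g * ginv k = 1\<^sub>m 3 \<longleftrightarrow> g = k" if "g \<in> G" for g
  proof
    assume "g * ginv k = 1\<^sub>m 3"
    hence "g * ginv k * k = k" using k by simp
    thus "g = k" using that k by simp
  qed (use k ginv in simp)
  \<comment> \<open>The regular character is supported at the identity, and the translation by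
    \<open>ginv k\<close> moves this support to \<open>g = k\<close>.\<close>
  have "0 = (\<Sum>g\<in>G. f g * mtrace (\<rho> (g * ginv k)))" using all[OF \<rho>(1) ginv(1)[OF k]] by simp
  also have "\<dots> = (\<Sum>g\<in>G. if g = k then f k * of_nat (card G) else 0)"
    using k by (intro sum.cong) (auto simp: \<rho>(2) mult_G ginv iff)
  also have "\<dots> = f k * of_nat (card G)" using k finite_G by simp
  finally show ?thesis using card_G_pos by simp
qed

end

section \<open>The McKay determinants of a finite matrix group\<close>

lemma det_mat_diag: "det (mat_diag n p) = (\<Prod>i<n. p i)"
  by (subst det_upper_triangular[of _ n])
    (auto simp: mat_diag_def prod_list_diag_prod atLeast0LessThan)

text \<open>Up to row \<open>i\<close>, which the minor deletes, \<open>X'\<close> is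
  \<open>X\<close> times a diagonal matrix; deleting column \<open>j\<close> drops the factor
  \<open>p j\<close>.\<close>

lemma cofactor_mult_mat_diag:
  assumes X: "(X :: 'a :: comm_ring_1 mat) \<in> carrier_mat n n" and i: "i < n" and j: "j < n"
    and X': "X' \<in> carrier_mat n n"
    and eq: "\<And>a b. a < n \<Longrightarrow> b < n \<Longrightarrow> a \<noteq> i \<Longrightarrow> X' $$ (a,b) = X $$ (a,b) * p b"
  shows "cofactor X' i j = cofactor X i j * (\<Prod>c\<in>{..<n} - {j}. p c)"
proof -
  obtain m where n: "n = Suc m" using i by (cases n) auto
  have dX: "dim_row X = Suc m" "dim_col X = Suc m" "dim_row X' = Suc m" "dim_col X' = Suc m"
    using X X' n by auto
  have ins: "insert_index a b < Suc m" if "b < m" for a b using that by (auto simp: insert_index_def)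
  have md: "mat_delete Y i j = mat m m (\<lambda>(a,b). Y $$ (insert_index i a, insert_index j b))"
    if "dim_row Y = Suc m" "dim_col Y = Suc m" for Y :: "'a mat"
    using that by (auto simp: mat_delete_def insert_index_def intro!: eq_matI)
  have "mat_delete X' i j = mat_delete X i j * mat_diag m (\<lambda>b. p (insert_index j b))"
  proof -
    have "mat_delete X i j * mat_diag m (\<lambda>b. p (insert_index j b)) =
        mat m m (\<lambda>(a,b). mat_delete X i j $$ (a,b) * p (insert_index j b))"
      using dX by (intro mat_diag_mult_right) (simp add: md)
    also have "\<dots> = mat_delete X' i j"
      using n dX ins eq by (auto simp: md intro!: eq_matI)
    finally show ?thesis by simp
  qed
  moreover have "mat_delete X i j \<in> carrier_mat m m" using dX by (simp add: md)
  ultimately have "det (mat_delete X' i j) = det (mat_delete X i j) * (\<Prod>b<m. p (insert_index j b))"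
    using det_mult[of "mat_delete X i j" m "mat_diag m (\<lambda>b. p (insert_index j b))"]
    by (simp add: det_mat_diag)
  also have "(\<Prod>b<m. p (insert_index j b)) = (\<Prod>c\<in>insert_index j ` {0..<m}. p c)"
    by (subst prod.reindex) (auto simp: insert_index_inj_on atLeast0LessThan)
  also have "insert_index j ` {0..<m} = {..<n} - {j}"
    using insert_index_image[of j m] j n by (auto simp: atLeast0LessThan)
  finally show ?thesis by (simp add: cofactor_def)
qed

text \<open>In the expansion of \<open>X'\<close> along row 0 the cofactors are those of
  \<open>X\<close> times products of the \<open>p c\<close>. The cofactors of \<open>X\<close> are
  known without computation, since the adjugate of \<open>X\<close> is \<open>det X\<close> times
  its inverse \<open>Y\<close>.\<close>

lemma det_first_row_replaced:
  assumes X: "(X :: 'a :: field mat) \<in> carrier_mat n n" and Y: "Y \<in> carrier_mat n n"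
    and XY: "X * Y = 1\<^sub>m n" and n: "0 < n" and X': "X' \<in> carrier_mat n n"
    and row0: "\<And>b. b < n \<Longrightarrow> X' $$ (0,b) = X $$ (0,b)"
    and rows: "\<And>a b. a < n \<Longrightarrow> b < n \<Longrightarrow> a \<noteq> 0 \<Longrightarrow> X' $$ (a,b) = X $$ (a,b) * p b"
  shows "det (X' * Y) = (\<Sum>j<n. X $$ (0,j) * Y $$ (j,0) * (\<Prod>c\<in>{..<n} - {j}. p c))"
proof -
  have det: "det X * det Y = 1" using det_mult[OF X Y] XY by simp
  have YX: "Y * X = 1\<^sub>m n" using mat_mult_left_right_inverse[OF X Y XY] .
  have "adj_mat X = Y * X * adj_mat X" using adj_mat(1)[OF X] YX by simp
  also have "\<dots> = Y * (X * adj_mat X)" using X Y adj_mat(1)[OF X] by simp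
  also have "\<dots> = det X \<cdot>\<^sub>m Y"
    using adj_mat(2)[OF X] mult_smult_distrib[OF Y one_carrier_mat] Y by simp
  finally have adj: "adj_mat X = det X \<cdot>\<^sub>m Y" .
  have cof: "cofactor X 0 j = det X * Y $$ (j,0)" if "j < n" for j
    using arg_cong[OF adj, of "\<lambda>A. A $$ (j,0)"] that n X Y by (simp add: adj_mat_def)
  have "det (X' * Y) = (\<Sum>j<n. X $$ (0,j) * (cofactor X 0 j * (\<Prod>c\<in>{..<n} - {j}. p c))) * det Y"
    using laplace_expansion_row[OF X' n] det_mult[OF X' Y]
      cofactor_mult_mat_diag[OF X n _ X' rows] row0 by simp
  also have "\<dots> = (det X * det Y) * (\<Sum>j<n. X $$ (0,j) * Y $$ (j,0) * (\<Prod>c\<in>{..<n} - {j}. p c))"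
    by (simp add: sum_distrib_left sum_distrib_right cof mult_ac)
  finally show ?thesis using det by simp
qed

section \<open>Conjugacy classes and the character table\<close>

locale matrix_group_classes = finite_matrix_group +
  fixes K :: nat and r :: "nat \<Rightarrow> complex mat" and z :: "nat \<Rightarrow> nat"
  assumes r_G: "c < K \<Longrightarrow> r c \<in> G"
    and class_ex1: "g \<in> G \<Longrightarrow> \<exists>!c. c < K \<and> (\<exists>k\<in>G. k * g = r c * k)"
    and z_card: "c < K \<Longrightarrow> z c = card {g \<in> G. \<exists>k\<in>G. k * g = r c * k}"
begin

definition class_index :: "complex mat \<Rightarrow> nat" where
  "class_index g = (THE c. c < K \<and> (\<exists>k\<in>G. k * g = r c * k))"

lemma class_index:
  assumes "g \<in> G"
  shows "class_index g < K" "\<exists>k\<in>G. k * g = r (class_index g) * k"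
  using theI'[OF class_ex1[OF assms]] unfolding class_index_def by blast+

lemma class_index_eqI: "g \<in> G \<Longrightarrow> c < K \<Longrightarrow> k \<in> G \<Longrightarrow> k * g = r c * k \<Longrightarrow> class_index g = c"
  using the1_equality[OF class_ex1, of g c] unfolding class_index_def by blast

lemma class_index_r: "c < K \<Longrightarrow> class_index (r c) = c"
  using class_index_eqI[OF r_G _ one_G] r_G by simp

text \<open>\<open>h * g\<close> and \<open>g * h\<close> are conjugate via \<open>g\<close>. This
  is the form of the class property that \<open>class_function_eq_0\<close> asks for.\<close>

lemma class_index_conj:
  assumes g: "g \<in> G" and h: "h \<in> G"
  shows "class_index (h * g) = class_index (g * h)"
proof -
  obtain k where k: "k \<in> G" "k * (g * h) = r (class_index (g * h)) * k"
    using class_index(2)[OF mult_G[OF g h]] by blast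
  have "(k * g) * (h * g) = (k * (g * h)) * g" using g h k(1) by (simp add: assoc_G mult_G)
  also have "\<dots> = r (class_index (g * h)) * (k * g)"
    using g h k r_G class_index(1)[OF mult_G[OF g h]] by (simp add: assoc_G mult_G)
  finally show ?thesis
    using class_index_eqI[of "h * g" "class_index (g * h)" "k * g"] g h k class_index(1) mult_G by blast
qed

lemma class_set: "c < K \<Longrightarrow> {g \<in> G. class_index g = c} = {g \<in> G. \<exists>k\<in>G. k * g = r c * k}"
  using class_index class_index_eqI by blast

lemma z_pos: "c < K \<Longrightarrow> z c > 0"
proof -
  assume c: "c < K"
  have "r c \<in> {g \<in> G. class_index g = c}" using c r_G class_index_r by blast
  moreover have "finite {g \<in> G. class_index g = c}" using finite_G by simp
  ultimately show ?thesis unfolding z_card[OF c] class_set[OF c, symmetric] card_gt_0_iff by blast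
qed

lemma sum_classes:
  assumes "\<And>g. g \<in> G \<Longrightarrow> f g = f (r (class_index g))"
  shows "(\<Sum>g\<in>G. f g) = (\<Sum>c<K. of_nat (z c) * (f (r c) :: complex))"
proof -
  have "(\<Sum>g\<in>G. f g) = (\<Sum>c<K. \<Sum>g\<in>{g \<in> G. class_index g = c}. f g)"
    using class_index(1) by (intro sum.group[symmetric]) (auto simp: finite_G)
  also have "\<dots> = (\<Sum>c<K. of_nat (z c) * f (r c))"
  proof (rule sum.cong)
    fix c assume "c \<in> {..<K}"
    hence c: "c < K" by simp
    have "(\<Sum>g\<in>{g \<in> G. class_index g = c}. f g) = (\<Sum>g\<in>{g \<in> G. class_index g = c}. f (r c))"
      using assms by (intro sum.cong) auto
    also have "\<dots> = of_nat (z c) * f (r c)" using z_card[OF c] class_set[OF c] by simp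
    finally show "(\<Sum>g\<in>{g \<in> G. class_index g = c}. f g) = of_nat (z c) * f (r c)" .
  qed simp
  finally show ?thesis .
qed

definition class_fun :: "(complex mat \<Rightarrow> complex) \<Rightarrow> bool" where
  "class_fun f \<longleftrightarrow> (\<forall>g\<in>G. f g = f (r (class_index g)))"

lemma mtrace_rep_class_fun:
  assumes \<rho>: "is_rep G n \<rho>"
  shows "class_fun (\<lambda>g. mtrace (\<rho> g))"
  unfolding class_fun_def
proof
  fix g assume g: "g \<in> G"
  define s where "s = r (class_index g)"
  have s: "s \<in> G" using r_G class_index(1)[OF g] by (simp add: s_def)
  obtain k where k: "k \<in> G" "k * g = s * k" using class_index(2)[OF g] unfolding s_def by blast
  have "g = ginv k * (s * k)" using k g by (metis ginv_mult_cancel(1))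
  hence "mtrace (\<rho> g) = mtrace (\<rho> (ginv k) * \<rho> (s * k))"
    using k s by (simp add: rep_mult[OF \<rho>] ginv mult_G)
  also have "\<dots> = mtrace (\<rho> (s * k) * \<rho> (ginv k))"
    using k s by (intro mtrace_mult_comm[of _ n n] rep_carrier[OF \<rho>] mult_G ginv)
  also have "\<rho> (s * k) * \<rho> (ginv k) = \<rho> (s * k * ginv k)"
    using k s by (intro rep_mult[OF \<rho>, symmetric] ginv mult_G)
  also have "s * k * ginv k = s" using k s by simp
  finally show "mtrace (\<rho> g) = mtrace (\<rho> (r (class_index g)))" by (simp add: s_def)
qed

lemma irr_char_class_fun: "\<chi> \<in> irr_chars G \<Longrightarrow> class_fun \<chi>"
proof -
  assume "\<chi> \<in> irr_chars G"
  then obtain n \<rho> where \<rho>: "is_irrep G n \<rho>" "\<And>g. g \<in> G \<Longrightarrow> \<chi> g = mtrace (\<rho> g)" by (metis irr_charsE)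
  show ?thesis
    unfolding class_fun_def
  proof
    fix g assume g: "g \<in> G"
    have "\<chi> g = mtrace (\<rho> g)" using \<rho>(2)[OF g] .
    also have "\<dots> = mtrace (\<rho> (r (class_index g)))"
      using mtrace_rep_class_fun[OF irrep_imp_rep[OF \<rho>(1)]] g unfolding class_fun_def by blast
    also have "\<dots> = \<chi> (r (class_index g))" using \<rho>(2)[OF r_G[OF class_index(1)[OF g]]] by simp
    finally show "\<chi> g = \<chi> (r (class_index g))" .
  qed
qed

lemma mult_in_classes:
  assumes "class_fun f" "class_fun \<chi>"
  shows "mult_in G \<chi> f = (\<Sum>c<K. f (r c) * (of_nat (z c) / of_nat (card G) * cnj (\<chi> (r c))))"
proof -
  have "(\<Sum>g\<in>G. f g * cnj (\<chi> g)) = (\<Sum>c<K. of_nat (z c) * (f (r c) * cnj (\<chi> (r c))))"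
    using assms by (intro sum_classes) (metis class_fun_def)
  thus ?thesis unfolding mult_in_def by (simp add: sum_divide_distrib mult_ac)
qed

context
  fixes N :: nat and e :: "nat \<Rightarrow> complex mat \<Rightarrow> complex"
  assumes e: "bij_betw e {..<N} (irr_chars G)"
begin

definition char_table :: "complex mat" where
  "char_table = mat N K (\<lambda>(i,c). e i (r c))"

text \<open>The conjugate transpose of the table weighted by relative class sizes, so that row
  orthogonality says exactly that it is a right inverse.\<close>

definition char_table_inv :: "complex mat" where
  "char_table_inv = mat K N (\<lambda>(c,i). of_nat (z c) / of_nat (card G) * cnj (e i (r c)))"

lemma char_table_carrier: "char_table \<in> carrier_mat N K" "char_table_inv \<in> carrier_mat K N"
  by (simp_all add: char_table_def char_table_inv_def)

lemma e_irr: "i < N \<Longrightarrow> e i \<in> irr_chars G"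
  using e by (auto simp: bij_betw_def)

lemma e_class_fun: "i < N \<Longrightarrow> class_fun (e i)"
  using e_irr irr_char_class_fun by blast

lemma e_orthonormal:
  assumes "i < N" "j < N"
  shows "mult_in G (e i) (e j) = (if i = j then 1 else 0)"
proof -
  have "e i = e j \<longleftrightarrow> i = j" using e assms by (auto simp: bij_betw_def inj_on_def)
  thus ?thesis using irr_chars_orthonormal[OF e_irr[OF assms(1)] e_irr[OF assms(2)]] by simp
qed

lemma char_table_right_inverse: "char_table * char_table_inv = 1\<^sub>m N"
proof (rule eq_matI)
  fix i j assume "i < dim_row (1\<^sub>m N :: complex mat)" "j < dim_col (1\<^sub>m N :: complex mat)"
  hence ij: "i < N" "j < N" by auto
  have "(char_table * char_table_inv) $$ (i,j) = mult_in G (e j) (e i)"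
    using ij by (simp add: mult_in_classes e_class_fun char_table_def char_table_inv_def
        scalar_prod_def atLeast0LessThan)
  thus "(char_table * char_table_inv) $$ (i,j) = 1\<^sub>m N $$ (i,j)"
    using ij by (simp add: e_orthonormal)
qed (auto simp: char_table_def char_table_inv_def)

text \<open>A kernel vector, spread over the classes, is a class function orthogonal to all
  irreducible characters, hence zero.\<close>

lemma inj_char_table: "inj_mat char_table"
  unfolding inj_mat_def
proof (intro ballI impI)
  fix v assume v: "v \<in> carrier_vec (dim_col char_table)"
    and 0: "char_table *\<^sub>v v = 0\<^sub>v (dim_row char_table)"
  \<comment> \<open>Dividing by the class size compensates for counting each value once per element
    of the class.\<close>
  define f where "f g = v $ class_index g / of_nat (z (class_index g))" for g
  have "f c = 0" if "c \<in> G" for c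
  proof (rule class_function_eq_0[OF _ _ that])
    show "f (h * g) = f (g * h)" if "g \<in> G" "h \<in> G" for g h
      using class_index_conj[OF that] by (simp add: f_def)
  next
    fix \<chi> assume \<chi>: "\<chi> \<in> irr_chars G"
    then obtain i where i: "i < N" "\<chi> = e i" using e by (auto simp: bij_betw_def)
    have "(\<Sum>g\<in>G. f g * \<chi> g) = (\<Sum>c<K. of_nat (z c) * (f (r c) * \<chi> (r c)))"
    proof (rule sum_classes)
      fix g assume g: "g \<in> G"
      have "f g = f (r (class_index g))" using class_index_r class_index(1)[OF g] by (simp add: f_def)
      moreover have "\<chi> g = \<chi> (r (class_index g))" using irr_char_class_fun[OF \<chi>] g by (simp add: class_fun_def)
      ultimately show "f g * \<chi> g = f (r (class_index g)) * \<chi> (r (class_index g))" by simp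
    qed
    also have "\<dots> = (\<Sum>c<K. e i (r c) * v $ c)"
      using z_pos i by (intro sum.cong) (auto simp: f_def class_index_r)
    also have "\<dots> = (char_table *\<^sub>v v) $ i"
      using i v by (simp add: char_table_def scalar_prod_def atLeast0LessThan)
    also have "\<dots> = 0" unfolding 0 using i by (simp add: char_table_def)
    finally show "(\<Sum>g\<in>G. f g * \<chi> g) = 0" .
  qed
  hence "v $ c = 0" if "c < K" for c
    using r_G[OF that] z_pos[OF that] class_index_r[OF that] by (force simp: f_def)
  thus "v = 0\<^sub>v (dim_col char_table)" using v by (intro eq_vecI) (auto simp: char_table_def)
qed

lemma card_classes_eq: "K = N"
proof (rule antisym)
  show "K \<le> N" using inj_mat_dim_le[OF char_table_carrier(1) inj_char_table] .
  show "N \<le> K"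
    using inj_mat_dim_le[OF char_table_carrier(2)]
      left_inverse_imp_inj_mat[OF char_table_carrier(2,1) char_table_right_inverse] by blast
qed

text \<open>The transpose of \<open>M\<close> factors as \<open>X * D * Y\<close> with the character
  table \<open>X\<close>, its inverse \<open>Y\<close> and the diagonal matrix \<open>D\<close> of
  the values of \<open>p\<close>.\<close>

lemma det_mult_operator:
  assumes p: "class_fun p"
  defines "M \<equiv> mat N N (\<lambda>(i,j). mult_in G (e i) (\<lambda>g. e j g * p g))"
  defines "M0 \<equiv> mat N N (\<lambda>(i,j). if j = 0 then (if i = 0 then 1 else 0) else M $$ (i,j))"
  shows "det M = (\<Prod>c<K. p (r c))"
    and "e 0 = triv_char G \<Longrightarrow>
      det M0 = (\<Sum>c<K. of_nat (z c) / of_nat (card G) * (\<Prod>d\<in>{..<K} - {c}. p (r d)))"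
proof -
  define X Y where "X = char_table" and "Y = char_table_inv"
  have X: "X \<in> carrier_mat N N" and Y: "Y \<in> carrier_mat N N"
    using char_table_carrier card_classes_eq by (simp_all add: X_def Y_def)
  have XY: "X * Y = 1\<^sub>m N" using char_table_right_inverse by (simp add: X_def Y_def)
  have Xi: "X $$ (j,c) = e j (r c)" if "j < N" "c < K" for j c
    using that by (simp add: X_def char_table_def)
  have Yi: "Y $$ (c,j) = of_nat (z c) / of_nat (card G) * cnj (e j (r c))" if "j < N" "c < K" for j c
    using that by (simp add: Y_def char_table_inv_def)
  have entry: "M $$ (i,j) = (\<Sum>c<N. X $$ (j,c) * p (r c) * Y $$ (c,i))" if "i < N" "j < N" for i j
  proof -
    have "class_fun (\<lambda>g. e j g * p g)" using e_class_fun[OF that(2)] p by (simp add: class_fun_def)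
    hence "M $$ (i,j) = (\<Sum>c<K. X $$ (j,c) * p (r c) * Y $$ (c,i))"
      using that by (simp add: M_def Xi Yi mult_in_classes[OF _ e_class_fun[OF that(1)]])
    thus ?thesis by (simp only: card_classes_eq)
  qed
  define D where "D = mat_diag N (\<lambda>c. p (r c))"
  have D: "D \<in> carrier_mat N N" by (simp add: D_def)
  have XD: "X * D = mat N N (\<lambda>(i,c). X $$ (i,c) * p (r c))"
    unfolding D_def by (rule mat_diag_mult_right[OF X])
  have M: "M \<in> carrier_mat N N" by (simp add: M_def)
  have "transpose_mat M = X * D * Y"
    unfolding XD using Y M by (intro eq_matI) (auto simp: entry scalar_prod_def atLeast0LessThan)
  hence "det M = det (X * D * Y)" using det_transpose[OF M] by simp
  also have "\<dots> = det X * det D * det Y" using X D Y by (simp add: det_mult[of _ N])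
  also have "\<dots> = det D * (det X * det Y)" by simp
  also have "det X * det Y = 1" using det_mult[OF X Y] XY by simp
  finally show "det M = (\<Prod>c<K. p (r c))" by (simp add: D_def det_mat_diag card_classes_eq)
  assume e0: "e 0 = triv_char G"
  have N: "0 < N" using class_index(1)[OF one_G] card_classes_eq by simp
  \<comment> \<open>Column 0 of \<open>M0\<close> is the first unit vector, which is also row 0 of
    \<open>X * Y\<close>. Passing from \<open>M\<close> to \<open>M0\<close> thus means leaving row
    0 of \<open>X\<close> unscaled by \<open>p\<close>.\<close>
  define X' where "X' = mat N N (\<lambda>(i,c). if i = 0 then X $$ (i,c) else X $$ (i,c) * p (r c))"
  have X': "X' \<in> carrier_mat N N" by (simp add: X'_def)
  have "transpose_mat M0 = X' * Y"
  proof (rule eq_matI)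
    fix j i assume "j < dim_row (X' * Y)" "i < dim_col (X' * Y)"
    hence ij: "i < N" "j < N" using X' Y by auto
    show "transpose_mat M0 $$ (j,i) = (X' * Y) $$ (j,i)"
    proof (cases "j = 0")
      case True
      have "(X' * Y) $$ (j,i) = (X * Y) $$ (j,i)"
        using ij X Y True by (simp add: X'_def scalar_prod_def)
      thus ?thesis using XY ij True by (simp add: M0_def)
    next
      case False
      thus ?thesis using ij X' Y entry[OF ij]
        by (simp add: M0_def X'_def scalar_prod_def atLeast0LessThan)
    qed
  qed (use X' Y in \<open>auto simp: M0_def\<close>)
  moreover have M0: "M0 \<in> carrier_mat N N" by (simp add: M0_def)
  ultimately have "det M0 = det (X' * Y)" using det_transpose[OF M0] by simp
  also have "\<dots> = (\<Sum>j<N. X $$ (0,j) * Y $$ (j,0) * (\<Prod>c\<in>{..<N} - {j}. p (r c)))"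
    by (rule det_first_row_replaced[OF X Y XY N X']) (auto simp: X'_def)
  also have "\<dots> = (\<Sum>c<K. X $$ (0,c) * Y $$ (c,0) * (\<Prod>d\<in>{..<K} - {c}. p (r d)))"
    by (simp only: card_classes_eq)
  also have "\<dots> = (\<Sum>c<K. of_nat (z c) / of_nat (card G) * (\<Prod>d\<in>{..<K} - {c}. p (r d)))"
    using N r_G by (intro sum.cong) (simp_all add: Xi Yi e0 triv_char_def)
  finally show "det M0 = (\<Sum>c<K. of_nat (z c) / of_nat (card G) * (\<Prod>d\<in>{..<K} - {c}. p (r d)))" .
qed

end

end

section \<open>The Weil representation of SL(2,3)\<close>

lemma eps_powr_9: "eps ^ 9 = 1"
proof -
  have "eps ^ 9 = cis (9 * (4*pi/9))" unfolding eps_def by (subst Complex.DeMoivre) simp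
  also have "9 * (4*pi/9) = 2 * pi * real_of_int 2" by simp
  also have "cis \<dots> = 1" by (rule cis_multiple_2pi) auto
  finally show ?thesis .
qed

lemma omega_eq_eps: "omega = eps ^ 6"
proof -
  have "eps ^ 6 = cis (6 * (4*pi/9))" unfolding eps_def by (subst Complex.DeMoivre) simp
  also have "6 * (4*pi/9) = 2*pi/3 + 2 * pi * real_of_int 1" by simp
  also have "cis \<dots> = cis (2*pi/3) * cis (2 * pi * real_of_int 1)" by (rule cis_mult[symmetric])
  also have "cis (2 * pi * real_of_int 1) = 1" by (rule cis_multiple_2pi) auto
  finally show ?thesis by (simp add: omega_def)
qed

lemma omega_Complex: "omega = Complex (-1/2) (sqrt 3 / 2)"
  by (simp add: omega_def complex_eq_iff cos_120 sin_120)

lemma omega_square: "omega * omega = - 1 - omega"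
  by (simp add: omega_Complex complex_eq_iff real_sqrt_mult_self field_simps)

lemma omega_square': "omega * (omega * x) = - x - omega * x"
proof -
  have "omega * (omega * x) = (omega * omega) * x" by simp
  thus ?thesis by (simp only: omega_square) (simp add: algebra_simps)
qed

lemma omega_cube: "omega ^ 3 = 1"
  by (simp add: power3_eq_cube omega_square algebra_simps)

lemma omega_pow_mod: "omega ^ (n mod 3) = omega ^ n"
proof -
  have "omega ^ n = omega ^ (3 * (n div 3) + n mod 3)" by simp
  also have "\<dots> = omega ^ (n mod 3)" unfolding power_add power_mult omega_cube by simp
  finally show ?thesis by simp
qed

lemma eps_pow_mod: "eps ^ (n mod 9) = eps ^ n"
proof -
  have "eps ^ n = eps ^ (9 * (n div 9) + n mod 9)" by simp
  also have "\<dots> = eps ^ (n mod 9)" unfolding power_add power_mult eps_powr_9 by simp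
  finally show ?thesis by simp
qed

lemma omega_pow_cong: "m mod 3 = n mod 3 \<Longrightarrow> omega ^ m = omega ^ n"
  by (metis omega_pow_mod)

lemma omega_pow_numeral:
  "omega ^ numeral k = (if numeral k mod 3 = (0::nat) then 1 else if numeral k mod 3 = (1::nat) then omega else - 1 - omega)"
proof -
  define n :: nat where "n = numeral k"
  have "n mod 3 = 0 \<or> n mod 3 = 1 \<or> n mod 3 = 2" by auto
  hence "omega ^ n = (if n mod 3 = 0 then 1 else if n mod 3 = 1 then omega else - 1 - omega)"
    by (subst omega_pow_mod[symmetric]) (auto simp: power2_eq_square omega_square)
  thus ?thesis by (simp add: n_def)
qed

lemma eps_ne_0: "eps \<noteq> 0"
  by (simp add: eps_def)

text \<open>The angle \<open>4*pi/9\<close> leads to \<open>2 k = 9 n\<close>, and 2 is invertible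
  modulo 9: \<open>eps\<close> is a primitive ninth root of unity.\<close>

lemma eps_pow_eq_1:
  assumes "eps ^ k = 1"
  shows "k mod 9 = 0"
proof -
  have "cis (real k * (4*pi/9)) = 1" using assms unfolding eps_def by (simp add: Complex.DeMoivre)
  hence "cos (real k * (4*pi/9)) = 1" by (simp add: complex_eq_iff)
  then obtain n :: int where "real k * (4*pi/9) = of_int n * (2*pi)"
    by (auto simp: cos_one_2pi_int)
  hence "real_of_int (2 * int k) = real_of_int (9 * n)" by (simp add: field_simps)
  hence "2 * int k = 9 * n" by linarith
  thus ?thesis by presburger
qed

lemma eps_pow_inj:
  assumes "eps ^ m = eps ^ n" "m < 9" "n < 9"
  shows "m = n"
proof -
  have *: "m = n" if "eps ^ m = eps ^ n" "m \<le> n" "n < 9" for m n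
  proof -
    have "eps ^ m * eps ^ (n - m) = eps ^ n" using that(2) by (simp flip: power_add)
    hence "eps ^ m * eps ^ (n - m) = eps ^ m" using that(1) by simp
    hence "eps ^ (n - m) = 1" using eps_ne_0 by simp
    from eps_pow_eq_1[OF this] show ?thesis using that by simp
  qed
  show ?thesis using *[of m n] *[of n m] assms by (cases "m \<le> n") auto
qed

lemma mat3_eqI:
  assumes "A \<in> carrier_mat 3 3" "B \<in> carrier_mat 3 3"
    and "A $$ (0,0) = B $$ (0,0)" "A $$ (0,1) = B $$ (0,1)" "A $$ (0,2) = B $$ (0,2)"
    and "A $$ (1,0) = B $$ (1,0)" "A $$ (1,1) = B $$ (1,1)" "A $$ (1,2) = B $$ (1,2)"
    and "A $$ (2,0) = B $$ (2,0)" "A $$ (2,1) = B $$ (2,1)" "A $$ (2,2) = B $$ (2,2)"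
  shows "A = B"
proof (rule eq_matI)
  fix i j assume "i < dim_row B" "j < dim_col B"
  hence "i = 0 \<or> i = 1 \<or> i = 2" "j = 0 \<or> j = 1 \<or> j = 2" using assms(2) by auto
  thus "A $$ (i,j) = B $$ (i,j)" using assms by auto
qed (use assms in auto)

lemma mat3_cong:
  assumes "f (0,0) = g (0,0)" "f (0,1) = g (0,1)" "f (0,2) = g (0,2)"
    and "f (1,0) = g (1,0)" "f (1,1) = g (1,1)" "f (1,2) = g (1,2)"
    and "f (2,0) = g (2,0)" "f (2,1) = g (2,1)" "f (2,2) = g (2,2)"
  shows "mat 3 3 f = mat 3 3 g"
  using assms by (intro mat3_eqI) simp_all

lemma mat3_mult:
  "mat 3 3 f * mat 3 3 g = mat 3 3 (\<lambda>(i,j). f (i,0) * g (0,j) + f (i,1) * g (1,j) + f (i,2) * (g (2,j) :: 'a :: semiring_1))"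
  by (intro eq_matI) (auto simp: scalar_prod_def numeral_3_eq_3 numeral_2_eq_2)

type_synonym sl = "nat \<times> nat \<times> nat \<times> nat"

fun sl_mult :: "sl \<Rightarrow> sl \<Rightarrow> sl" where
  "sl_mult (p,q,r,s) (p',q',r',s') =
    ((p*p'+q*r') mod 3, (p*q'+q*s') mod 3, (r*p'+s*r') mod 3, (r*q'+s*s') mod 3)"

fun sl_act :: "sl \<Rightarrow> nat \<times> nat \<Rightarrow> nat \<times> nat" where
  "sl_act (p,q,r,s) (a,b) = ((p*a+q*b) mod 3, (r*a+s*b) mod 3)"

text \<open>Residues are naturals, so 2 stands for -1 and the filter says that the determinant is 1
  modulo 3.\<close>

definition SL :: "sl list" where
  "SL = filter (\<lambda>(p,q,r,s). (p*s+2*q*r) mod 3 = 1)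
    (List.product [0,1,2] (List.product [0,1,2] (List.product [0,1,2] [0,1,2])))"

lemma SL_eq: "SL = [(0,1,2,0),(0,1,2,1),(0,1,2,2),(0,2,1,0),(0,2,1,1),(0,2,1,2),
  (1,0,0,1),(1,0,1,1),(1,0,2,1),(1,1,0,1),(1,1,1,2),(1,1,2,0),
  (1,2,0,1),(1,2,1,0),(1,2,2,2),(2,0,0,2),(2,0,1,2),(2,0,2,2),
  (2,1,0,2),(2,1,1,1),(2,1,2,0),(2,2,0,2),(2,2,1,0),(2,2,2,1)]"
  by code_simp

text \<open>The Legendre symbol modulo 3 on the nonzero residues.\<close>

fun sgn3 :: "nat \<Rightarrow> complex" where
  "sgn3 n = (if n = 1 then 1 else - 1)"

text \<open>The reciprocal of the quadratic Gauss sum \<open>1 + 2 * omega\<close>, which is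
  \<open>i\<close> times the square root of 3.\<close>

definition inv_theta :: complex where
  "inv_theta = - (1 + 2 * omega) / 3"

lemma inv_theta_eq: "1 / (complex_of_real (sqrt 3) * \<i>) = inv_theta"
  by (simp add: inv_theta_def omega_Complex complex_eq_iff Re_divide Im_divide power2_eq_square real_div_sqrt field_simps)

definition heis :: "nat \<times> nat \<Rightarrow> complex mat" where
  "heis v = mat 3 3 (\<lambda>(j,k). if k mod 3 = (j + snd v) mod 3 then omega ^ (fst v * j + 2 * fst v * snd v) else 0)"

text \<open>The Gauss sum normalisation is the one for which \<open>weil\<close> is multiplicative on SL(2,3), where
  \<open>(p,q,r,s)\<close> is the matrix with rows \<open>(p,q)\<close>, \<open>(r,s)\<close>. The twist \<open>2 * fst v * snd v\<close> in \<open>heis\<close>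
  makes the relation \<open>weil \<sigma> * heis v = heis (\<sigma> v) * weil \<sigma>\<close> hold without a scalar factor.\<close>

fun weil :: "sl \<Rightarrow> complex mat" where
  "weil (p,q,r,s) = mat 3 3 (\<lambda>(j,k).
    if r = 0 then (if j = (p * k) mod 3 then sgn3 p * omega ^ (q*p*j*j) else 0)
    else sgn3 r * inv_theta * omega ^ (r*(p*j*j + j*k + s*k*k)))"

text \<open>The matrices through which the generators \<open>V\<close> and \<open>U\<close> act on
  the Heisenberg group; together they generate SL(2,3).\<close>

abbreviation "sV \<equiv> (0,2,1,0) :: sl"
abbreviation "sU \<equiv> (1,2,0,1) :: sl"

lemma weil_carrier [simp]: "weil \<sigma> \<in> carrier_mat 3 3"
  by (cases \<sigma>) simp

lemma heis_carrier [simp]: "heis v \<in> carrier_mat 3 3"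
  by (simp add: heis_def)

lemma V_eq: "V = weil sV"
  by (rule mat3_eqI) (simp_all add: V_def mat3_def inv_theta_eq omega_pow_numeral power2_eq_square omega_square)

section \<open>Exact arithmetic with Eisenstein integers\<close>

type_synonym eisenstein = "int \<times> int"

fun ev_eis :: "eisenstein \<Rightarrow> complex" where
  "ev_eis (a,b) = of_int a + of_int b * omega"

fun eis_add :: "eisenstein \<Rightarrow> eisenstein \<Rightarrow> eisenstein" where
  "eis_add (a,b) (c,d) = (a + c, b + d)"

fun eis_mult :: "eisenstein \<Rightarrow> eisenstein \<Rightarrow> eisenstein" where
  "eis_mult (a,b) (c,d) = (a * c - b * d, a * d + b * c - b * d)"

definition eis_omega_pow :: "nat \<Rightarrow> eisenstein" where
  "eis_omega_pow n = (if n mod 3 = 0 then (1,0) else if n mod 3 = 1 then (0,1) else (-1,-1))"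

lemma ev_eis_add: "ev_eis (eis_add x y) = ev_eis x + ev_eis y"
  by (cases x; cases y) (simp add: algebra_simps)

lemma ev_eis_mult: "ev_eis (eis_mult x y) = ev_eis x * ev_eis y"
  by (cases x; cases y) (simp add: omega_square omega_square' algebra_simps)

lemma ev_eis_omega_pow: "ev_eis (eis_omega_pow n) = omega ^ n"
proof -
  have "n mod 3 = 0 \<or> n mod 3 = 1 \<or> n mod 3 = 2" by auto
  thus ?thesis
    by (subst omega_pow_mod[symmetric]) (auto simp: eis_omega_pow_def power2_eq_square omega_square)
qed

text \<open>The factor 3 clears the denominators, so that products can be evaluated with integer arithmetic.\<close>

fun weil3 :: "sl \<Rightarrow> nat \<Rightarrow> nat \<Rightarrow> eisenstein" where
  "weil3 (p,q,r,s) j k =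
    (if r = 0 then (if j = (p * k) mod 3 then eis_mult (if p = 1 then (3,0) else (-3,0)) (eis_omega_pow (q*p*j*j)) else (0,0))
     else eis_mult (if r = 1 then (-1,-2) else (1,2)) (eis_omega_pow (r*(p*j*j + j*k + s*k*k))))"

lemma weil_eq_weil3: "weil \<sigma> = mat 3 3 (\<lambda>(j,k). ev_eis (weil3 \<sigma> j k) / 3)"
  by (cases \<sigma>) (auto simp: ev_eis_mult ev_eis_omega_pow inv_theta_def intro!: eq_matI)

text \<open>The product of two \<open>weil3\<close> matrices carries the factor 9, which the extra
  \<open>(3,0)\<close> restores on the right.\<close>

definition weil_mult_check :: "sl \<Rightarrow> sl \<Rightarrow> bool" where
  "weil_mult_check \<sigma> \<tau> = list_all (\<lambda>j. list_all (\<lambda>k.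
     eis_add (eis_mult (weil3 \<sigma> j 0) (weil3 \<tau> 0 k))
       (eis_add (eis_mult (weil3 \<sigma> j 1) (weil3 \<tau> 1 k)) (eis_mult (weil3 \<sigma> j 2) (weil3 \<tau> 2 k)))
     = eis_mult (3,0) (weil3 (sl_mult \<sigma> \<tau>) j k)) [0,1,2]) [0,1,2]"

lemma weil_mult_check_imp:
  assumes "weil_mult_check \<sigma> \<tau>"
  shows "weil \<sigma> * weil \<tau> = weil (sl_mult \<sigma> \<tau>)"
proof -
  have "ev_eis (weil3 \<sigma> j 0) * ev_eis (weil3 \<tau> 0 k) + (ev_eis (weil3 \<sigma> j 1) * ev_eis (weil3 \<tau> 1 k)
      + ev_eis (weil3 \<sigma> j 2) * ev_eis (weil3 \<tau> 2 k)) = 3 * ev_eis (weil3 (sl_mult \<sigma> \<tau>) j k)"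
    if "j \<in> {0,1,2}" "k \<in> {0,1,2}" for j k
  proof -
    have "eis_add (eis_mult (weil3 \<sigma> j 0) (weil3 \<tau> 0 k))
       (eis_add (eis_mult (weil3 \<sigma> j 1) (weil3 \<tau> 1 k)) (eis_mult (weil3 \<sigma> j 2) (weil3 \<tau> 2 k)))
     = eis_mult (3,0) (weil3 (sl_mult \<sigma> \<tau>) j k)"
      using assms that unfolding weil_mult_check_def by auto
    from arg_cong[OF this, of ev_eis] show ?thesis
      by (simp only: ev_eis_add ev_eis_mult) simp
  qed
  note * = this
  show ?thesis
    unfolding weil_eq_weil3 mat3_mult
    by (intro eq_matI) (use * in \<open>auto simp: less_Suc_eq numeral_3_eq_3 numeral_2_eq_2 field_simps\<close>)
qed

text \<open>Only products with a generator on the left are evaluated, 48 in place of all 576; the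
  remaining ones follow by induction over words and associativity.\<close>

lemma weil_V_check: "list_all (weil_mult_check sV) SL" by code_simp
lemma weil_U_check: "list_all (weil_mult_check sU) SL" by code_simp

lemma mod_linear_comb:
  "(a * (x mod n) + b * (y mod n)) mod n = (a * x + b * y) mod (n :: nat)"
  "((x mod n) * a + (y mod n) * b) mod n = (x * a + y * b) mod (n :: nat)"
  by (metis mod_add_eq mod_mult_right_eq) (metis mod_add_eq mod_mult_left_eq)

lemma sl_mult_assoc: "sl_mult (sl_mult \<sigma> \<tau>) \<rho> = sl_mult \<sigma> (sl_mult \<tau> \<rho>)"
  by (cases \<sigma>; cases \<tau>; cases \<rho>) (simp only: sl_mult.simps mod_linear_comb, simp add: algebra_simps)

lemma sl_act_mult: "sl_act (sl_mult \<sigma> \<tau>) v = sl_act \<sigma> (sl_act \<tau> v)"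
  by (cases \<sigma>; cases \<tau>; cases v) (simp only: sl_mult.simps sl_act.simps mod_linear_comb, simp add: algebra_simps)

lemma SL_mult_check: "list_all (\<lambda>\<sigma>. list_all (\<lambda>\<tau>. sl_mult \<sigma> \<tau> \<in> set SL) SL) SL"
  by code_simp

lemma SL_mult: "\<sigma> \<in> set SL \<Longrightarrow> \<tau> \<in> set SL \<Longrightarrow> sl_mult \<sigma> \<tau> \<in> set SL"
  using SL_mult_check by (simp add: list_all_iff)

lemma sV_sU_SL: "sV \<in> set SL" "sU \<in> set SL" "(1,0,0,1) \<in> set SL"
  by (simp_all add: SL_eq)

definition sl_word :: "bool list \<Rightarrow> sl" where
  "sl_word w = foldr (\<lambda>b. sl_mult (if b then sV else sU)) w (1,0,0,1)"

text \<open>One word per element, in the order of \<open>SL_eq\<close>, with \<open>True\<close> for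
  \<open>sV\<close> and \<open>False\<close> for \<open>sU\<close>: a certificate that these two
  generate SL(2,3).\<close>

lemma SL_words_check: "SL = map sl_word [[True,True,True],
    [True,False,True,True],
    [False,True,False,True],
    [True],
    [True,False,False],
    [True,False],
    [],
    [True,False,True,True,True],
    [False,True,False,True,True],
    [False,False],
    [False,False,True,False],
    [False,True,True,True],
    [False],
    [False,False,True],
    [False,False,True,False,True],
    [True,True],
    [False,True,False],
    [True,False,True],
    [False,True,True],
    [False,True,False,False],
    [True,False,True,False],
    [False,False,True,True],
    [False,True],
    [True,False,True,False,False]]"
  unfolding sl_word_def by code_simp

text \<open>Turns the generation of SL(2,3) into an induction rule: identities for
  \<open>weil\<close> only have to survive left multiplication by the two generators.\<close>

lemma SL_induct [consumes 1, case_names one V U]: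
  assumes \<sigma>: "\<sigma> \<in> set SL" and one: "P (1,0,0,1)"
    and V: "\<And>\<sigma>. \<sigma> \<in> set SL \<Longrightarrow> P \<sigma> \<Longrightarrow> P (sl_mult sV \<sigma>)"
    and U: "\<And>\<sigma>. \<sigma> \<in> set SL \<Longrightarrow> P \<sigma> \<Longrightarrow> P (sl_mult sU \<sigma>)"
  shows "P \<sigma>"
proof -
  have "sl_word w \<in> set SL \<and> P (sl_word w)" for w
  proof (induction w)
    case Nil
    show ?case using one sV_sU_SL by (simp add: sl_word_def)
  next
    case (Cons b w)
    have "sl_word (b # w) = sl_mult (if b then sV else sU) (sl_word w)" by (simp add: sl_word_def)
    thus ?case using Cons V U SL_mult sV_sU_SL by (cases b) simp_all
  qed
  thus ?thesis using \<sigma> unfolding SL_words_check by auto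
qed

lemma sl_one_mult: "\<sigma> \<in> set SL \<Longrightarrow> sl_mult (1,0,0,1) \<sigma> = \<sigma>"
proof -
  have "list_all (\<lambda>\<sigma>. sl_mult (1,0,0,1) \<sigma> = \<sigma>) SL" by code_simp
  thus "\<sigma> \<in> set SL \<Longrightarrow> sl_mult (1,0,0,1) \<sigma> = \<sigma>" by (simp add: list_all_iff)
qed

lemma weil_one: "weil (1,0,0,1) = 1\<^sub>m 3"
  by (intro eq_matI) auto

lemma weil_V_mult: "\<sigma> \<in> set SL \<Longrightarrow> weil sV * weil \<sigma> = weil (sl_mult sV \<sigma>)"
  using weil_V_check by (auto simp: list_all_iff intro!: weil_mult_check_imp simp del: weil.simps)

lemma weil_U_mult: "\<sigma> \<in> set SL \<Longrightarrow> weil sU * weil \<sigma> = weil (sl_mult sU \<sigma>)"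
  using weil_U_check by (auto simp: list_all_iff intro!: weil_mult_check_imp simp del: weil.simps)

lemma weil_mult:
  assumes "\<sigma> \<in> set SL" "\<tau> \<in> set SL"
  shows "weil \<sigma> * weil \<tau> = weil (sl_mult \<sigma> \<tau>)"
  using assms(1)
proof (induction \<sigma> rule: SL_induct)
  case one
  show ?case by (simp only: weil_one sl_one_mult[OF assms(2)] left_mult_one_mat[OF weil_carrier])
next
  case (V \<sigma>)
  have "weil (sl_mult sV \<sigma>) * weil \<tau> = weil sV * weil \<sigma> * weil \<tau>"
    by (simp only: weil_V_mult[OF V(1)])
  also have "\<dots> = weil sV * (weil \<sigma> * weil \<tau>)" by (rule assoc_mult_mat) (rule weil_carrier)+
  also have "\<dots> = weil (sl_mult (sl_mult sV \<sigma>) \<tau>)"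
    by (simp only: V(2) weil_V_mult[OF SL_mult[OF V(1) assms(2)]] sl_mult_assoc)
  finally show ?case .
next
  case (U \<sigma>)
  have "weil (sl_mult sU \<sigma>) * weil \<tau> = weil sU * weil \<sigma> * weil \<tau>"
    by (simp only: weil_U_mult[OF U(1)])
  also have "\<dots> = weil sU * (weil \<sigma> * weil \<tau>)" by (rule assoc_mult_mat) (rule weil_carrier)+
  also have "\<dots> = weil (sl_mult (sl_mult sU \<sigma>) \<tau>)"
    by (simp only: U(2) weil_U_mult[OF SL_mult[OF U(1) assms(2)]] sl_mult_assoc)
  finally show ?case .
qed

section \<open>The Heisenberg group and the action of SL(2,3) on it\<close>

lemma omega_pow_mult_mod:
  "omega ^ (j * (x mod 3)) = omega ^ (j * x)" "omega ^ ((x mod 3) * j) = omega ^ (x * j)"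
  by (rule omega_pow_cong, simp add: mod_simps)+

lemma mod3_shift_iff:
  assumes "l < 3" "k < (3::nat)"
  shows "k = (l + b) mod 3 \<longleftrightarrow> l = (k + 2 * b) mod 3"
proof -
  have "((l + b) mod 3 + 2 * b) mod 3 = (l + 3 * b) mod 3" "((k + 2 * b) mod 3 + b) mod 3 = (k + 3 * b) mod 3"
    by (simp_all add: mod_simps)
  thus ?thesis using assms by auto
qed

lemma heis_mult_index:
  assumes A: "A \<in> carrier_mat 3 n" and jk: "j < 3" "k < n"
  shows "(heis (a,b) * A) $$ (j,k) = omega ^ (a * j + 2 * a * b) * A $$ ((j + b) mod 3, k)"
proof -
  have "(heis (a,b) * A) $$ (j,k) = (\<Sum>l\<in>{0..<3}. heis (a,b) $$ (j,l) * A $$ (l,k))"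
    using A jk by (simp add: scalar_prod_def heis_def)
  also have "\<dots> = (\<Sum>l\<in>{0..<3}. if l = (j + b) mod 3 then omega ^ (a * j + 2 * a * b) * A $$ (l,k) else 0)"
    using jk by (intro sum.cong) (auto simp: heis_def)
  also have "\<dots> = omega ^ (a * j + 2 * a * b) * A $$ ((j + b) mod 3, k)" by simp
  finally show ?thesis .
qed

lemma mult_heis_index:
  assumes A: "A \<in> carrier_mat n 3" and jk: "j < n" "k < 3"
  shows "(A * heis (a,b)) $$ (j,k) = A $$ (j, (k + 2 * b) mod 3) * omega ^ (a * (k + 2 * b) + 2 * a * b)"
proof -
  have iff: "k = (l + b) mod 3 \<longleftrightarrow> l = (k + 2 * b) mod 3" if "l < 3" for l
    using mod3_shift_iff[OF that jk(2)] .
  have "(A * heis (a,b)) $$ (j,k) = (\<Sum>l\<in>{0..<3}. A $$ (j,l) * heis (a,b) $$ (l,k))"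
    using A jk by (simp add: scalar_prod_def heis_def)
  also have "\<dots> = (\<Sum>l\<in>{0..<3}. if l = (k + 2 * b) mod 3 then A $$ (j,l) * omega ^ (a * l + 2 * a * b) else 0)"
    using jk iff by (intro sum.cong) (auto simp: heis_def)
  also have "\<dots> = A $$ (j, (k + 2 * b) mod 3) * omega ^ (a * ((k + 2 * b) mod 3) + 2 * a * b)" by simp
  finally show ?thesis by (simp only: power_add omega_pow_mult_mod)
qed

lemma heis_mod: "heis (a mod 3, b mod 3) = heis (a, b)"
proof -
  have "omega ^ (a mod 3 * j + 2 * (a mod 3) * (b mod 3)) = omega ^ (a * j + 2 * a * b)" for j
    by (rule omega_pow_cong, intro mod_add_cong mod_mult_cong) auto
  thus ?thesis unfolding heis_def by (intro cong_mat) (auto simp: mod_simps)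
qed

lemma heis_zero: "heis (0,0) = 1\<^sub>m 3"
  by (intro eq_matI) (auto simp: heis_def)

text \<open>The symplectic form \<open>a d - b c\<close> modulo 3. Thanks to the twist in
  \<open>heis\<close> it is the cocycle itself, and the cocycle is invariant under SL(2,3).\<close>

definition heis_form :: "nat \<times> nat \<Rightarrow> nat \<times> nat \<Rightarrow> nat" where
  "heis_form v w = fst v * snd w + 2 * snd v * fst w"

definition heis_add :: "nat \<times> nat \<Rightarrow> nat \<times> nat \<Rightarrow> nat \<times> nat" where
  "heis_add v w = ((fst v + fst w) mod 3, (snd v + snd w) mod 3)"

lemma heis_mult: "heis v * heis w = omega ^ heis_form v w \<cdot>\<^sub>m heis (heis_add v w)"
proof -
  obtain a b c d where vw: "v = (a,b)" "w = (c,d)" by (cases v; cases w)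
  have "heis (a,b) * heis (c,d) = omega ^ (a * d + 2 * b * c) \<cdot>\<^sub>m heis (a + c, b + d)"
  proof (rule eq_matI)
    fix j k assume "j < dim_row (omega ^ (a * d + 2 * b * c) \<cdot>\<^sub>m heis (a + c, b + d))"
      "k < dim_col (omega ^ (a * d + 2 * b * c) \<cdot>\<^sub>m heis (a + c, b + d))"
    hence jk: "j < 3" "k < 3" by (auto simp: heis_def)
    have "omega ^ (a * j + 2 * a * b) * omega ^ (c * ((j + b) mod 3) + 2 * c * d)
        = omega ^ (a * j + 2 * a * b + (c * (j + b) + 2 * c * d))"
      by (simp only: power_add omega_pow_mult_mod mult.assoc)
    also have "\<dots> = omega ^ (a * d + 2 * b * c + ((a + c) * j + 2 * (a + c) * (b + d)))"
    proof (rule omega_pow_cong)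
      have "a * d + 2 * b * c + ((a + c) * j + 2 * (a + c) * (b + d)) =
          a * j + 2 * a * b + (c * (j + b) + 2 * c * d) + 3 * (a * d + b * c)"
        by (simp add: algebra_simps)
      thus "(a * j + 2 * a * b + (c * (j + b) + 2 * c * d)) mod 3 =
          (a * d + 2 * b * c + ((a + c) * j + 2 * (a + c) * (b + d))) mod 3"
        by (simp only: mod_mult_self2)
    qed
    finally have "omega ^ (a * j + 2 * a * b) * omega ^ (c * ((j + b) mod 3) + 2 * c * d) =
      omega ^ (a * d + 2 * b * c) * omega ^ ((a + c) * j + 2 * (a + c) * (b + d))"
      by (simp only: power_add)
    thus "(heis (a,b) * heis (c,d)) $$ (j,k) = (omega ^ (a * d + 2 * b * c) \<cdot>\<^sub>m heis (a + c, b + d)) $$ (j,k)"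
      using jk by (simp add: heis_mult_index[OF heis_carrier]) (simp add: heis_def mod_simps add.assoc)
  qed (simp_all add: heis_def)
  thus ?thesis unfolding vw heis_form_def heis_add_def by (simp add: heis_mod)
qed

text \<open>\<open>weil sV\<close> is the Fourier matrix: it exchanges cyclic shifts with
  multiplications by characters, which is the rotation of \<open>(a,b)\<close> to
  \<open>(-b,a)\<close>.\<close>

lemma weil_V_heis: "weil sV * heis (a,b) = heis (sl_act sV (a,b)) * weil sV"
proof -
  have sV: "weil sV $$ (j,k) = inv_theta * omega ^ (j * k)" if "j < 3" "k < 3" for j k
    using that by simp
  have "weil sV * heis (a,b) = heis (2 * b, a) * weil sV"
  proof (rule eq_matI)
    fix j k assume "j < dim_row (heis (2 * b, a) * weil sV)" "k < dim_col (heis (2 * b, a) * weil sV)"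
    hence jk: "j < 3" "k < 3" by (auto simp: heis_def)
    have "(weil sV * heis (a,b)) $$ (j,k) = inv_theta * omega ^ (j * (k + 2 * b) + (a * (k + 2 * b) + 2 * a * b))"
      using jk by (simp only: mult_heis_index[OF weil_carrier] sV mod_less_divisor power_add omega_pow_mult_mod mult.assoc zero_less_numeral)
    moreover have "(heis (2 * b, a) * weil sV) $$ (j,k) = inv_theta * omega ^ (2 * b * j + 2 * (2 * b) * a + (j + a) * k)"
      using jk by (simp only: heis_mult_index[OF weil_carrier] sV mod_less_divisor power_add omega_pow_mult_mod mult_ac zero_less_numeral)
    moreover have "j * (k + 2 * b) + (a * (k + 2 * b) + 2 * a * b) = 2 * b * j + 2 * (2 * b) * a + (j + a) * k"
      by (simp add: algebra_simps)
    ultimately show "(weil sV * heis (a,b)) $$ (j,k) = (heis (2 * b, a) * weil sV) $$ (j,k)" by metis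
  qed (simp_all add: heis_def)
  thus ?thesis by (simp add: heis_mod)
qed

text \<open>\<open>weil sU\<close> multiplies by a quadratic phase; moved past a shift by
  \<open>b\<close> it leaves a linear phase, which is the shear of \<open>a\<close> by
  \<open>2 * b\<close>.\<close>

lemma weil_U_heis: "weil sU * heis (a,b) = heis (sl_act sU (a,b)) * weil sU"
proof -
  have sU: "weil sU $$ (j,k) = (if j = k then omega ^ (2 * j * j) else 0)" if "j < 3" "k < 3" for j k
    using that by simp
  have "weil sU * heis (a,b) = heis (a + 2 * b, b) * weil sU"
  proof (rule eq_matI)
    fix j k assume "j < dim_row (heis (a + 2 * b, b) * weil sU)" "k < dim_col (heis (a + 2 * b, b) * weil sU)"
    hence jk: "j < 3" "k < 3" by (auto simp: heis_def)
    have iff: "j = (k + 2 * b) mod 3 \<longleftrightarrow> (j + b) mod 3 = k" using mod3_shift_iff[OF jk, of b] by metis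
    have L: "(weil sU * heis (a,b)) $$ (j,k) =
        (if (j + b) mod 3 = k then omega ^ (2 * j * j) * omega ^ (a * (k + 2 * b) + 2 * a * b) else 0)"
      unfolding mult_heis_index[OF weil_carrier jk]
      using sU[of j "(k + 2 * b) mod 3"] jk iff by (simp del: weil.simps)
    have R: "(heis (a + 2 * b, b) * weil sU) $$ (j,k) =
        (if (j + b) mod 3 = k then omega ^ ((a + 2 * b) * j + 2 * (a + 2 * b) * b) * omega ^ (2 * k * k) else 0)"
      unfolding heis_mult_index[OF weil_carrier jk]
      using sU[of "(j + b) mod 3" k] jk by (simp del: weil.simps)
    have "omega ^ (2 * j * j + (a * (k + 2 * b) + 2 * a * b)) = omega ^ ((a + 2 * b) * j + 2 * (a + 2 * b) * b + 2 * k * k)"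
      if k: "(j + b) mod 3 = k"
    proof (rule omega_pow_cong)
      have "(2 * j * j + (a * (k + 2 * b) + 2 * a * b)) mod 3 = (2 * j * j + (a * ((j + b) + 2 * b) + 2 * a * b)) mod 3"
        using k jk(2) by (intro mod_add_cong mod_mult_cong) simp_all
      moreover have "((a + 2 * b) * j + 2 * (a + 2 * b) * b + 2 * k * k) mod 3 =
          ((a + 2 * b) * j + 2 * (a + 2 * b) * b + 2 * (j + b) * (j + b)) mod 3"
        using k jk(2) by (intro mod_add_cong mod_mult_cong) simp_all
      \<comment> \<open>The exponents agree only modulo 3; adding suitable multiples of 3 on both
        sides gives an exact identity of naturals.\<close>
      moreover have "(a + 2 * b) * j + 2 * (a + 2 * b) * b + 2 * (j + b) * (j + b) + 3 * (a * b) =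
         2 * j * j + (a * ((j + b) + 2 * b) + 2 * a * b) + 3 * (2 * b * j + 2 * b * b)"
        by (simp add: algebra_simps)
      ultimately show "(2 * j * j + (a * (k + 2 * b) + 2 * a * b)) mod 3 =
          ((a + 2 * b) * j + 2 * (a + 2 * b) * b + 2 * k * k) mod 3"
        by (metis mod_mult_self2)
    qed
    thus "(weil sU * heis (a,b)) $$ (j,k) = (heis (a + 2 * b, b) * weil sU) $$ (j,k)"
      unfolding L R by (simp add: power_add)
  qed (simp_all add: heis_def)
  thus ?thesis by (simp add: heis_mod)
qed

lemma weil_heis: "\<sigma> \<in> set SL \<Longrightarrow> weil \<sigma> * heis v = heis (sl_act \<sigma> v) * weil \<sigma>"
proof (induction \<sigma> rule: SL_induct)
  case one
  show ?case by (cases v) (simp only: weil_one sl_act.simps, simp add: heis_mod left_mult_one_mat[OF heis_carrier] right_mult_one_mat[OF heis_carrier])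
next
  case (V \<sigma>)
  have "weil (sl_mult sV \<sigma>) * heis v = weil sV * weil \<sigma> * heis v" by (simp only: weil_V_mult[OF V(1)])
  also have "\<dots> = weil sV * (weil \<sigma> * heis v)" by (rule assoc_mult_mat) (rule weil_carrier heis_carrier)+
  also have "\<dots> = weil sV * heis (sl_act \<sigma> v) * weil \<sigma>" unfolding V(2)
    by (rule assoc_mult_mat[symmetric]) (rule weil_carrier heis_carrier)+
  also have "weil sV * heis (sl_act \<sigma> v) = heis (sl_act sV (sl_act \<sigma> v)) * weil sV"
    using weil_V_heis[of "fst (sl_act \<sigma> v)" "snd (sl_act \<sigma> v)"] by (simp only: prod.collapse)
  also have "\<dots> * weil \<sigma> = heis (sl_act sV (sl_act \<sigma> v)) * (weil sV * weil \<sigma>)"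
    by (rule assoc_mult_mat) (rule weil_carrier heis_carrier)+
  finally show ?case by (simp only: weil_V_mult[OF V(1)] sl_act_mult)
next
  case (U \<sigma>)
  have "weil (sl_mult sU \<sigma>) * heis v = weil sU * weil \<sigma> * heis v" by (simp only: weil_U_mult[OF U(1)])
  also have "\<dots> = weil sU * (weil \<sigma> * heis v)" by (rule assoc_mult_mat) (rule weil_carrier heis_carrier)+
  also have "\<dots> = weil sU * heis (sl_act \<sigma> v) * weil \<sigma>" unfolding U(2)
    by (rule assoc_mult_mat[symmetric]) (rule weil_carrier heis_carrier)+
  also have "weil sU * heis (sl_act \<sigma> v) = heis (sl_act sU (sl_act \<sigma> v)) * weil sU"
    using weil_U_heis[of "fst (sl_act \<sigma> v)" "snd (sl_act \<sigma> v)"] by (simp only: prod.collapse)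
  also have "\<dots> * weil \<sigma> = heis (sl_act sU (sl_act \<sigma> v)) * (weil sU * weil \<sigma>)"
    by (rule assoc_mult_mat) (rule weil_carrier heis_carrier)+
  finally show ?case by (simp only: weil_U_mult[OF U(1)] sl_act_mult)
qed

section \<open>Normal forms in the Hessian group\<close>

type_synonym hess = "nat \<times> (nat \<times> nat) \<times> sl"

lemma one_smult_mat: "(1 :: 'a :: semiring_1) \<cdot>\<^sub>m A = A"
  by (rule eq_matI) auto

lemma smult_smult_mat: "a \<cdot>\<^sub>m (b \<cdot>\<^sub>m A) = (a * b :: 'a :: semigroup_mult) \<cdot>\<^sub>m A"
  by (rule eq_matI) (auto simp: mult.assoc)

fun hess_mat :: "hess \<Rightarrow> complex mat" where
  "hess_mat (m,v,\<sigma>) = eps ^ m \<cdot>\<^sub>m (heis v * weil \<sigma>)"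

text \<open>The factor 6 turns the Heisenberg phase into a power of \<open>eps\<close>, because
  \<open>omega = eps ^ 6\<close>.\<close>

fun hess_mult :: "hess \<Rightarrow> hess \<Rightarrow> hess" where
  "hess_mult (m,v,\<sigma>) (n,w,\<tau>) =
    ((m + n + 6 * heis_form v (sl_act \<sigma> w)) mod 9, heis_add v (sl_act \<sigma> w), sl_mult \<sigma> \<tau>)"

text \<open>The homomorphism from SL(2,3) onto the integers modulo 3 with value 0 at
  \<open>sV\<close> and 1 at \<open>sU\<close>, the exponents of \<open>eps\<close> in
  \<open>V\<close> and \<open>U\<close>. The factor \<open>1 + 2*r*r\<close> is 1 for
  \<open>r = 0\<close> and 0 modulo 3 otherwise, so the formula is a case distinction:
  \<open>2*q*s\<close> or \<open>2*r*(p+s)\<close>.\<close>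

fun sl_char :: "sl \<Rightarrow> nat" where
  "sl_char (p,q,r,s) = (2 * ((1 + 2*r*r) * (q*s) + r * (p+s))) mod 3"

definition hess_list :: "hess list" where
  "hess_list = map (\<lambda>(\<sigma>,k,a,b). (sl_char \<sigma> + 3 * k, (a,b), \<sigma>))
    (List.product SL (List.product [0,1,2] (List.product [0,1,2] [0,1,2])))"

definition sl_inv :: "sl \<Rightarrow> sl" where
  "sl_inv = (\<lambda>(p,q,r,s). (s, (2*q) mod 3, (2*r) mod 3, p))"

text \<open>Here 8 and 2 are -1 modulo 9 and 3. No phase correction appears because the symplectic
  form vanishes on \<open>v\<close> and \<open>-v\<close>.\<close>

fun hess_inv :: "hess \<Rightarrow> hess" where
  "hess_inv (m,(a,b),\<sigma>) = ((8*m) mod 9, sl_act (sl_inv \<sigma>) (2*a, 2*b), sl_inv \<sigma>)"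

lemma hess_mat_carrier [simp]: "hess_mat x \<in> carrier_mat 3 3"
  by (cases x) (auto intro!: smult_carrier_mat mult_carrier_mat heis_carrier weil_carrier simp del: weil.simps)

lemma hess_mat_mult:
  assumes "\<sigma> \<in> set SL" "\<tau> \<in> set SL"
  shows "hess_mat (m,v,\<sigma>) * hess_mat (n,w,\<tau>) = hess_mat (hess_mult (m,v,\<sigma>) (n,w,\<tau>))"
proof -
  note c = heis_carrier weil_carrier mult_carrier_mat[OF heis_carrier weil_carrier]
  have "heis v * weil \<sigma> * (heis w * weil \<tau>) = heis v * (weil \<sigma> * (heis w * weil \<tau>))"
    by (rule assoc_mult_mat) (rule c)+
  also have "weil \<sigma> * (heis w * weil \<tau>) = weil \<sigma> * heis w * weil \<tau>"
    by (rule assoc_mult_mat[symmetric]) (rule c)+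
  also have "\<dots> = heis (sl_act \<sigma> w) * (weil \<sigma> * weil \<tau>)"
    unfolding weil_heis[OF assms(1)] by (rule assoc_mult_mat) (rule c)+
  also have "heis v * \<dots> = heis v * heis (sl_act \<sigma> w) * weil (sl_mult \<sigma> \<tau>)"
    unfolding weil_mult[OF assms] by (rule assoc_mult_mat[symmetric]) (rule c)+
  also have "\<dots> = omega ^ heis_form v (sl_act \<sigma> w) \<cdot>\<^sub>m (heis (heis_add v (sl_act \<sigma> w)) * weil (sl_mult \<sigma> \<tau>))"
    unfolding heis_mult by (rule mult_smult_assoc_mat) (rule c)+
  finally have *: "heis v * weil \<sigma> * (heis w * weil \<tau>) = \<dots>" .
  have "hess_mat (m,v,\<sigma>) * hess_mat (n,w,\<tau>) = eps ^ m \<cdot>\<^sub>m (heis v * weil \<sigma> * (eps ^ n \<cdot>\<^sub>m (heis w * weil \<tau>)))"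
    unfolding hess_mat.simps by (rule mult_smult_assoc_mat) (rule c smult_carrier_mat)+
  also have "heis v * weil \<sigma> * (eps ^ n \<cdot>\<^sub>m (heis w * weil \<tau>)) = eps ^ n \<cdot>\<^sub>m (heis v * weil \<sigma> * (heis w * weil \<tau>))"
    by (rule mult_smult_distrib) (rule c)+
  also have "eps ^ m \<cdot>\<^sub>m \<dots> = eps ^ (m + n + 6 * heis_form v (sl_act \<sigma> w)) \<cdot>\<^sub>m (heis (heis_add v (sl_act \<sigma> w)) * weil (sl_mult \<sigma> \<tau>))"
    unfolding * smult_smult_mat
    by (simp only: omega_eq_eps power_add power_mult mult.assoc)
  also have "\<dots> = hess_mat (hess_mult (m,v,\<sigma>) (n,w,\<tau>))"
    by (simp only: hess_mult.simps hess_mat.simps eps_pow_mod)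
  finally show ?thesis .
qed

lemma sl_char_less: "sl_char \<sigma> < 3"
  by (cases \<sigma>) simp

lemma dvd_3_less_9:
  assumes "k < 9" "k mod 3 = (0::nat)"
  shows "k \<in> {0,3,6}"
proof -
  obtain q where q: "k = 3 * q" using assms(2) by (auto simp: mod_eq_0_iff_dvd dvd_def)
  hence "q = 0 \<or> q = 1 \<or> q = 2" using assms(1) by auto
  thus ?thesis using q by auto
qed

lemma in_hess_list_iff:
  "(m,v,\<sigma>) \<in> set hess_list \<longleftrightarrow> m < 9 \<and> fst v \<in> {0,1,2} \<and> snd v \<in> {0,1,2} \<and> \<sigma> \<in> set SL \<and> m mod 3 = sl_char \<sigma>"
proof -
  have "(\<exists>k\<in>{0,1,2}. m = sl_char \<sigma> + 3 * k) \<longleftrightarrow> m < 9 \<and> m mod 3 = sl_char \<sigma>"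
  proof
    assume "m < 9 \<and> m mod 3 = sl_char \<sigma>"
    hence "m = sl_char \<sigma> + 3 * (m div 3)" "m div 3 < 3"
      using mult_div_mod_eq[of 3 m] less_mult_imp_div_less[of m 3 3] by linarith+
    moreover from this(2) have "m div 3 \<in> {0,1,2}" by auto
    ultimately show "\<exists>k\<in>{0,1,2}. m = sl_char \<sigma> + 3 * k" by blast
  next
    assume "\<exists>k\<in>{0,1,2}. m = sl_char \<sigma> + 3 * k"
    then obtain k where k: "k \<in> {0,1,2}" "m = sl_char \<sigma> + 3 * k" by blast
    have "m mod 3 = sl_char \<sigma>" using sl_char_less[of \<sigma>] by (simp only: k(2) mod_mult_self2 mod_less)
    thus "m < 9 \<and> m mod 3 = sl_char \<sigma>" using sl_char_less[of \<sigma>] k by auto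
  qed
  moreover obtain a b where v: "v = (a,b)" by (cases v)
  have "(m,(a,b),\<sigma>) \<in> set (map (\<lambda>(\<sigma>,k,a,b). (sl_char \<sigma> + 3 * k, (a,b), \<sigma>))
      (List.product SL (List.product ys (List.product ys ys)))) \<longleftrightarrow>
    (\<exists>k\<in>set ys. m = sl_char \<sigma> + 3 * k) \<and> a \<in> set ys \<and> b \<in> set ys \<and> \<sigma> \<in> set SL" for ys
    by (force simp del: sl_char.simps)
  from this[of "[0,1,2]"] have "(m,v,\<sigma>) \<in> set hess_list \<longleftrightarrow>
    (\<exists>k\<in>{0,1,2}. m = sl_char \<sigma> + 3 * k) \<and> a \<in> {0,1,2} \<and> b \<in> {0,1,2} \<and> \<sigma> \<in> set SL"
    by (simp only: hess_list_def list.set v)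
  ultimately show ?thesis by (simp only: v fst_conv snd_conv) blast
qed

lemma distinct_hess_list: "distinct hess_list"
proof -
  have "distinct SL" by (simp add: SL_eq)
  thus ?thesis unfolding hess_list_def
    by (intro distinct_map[THEN iffD2] conjI distinct_product) (auto simp: inj_on_def)
qed

lemma length_hess_list: "length hess_list = 648"
  by (simp add: hess_list_def SL_eq)

lemma sl_char_check: "list_all (\<lambda>\<sigma>. list_all (\<lambda>\<tau>. sl_char (sl_mult \<sigma> \<tau>) = (sl_char \<sigma> + sl_char \<tau>) mod 3) SL) SL"
  by code_simp

lemma sl_char_mult: "\<sigma> \<in> set SL \<Longrightarrow> \<tau> \<in> set SL \<Longrightarrow> sl_char (sl_mult \<sigma> \<tau>) = (sl_char \<sigma> + sl_char \<tau>) mod 3"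
  using sl_char_check by (simp add: list_all_iff)

lemma mod_3_in: "n mod 3 \<in> {0,1,2::nat}"
  by (simp, presburger)

text \<open>Heisenberg phases change \<open>m\<close> by multiples of 6 only, so \<open>m\<close>
  modulo 3 is multiplicative. It bounds the group here and separates classes later.\<close>

lemma fst_hess_mult_mod: "fst (hess_mult x y) mod 3 = (fst x + fst y) mod 3"
proof -
  obtain m v \<sigma> n w \<tau> where xy: "x = (m,v,\<sigma>)" "y = (n,w,\<tau>)" by (cases x; cases y)
  have "(m + n + 6 * k) mod 9 mod 3 = (m + n) mod 3" for k :: nat
  proof -
    have "(m + n + 6 * k) mod 9 mod 3 = (m + n + 3 * (2 * k)) mod 3" by (simp add: mod_mod_cancel)
    thus ?thesis by (simp only: mod_mult_self2)
  qed
  thus ?thesis unfolding xy by (simp del: sl_mult.simps sl_act.simps)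
qed

lemma hess_mult_closed:
  assumes "x \<in> set hess_list" "y \<in> set hess_list"
  shows "hess_mult x y \<in> set hess_list"
proof -
  obtain m v \<sigma> n w \<tau> where xy: "x = (m,v,\<sigma>)" "y = (n,w,\<tau>)" by (cases x; cases y)
  have \<sigma>\<tau>: "\<sigma> \<in> set SL" "\<tau> \<in> set SL" "m mod 3 = sl_char \<sigma>" "n mod 3 = sl_char \<tau>"
    using assms by (auto simp: xy in_hess_list_iff)
  have "fst (hess_mult x y) mod 3 = sl_char (sl_mult \<sigma> \<tau>)"
    unfolding fst_hess_mult_mod sl_char_mult[OF \<sigma>\<tau>(1,2)] by (simp only: xy fst_conv \<sigma>\<tau>(3,4)[symmetric] mod_add_eq)
  thus ?thesis
    using SL_mult[OF \<sigma>\<tau>(1,2)] mod_3_in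
    unfolding xy hess_mult.simps in_hess_list_iff heis_add_def fst_conv snd_conv by simp
qed

lemma hess_mat_hess_mult:
  "x \<in> set hess_list \<Longrightarrow> y \<in> set hess_list \<Longrightarrow> hess_mat x * hess_mat y = hess_mat (hess_mult x y)"
  by (cases x; cases y) (simp only: in_hess_list_iff hess_mat_mult)

definition hess_one :: hess where "hess_one = (0,(0,0),(1,0,0,1))"

lemma hess_mat_one: "hess_mat hess_one = 1\<^sub>m 3"
  unfolding hess_one_def hess_mat.simps weil_one heis_zero by (simp add: one_smult_mat)

lemma hess_one_in: "hess_one \<in> set hess_list"
  by (simp add: hess_one_def in_hess_list_iff SL_eq)

lemma sl_inv_check:
  "list_all (\<lambda>\<sigma>. sl_inv \<sigma> \<in> set SL \<and> sl_mult \<sigma> (sl_inv \<sigma>) = (1,0,0,1) \<and> sl_char (sl_inv \<sigma>) = (8 * sl_char \<sigma>) mod 3) SL"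
  unfolding sl_inv_def by code_simp

lemma sl_inv:
  assumes "\<sigma> \<in> set SL"
  shows "sl_inv \<sigma> \<in> set SL" "sl_mult \<sigma> (sl_inv \<sigma>) = (1,0,0,1)" "sl_char (sl_inv \<sigma>) = (8 * sl_char \<sigma>) mod 3"
  using sl_inv_check assms by (simp_all only: list_all_iff)

lemma hess_inv:
  assumes "x \<in> set hess_list"
  shows "hess_inv x \<in> set hess_list" "hess_mult x (hess_inv x) = hess_one"
    "hess_mat x * hess_mat (hess_inv x) = 1\<^sub>m 3"
proof -
  obtain m a b \<sigma> where x: "x = (m,(a,b),\<sigma>)" by (cases x) auto
  have mx: "a \<in> {0,1,2}" "b \<in> {0,1,2}" "\<sigma> \<in> set SL" "m mod 3 = sl_char \<sigma>"
    using assms by (simp_all add: x in_hess_list_iff)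
  have "(8 * m) mod 9 mod 3 = (8 * (m mod 3)) mod 3"
    by (simp add: mod_mod_cancel mod_simps)
  moreover have "fst (sl_act \<tau> w) \<in> {0,1,2}" "snd (sl_act \<tau> w) \<in> {0,1,2}" for \<tau> w
    using mod_3_in by (cases \<tau>; cases w; simp only: sl_act.simps fst_conv snd_conv)+
  ultimately show 1: "hess_inv x \<in> set hess_list"
    using sl_inv[OF mx(3)] unfolding x hess_inv.simps in_hess_list_iff mx(4) by simp
  have "sl_act \<sigma> (sl_act (sl_inv \<sigma>) (2*a, 2*b)) = ((2 * a) mod 3, (2 * b) mod 3)"
    unfolding sl_act_mult[symmetric] sl_inv[OF mx(3)] by simp
  moreover have "(m + (8 * m) mod 9 + k) mod 9 = k mod 9" for k
  proof -
    have "(m + (8 * m) mod 9 + k) mod 9 = (m + 8 * m + k) mod 9" by (intro mod_add_cong) auto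
    also have "m + 8 * m + k = k + 9 * m" by simp
    finally show ?thesis by (simp only: mod_mult_self2)
  qed
  ultimately show 2: "hess_mult x (hess_inv x) = hess_one"
    unfolding x hess_inv.simps hess_mult.simps hess_one_def using mx(1,2) sl_inv[OF mx(3)]
    by (auto simp: heis_form_def heis_add_def mod_simps simp del: sl_mult.simps sl_act.simps)
  show "hess_mat x * hess_mat (hess_inv x) = 1\<^sub>m 3"
    using hess_mat_hess_mult[OF assms 1] 2 by (simp only: hess_mat_one)
qed

lemma S1_eq: "S1 = hess_mat (0,(1,0),(1,0,0,1))"
  unfolding hess_mat.simps weil_one S1_def
  by (rule mat3_eqI) (simp_all add: mat3_def heis_def right_mult_one_mat[OF heis_carrier, unfolded heis_def])

lemma T0_eq: "T0 = hess_mat (0,(0,1),(1,0,0,1))"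
  unfolding hess_mat.simps weil_one T0_def
  by (rule mat3_eqI) (simp_all add: mat3_def heis_def right_mult_one_mat[OF heis_carrier, unfolded heis_def])

lemma V_eq_hess: "V = hess_mat (0,(0,0),sV)"
  unfolding hess_mat.simps V_eq heis_zero
  by (simp only: left_mult_one_mat[OF weil_carrier] power_0 one_smult_mat)

text \<open>\<open>diag(1,1,omega)\<close> is \<open>S1\<close> times the quadratic phase
  \<open>omega ^ (2 * j * j)\<close>: the linear and the quadratic exponent cancel at
  \<open>j = 1\<close>.\<close>

lemma U_eq_hess: "U = hess_mat (1,(1,0),sU)"
proof -
  have "heis (1,0) * weil sU = mat3 [[1,0,0],[0,1,0],[0,0,omega]]"
    unfolding heis_def weil.simps mat3_def mat3_mult
    by (rule mat3_cong) (simp_all add: omega_pow_numeral omega_square omega_square' algebra_simps)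
  thus ?thesis unfolding hess_mat.simps U_def mat3_def by (intro mat3_eqI) simp_all
qed

lemma HessG_subset: "HessG \<subseteq> hess_mat ` set hess_list"
proof
  fix g assume "g \<in> HessG"
  thus "g \<in> hess_mat ` set hess_list"
  proof induction
    case one
    show ?case using hess_mat_one hess_one_in by (metis imageI)
  next
    case (gen g h)
    have "(0,(1,0),(1,0,0,1)) \<in> set hess_list" "(0,(0,1),(1,0,0,1)) \<in> set hess_list"
      "(0,(0,0),sV) \<in> set hess_list" "(1,(1,0),sU) \<in> set hess_list"
      by (simp_all add: in_hess_list_iff SL_eq)
    hence "g \<in> hess_mat ` set hess_list"
      using gen(1) S1_eq T0_eq V_eq_hess U_eq_hess by (auto simp del: hess_mat.simps)
    then obtain x y where "x \<in> set hess_list" "g = hess_mat x" "y \<in> set hess_list" "h = hess_mat y"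
      using gen(3) by blast
    thus ?case using hess_mat_hess_mult hess_mult_closed by (metis imageI)
  qed
qed

lemma HessG_carrier: "g \<in> HessG \<Longrightarrow> g \<in> carrier_mat 3 3"
  using HessG_subset hess_mat_carrier by blast

lemma HessG_mult: "g \<in> HessG \<Longrightarrow> h \<in> HessG \<Longrightarrow> g * h \<in> HessG"
proof (induction rule: HessG.induct)
  case one
  thus ?case using HessG_carrier left_mult_one_mat by metis
next
  case (gen g k)
  have "g \<in> carrier_mat 3 3" using gen(1) S1_eq T0_eq V_eq_hess U_eq_hess hess_mat_carrier by (metis insertE singletonD)
  hence "g * k * h = g * (k * h)" using gen HessG_carrier by (intro assoc_mult_mat[of _ 3 3 _ 3 _ 3]) auto
  thus ?case using HessG.gen gen by auto
qed

lemma HessG_gens: "S1 \<in> HessG" "T0 \<in> HessG" "V \<in> HessG" "U \<in> HessG"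
proof -
  have "g \<in> HessG" if "g \<in> {S1, T0, V, U}" for g
  proof -
    have "g \<in> carrier_mat 3 3" using that S1_eq T0_eq V_eq_hess U_eq_hess hess_mat_carrier by (metis insertE singletonD)
    thus ?thesis using HessG.gen[OF that HessG.one] by simp
  qed
  thus "S1 \<in> HessG" "T0 \<in> HessG" "V \<in> HessG" "U \<in> HessG" by blast+
qed

text \<open>Lets the converse inclusion be proved by arithmetic with normal forms, before these are
  known to be unique.\<close>

definition hess_gen :: "hess set" where
  "hess_gen = {x \<in> set hess_list. hess_mat x \<in> HessG}"

lemma hess_gen_mult: "x \<in> hess_gen \<Longrightarrow> y \<in> hess_gen \<Longrightarrow> hess_mult x y \<in> hess_gen"
  unfolding hess_gen_def using hess_mult_closed hess_mat_hess_mult HessG_mult by (metis (mono_tags, lifting) mem_Collect_eq)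

lemmas hess_mult_compute = heis_form_def heis_add_def

lemma hess_gen_generators:
  "(0,(1,0),(1,0,0,1)) \<in> hess_gen" "(0,(0,1),(1,0,0,1)) \<in> hess_gen" "(0,(0,0),sV) \<in> hess_gen" "(1,(1,0),sU) \<in> hess_gen"
  unfolding hess_gen_def using HessG_gens[unfolded S1_eq T0_eq V_eq_hess U_eq_hess]
  by (simp_all add: in_hess_list_iff SL_eq del: hess_mat.simps)

lemma hess_gen_heisenberg:
  assumes "m \<in> {0,3,6}" "a \<in> {0,1,2}" "b \<in> {0,1,2}"
  shows "(m,(a,b),(1,0,0,1)) \<in> hess_gen"
proof -
  note S = hess_gen_generators(1) and T = hess_gen_generators(2)
  have I: "(0,(0,0),(1,0,0,1)) \<in> hess_gen"
    unfolding hess_gen_def using hess_one_in hess_mat_one HessG.one by (simp add: hess_one_def del: hess_mat.simps)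
  have S2: "(0,(2,0),(1,0,0,1)) \<in> hess_gen"
    using hess_gen_mult[OF S S] by (simp add: hess_mult_compute numeral_2_eq_2)
  have T2: "(0,(0,2),(1,0,0,1)) \<in> hess_gen"
    using hess_gen_mult[OF T T] by (simp add: hess_mult_compute numeral_2_eq_2)
  \<comment> \<open>With \<open>S2\<close> and \<open>T2\<close> as inverses of \<open>S\<close> and
    \<open>T\<close> this is their commutator, a scalar matrix equal to
    \<open>eps ^ 3\<close>.\<close>
  have Z: "(3,(0,0),(1,0,0,1)) \<in> hess_gen"
    using hess_gen_mult[OF hess_gen_mult[OF S T] hess_gen_mult[OF S2 T2]]
    by (simp add: hess_mult_compute)
  have Z2: "(6,(0,0),(1,0,0,1)) \<in> hess_gen"
    using hess_gen_mult[OF Z Z] by (simp add: hess_mult_compute)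
  have Sa: "(0,(a,0),(1,0,0,1)) \<in> hess_gen" using assms S S2 I by auto
  have Tb: "(0,(0,b),(1,0,0,1)) \<in> hess_gen" using assms T T2 I by auto
  have ZST: "hess_mult (k,(0,0),(1,0,0,1)) (hess_mult (0,(a,0),(1,0,0,1)) (0,(0,b),(1,0,0,1))) \<in> hess_gen"
    if "k \<in> {0,3,6}" for k
    using that Z Z2 I Sa Tb hess_gen_mult by (metis empty_iff insert_iff)
  have "hess_mult (k,(0,0),(1,0,0,1)) (hess_mult (0,(a,0),(1,0,0,1)) (0,(0,b),(1,0,0,1))) =
     ((k + (6 * (a * b)) mod 9) mod 9, (a,b), (1,0,0,1))" for k
    using assms by (auto simp: hess_mult_compute)
  moreover have "\<exists>k\<in>{0,3,6}. (k + (6 * (a * b)) mod 9) mod 9 = m"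
    using assms by auto
  ultimately show ?thesis using ZST by metis
qed

text \<open>Words in the generators reach some element above every \<open>\<sigma>\<close>;
  multiplication by a Heisenberg element times a power of \<open>eps ^ 3\<close> then reaches all
  others above the same \<open>\<sigma>\<close>.\<close>

lemma hess_list_subset_gen: "set hess_list \<subseteq> hess_gen"
proof -
  have ex: "\<exists>m v. (m,v,\<sigma>) \<in> hess_gen" if "\<sigma> \<in> set SL" for \<sigma>
    using that
  proof (induction \<sigma> rule: SL_induct)
    case one
    show ?case using hess_gen_generators(1) by blast
  next
    case (V \<sigma>)
    then obtain m v where "(m,v,\<sigma>) \<in> hess_gen" by blast
    from hess_gen_mult[OF hess_gen_generators(3) this] show ?case unfolding hess_mult.simps by blast
  next
    case (U \<sigma>)
    then obtain m v where "(m,v,\<sigma>) \<in> hess_gen" by blast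
    from hess_gen_mult[OF hess_gen_generators(4) this] show ?case unfolding hess_mult.simps by blast
  qed
  show ?thesis
  proof
    fix x assume x: "x \<in> set hess_list"
    obtain m a b \<sigma> where x': "x = (m,(a,b),\<sigma>)" by (cases x) auto
    have mx: "m < 9" "a \<in> {0,1,2}" "b \<in> {0,1,2}" "\<sigma> \<in> set SL" "m mod 3 = sl_char \<sigma>"
      using x by (simp_all add: x' in_hess_list_iff)
    obtain n v where y: "(n,v,\<sigma>) \<in> hess_gen" using ex[OF mx(4)] by blast
    obtain c d where v: "v = (c,d)" by (cases v)
    have n: "n < 9" "c \<in> {0,1,2}" "d \<in> {0,1,2}" "n mod 3 = sl_char \<sigma>"
      using y by (simp_all add: hess_gen_def v in_hess_list_iff)
    define a' b' where "a' = (a + 2 * c) mod 3" and "b' = (b + 2 * d) mod 3"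
    have ab': "a' \<in> {0,1,2}" "b' \<in> {0,1,2}" unfolding a'_def b'_def by (rule mod_3_in)+
    have sums: "(a' + c) mod 3 = a" "(b' + d) mod 3 = b"
      using mx(2,3) n(2,3) by (auto simp: a'_def b'_def)
    have cd_mod: "c mod 3 = c" "d mod 3 = d" using n by auto
    define f where "f = heis_form (a',b') (c mod 3, d mod 3)"
    \<comment> \<open>This is \<open>m - n - 6 * f\<close> modulo 9. It is a multiple of 3 because
      \<open>m\<close> and \<open>n\<close> belong to the same \<open>\<sigma>\<close>.\<close>
    define k where "k = (m + 8 * n + 3 * f) mod 9"
    have "k mod 3 = 0"
    proof -
      have "k mod 3 = (m + 8 * n) mod 3"
        unfolding k_def by (simp add: mod_mod_cancel)
      also have "\<dots> = (m mod 3 + 8 * (n mod 3)) mod 3" by (intro mod_add_cong mod_mult_cong) auto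
      also have "\<dots> = (9 * (n mod 3)) mod 3" using mx n by simp
      finally show ?thesis by simp
    qed
    moreover have "k < 9" by (simp add: k_def)
    ultimately have "k \<in> {0,3,6}" by (intro dvd_3_less_9)
    hence "hess_mult (k,(a',b'),(1,0,0,1)) (n,v,\<sigma>) \<in> hess_gen"
      by (rule hess_gen_mult[OF hess_gen_heisenberg[OF _ ab'] y])
    moreover have "(k + n + 6 * f) mod 9 = m"
    proof -
      have "(k + n + 6 * f) mod 9 = (m + 8 * n + 3 * f + n + 6 * f) mod 9"
        unfolding k_def by (intro mod_add_cong) auto
      also have "m + 8 * n + 3 * f + n + 6 * f = m + 9 * (n + f)" by simp
      finally show ?thesis using mx(1) by (simp only: mod_mult_self2 mod_less)
    qed
    hence "hess_mult (k,(a',b'),(1,0,0,1)) (n,v,\<sigma>) = x"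
      using sums cd_mod sl_one_mult[OF mx(4)]
      unfolding x' v hess_mult.simps sl_act.simps heis_add_def by (simp add: f_def del: sl_mult.simps)
    ultimately show "x \<in> hess_gen" by simp
  qed
qed

lemma HessG_eq: "HessG = hess_mat ` set hess_list"
  using HessG_subset hess_list_subset_gen by (auto simp: hess_gen_def)

section \<open>Conjugacy classes of the Hessian group\<close>

lemma omega_ne_0: "omega \<noteq> 0"
  by (simp add: omega_def)

lemma omega_pow_inj:
  assumes "omega ^ a = omega ^ b" "a < 3" "b < 3"
  shows "a = b"
proof -
  have "eps ^ ((6 * a) mod 9) = eps ^ ((6 * b) mod 9)"
    using assms(1) unfolding omega_eq_eps by (simp add: eps_pow_mod power_mult)
  hence "(6 * a) mod 9 = (6 * b) mod 9" by (rule eps_pow_inj) auto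
  moreover have "a = 0 \<or> a = 1 \<or> a = 2" "b = 0 \<or> b = 1 \<or> b = 2" using assms by auto
  ultimately show ?thesis by auto
qed

text \<open>The nonzero position in row 0 gives the shift, the ratio of the nonzero entries in rows
  1 and 0 gives the character, and what remains is the scalar.\<close>

lemma heis_smult_inj:
  assumes eq: "c \<cdot>\<^sub>m heis v = d \<cdot>\<^sub>m heis w" and cd: "c \<noteq> 0"
    and v: "fst v < 3" "snd v < 3" and w: "fst w < 3" "snd w < 3"
  shows "v = w \<and> c = d"
proof -
  obtain a b where v': "v = (a,b)" by (cases v)
  obtain a' b' where w': "w = (a',b')" by (cases w)
  have ab: "a < 3" "b < 3" "a' < 3" "b' < 3" using v w v' w' by auto
  have entry: "c * heis (a,b) $$ (j,k) = d * heis (a',b') $$ (j,k)" if "j < 3" "k < 3" for j k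
    using arg_cong[OF eq, of "\<lambda>A. A $$ (j,k)"] that by (simp add: v' w' heis_def)
  have e0: "c * omega ^ (2 * a * b) = d * (if b = b' then omega ^ (2 * a' * b') else 0)"
    using entry[of 0 b] ab by (simp add: heis_def)
  hence b: "b = b'" using cd omega_ne_0 by (auto split: if_splits)
  have e1: "c * omega ^ (a + 2 * a * b) = d * omega ^ (a' + 2 * a' * b)"
    using entry[of 1 "(1 + b) mod 3"] b by (simp add: heis_def)
  have "omega ^ a * (c * omega ^ (2 * a * b)) = c * omega ^ (a + 2 * a * b)" by (simp add: power_add)
  also have "\<dots> = omega ^ a' * (d * omega ^ (2 * a' * b))" unfolding e1 by (simp add: power_add)
  also have "d * omega ^ (2 * a' * b) = c * omega ^ (2 * a * b)" using e0 b by simp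
  finally have "omega ^ a = omega ^ a'" using cd omega_ne_0 by simp
  hence "a = a'" using omega_pow_inj ab by blast
  thus ?thesis using b e0 omega_ne_0 by (simp add: v' w')
qed

lemma heis_commute:
  "heis v * heis w = omega ^ (heis_form v w + 2 * heis_form w v) \<cdot>\<^sub>m (heis w * heis v)"
proof -
  have "heis_add w v = heis_add v w" by (simp add: heis_add_def add.commute)
  moreover have "omega ^ (heis_form v w + 2 * heis_form w v + heis_form w v) = omega ^ heis_form v w"
    by (rule omega_pow_cong) simp
  ultimately show ?thesis
    unfolding heis_mult smult_smult_mat by (simp only: power_add[symmetric])
qed

text \<open>Conjugation by a group element acts on Heisenberg elements through
  \<open>\<sigma>\<close>, up to scalars; this makes \<open>\<sigma>\<close> recoverable from the
  matrix.\<close>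

lemma hess_mat_heis:
  assumes "\<sigma> \<in> set SL"
  shows "hess_mat (m,v,\<sigma>) * heis u =
    omega ^ (heis_form v (sl_act \<sigma> u) + 2 * heis_form (sl_act \<sigma> u) v) \<cdot>\<^sub>m (heis (sl_act \<sigma> u) * hess_mat (m,v,\<sigma>))"
proof -
  define w where "w = sl_act \<sigma> u"
  define k where "k = heis_form v w + 2 * heis_form w v"
  note c = heis_carrier weil_carrier mult_carrier_mat[OF heis_carrier weil_carrier] mult_carrier_mat[OF heis_carrier heis_carrier]
  have "heis v * weil \<sigma> * heis u = heis v * (weil \<sigma> * heis u)" by (rule assoc_mult_mat) (rule c)+
  also have "\<dots> = heis v * heis w * weil \<sigma>"
    unfolding weil_heis[OF assms] w_def by (rule assoc_mult_mat[symmetric]) (rule c)+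
  also have "\<dots> = omega ^ k \<cdot>\<^sub>m (heis w * heis v * weil \<sigma>)"
    unfolding heis_commute[of v w] k_def by (rule mult_smult_assoc_mat) (rule c)+
  also have "heis w * heis v * weil \<sigma> = heis w * (heis v * weil \<sigma>)" by (rule assoc_mult_mat) (rule c)+
  finally have *: "heis v * weil \<sigma> * heis u = omega ^ k \<cdot>\<^sub>m (heis w * (heis v * weil \<sigma>))" .
  have "hess_mat (m,v,\<sigma>) * heis u = eps ^ m \<cdot>\<^sub>m (heis v * weil \<sigma> * heis u)"
    unfolding hess_mat.simps by (rule mult_smult_assoc_mat) (rule c)+
  also have "\<dots> = omega ^ k \<cdot>\<^sub>m (eps ^ m \<cdot>\<^sub>m (heis w * (heis v * weil \<sigma>)))"
    unfolding * smult_smult_mat by (simp only: mult.commute)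
  also have "eps ^ m \<cdot>\<^sub>m (heis w * (heis v * weil \<sigma>)) = heis w * hess_mat (m,v,\<sigma>)"
    unfolding hess_mat.simps by (rule mult_smult_distrib[symmetric]) (rule c)+
  finally show ?thesis by (simp only: k_def w_def)
qed

lemma SL_entries_check: "list_all (\<lambda>(p,q,r,s). p < 3 \<and> q < 3 \<and> r < 3 \<and> s < 3) SL"
  by code_simp

text \<open>The matrix determines \<open>\<sigma>\<close> by its action on the Heisenberg group.
  Cancelling \<open>weil \<sigma>\<close> leaves a scalar multiple of \<open>heis v\<close>, which
  determines both the scalar and \<open>v\<close>.\<close>

lemma hess_mat_inj:
  assumes x: "x \<in> set hess_list" and y: "y \<in> set hess_list" and eq: "hess_mat x = hess_mat y"
  shows "x = y"
proof -
  obtain m v \<sigma> n w \<tau> where xy: "x = (m,v,\<sigma>)" "y = (n,w,\<tau>)" by (cases x; cases y)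
  have lt3: "z < 3" if "z \<in> {0,1,2}" for z :: nat using that by auto
  have mem: "m < 9" "fst v < 3" "snd v < 3" "\<sigma> \<in> set SL" "n < 9" "fst w < 3" "snd w < 3" "\<tau> \<in> set SL"
    using x y lt3 unfolding xy in_hess_list_iff by blast+
  define A where "A = hess_mat x"
  define B where "B = hess_mat (hess_inv x)"
  have AB: "A \<in> carrier_mat 3 3" "B \<in> carrier_mat 3 3" "A * B = 1\<^sub>m 3"
    using hess_inv(3)[OF x] by (simp_all add: A_def B_def)
  have cancel: "(c \<cdot>\<^sub>m (heis z * A)) * B = c \<cdot>\<^sub>m heis z" for c z
  proof -
    have "(c \<cdot>\<^sub>m (heis z * A)) * B = c \<cdot>\<^sub>m (heis z * A * B)"
      by (rule mult_smult_assoc_mat[OF mult_carrier_mat[OF heis_carrier AB(1)] AB(2)])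
    also have "heis z * A * B = heis z * (A * B)"
      by (rule assoc_mult_mat) (rule heis_carrier AB)+
    finally show ?thesis using AB by (simp add: right_mult_one_mat[OF heis_carrier])
  qed
  have act: "sl_act \<sigma> u = sl_act \<tau> u" for u
  proof -
    define k where "k = heis_form v (sl_act \<sigma> u) + 2 * heis_form (sl_act \<sigma> u) v"
    define l where "l = heis_form w (sl_act \<tau> u) + 2 * heis_form (sl_act \<tau> u) w"
    have "omega ^ k \<cdot>\<^sub>m (heis (sl_act \<sigma> u) * A) = omega ^ l \<cdot>\<^sub>m (heis (sl_act \<tau> u) * A)"
      using hess_mat_heis[OF mem(4), of m v u] hess_mat_heis[OF mem(8), of n w u] eq
      unfolding A_def k_def l_def xy by simp
    hence "omega ^ k \<cdot>\<^sub>m heis (sl_act \<sigma> u) = omega ^ l \<cdot>\<^sub>m heis (sl_act \<tau> u)"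
      using cancel by metis
    moreover have "fst (sl_act \<rho> u) < 3" "snd (sl_act \<rho> u) < 3" for \<rho>
      by (cases \<rho>; cases u; simp)+
    ultimately show ?thesis using heis_smult_inj[of "omega ^ k" _ "omega ^ l"] omega_ne_0 by simp
  qed
  have \<sigma>\<tau>: "\<sigma> = \<tau>"
  proof -
    obtain p q r s where \<sigma>: "\<sigma> = (p,q,r,s)" by (cases \<sigma>)
    obtain p' q' r' s' where \<tau>: "\<tau> = (p',q',r',s')" by (cases \<tau>)
    have "p < 3" "q < 3" "r < 3" "s < 3" "p' < 3" "q' < 3" "r' < 3" "s' < 3"
      using SL_entries_check mem(4,8) unfolding list_all_iff \<sigma> \<tau> by auto
    thus ?thesis using act[of "(1,0)"] act[of "(0,1)"] by (simp add: \<sigma> \<tau>)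
  qed
  have inv: "(c \<cdot>\<^sub>m (heis z * weil \<sigma>)) * weil (sl_inv \<sigma>) = c \<cdot>\<^sub>m heis z" for c z
  proof -
    have "(c \<cdot>\<^sub>m (heis z * weil \<sigma>)) * weil (sl_inv \<sigma>) = c \<cdot>\<^sub>m (heis z * weil \<sigma> * weil (sl_inv \<sigma>))"
      by (rule mult_smult_assoc_mat) (rule mult_carrier_mat heis_carrier weil_carrier)+
    also have "heis z * weil \<sigma> * weil (sl_inv \<sigma>) = heis z * (weil \<sigma> * weil (sl_inv \<sigma>))"
      by (rule assoc_mult_mat) (rule heis_carrier weil_carrier)+
    also have "weil \<sigma> * weil (sl_inv \<sigma>) = 1\<^sub>m 3"
      unfolding weil_mult[OF mem(4) sl_inv(1)[OF mem(4)]] sl_inv(2)[OF mem(4)] by (rule weil_one)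
    finally show ?thesis by (simp add: right_mult_one_mat[OF heis_carrier])
  qed
  have "eps ^ m \<cdot>\<^sub>m (heis v * weil \<sigma>) = eps ^ n \<cdot>\<^sub>m (heis w * weil \<sigma>)"
    using eq by (simp only: xy \<sigma>\<tau> hess_mat.simps)
  hence "eps ^ m \<cdot>\<^sub>m heis v = eps ^ n \<cdot>\<^sub>m heis w" using inv by metis
  hence "v = w" "eps ^ m = eps ^ n"
    using heis_smult_inj[of "eps ^ m" v "eps ^ n" w] mem eps_ne_0 by simp_all
  thus ?thesis using eps_pow_inj mem \<sigma>\<tau> by (simp add: xy)
qed

lemma finite_matrix_group_HessG: "finite_matrix_group HessG"
proof
  show "finite HessG" by (simp add: HessG_eq)
  show "g \<in> carrier_mat 3 3" if "g \<in> HessG" for g using HessG_carrier that .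
  show "1\<^sub>m 3 \<in> HessG" by (rule HessG.one)
  show "g * h \<in> HessG" if "g \<in> HessG" "h \<in> HessG" for g h using HessG_mult that .
  show "\<exists>h\<in>HessG. g * h = 1\<^sub>m 3" if "g \<in> HessG" for g
    using that hess_inv unfolding HessG_eq by blast
qed

lemma card_HessG: "card HessG = 648"
proof -
  have "card HessG = card (set hess_list)"
    unfolding HessG_eq by (intro card_image inj_onI hess_mat_inj)
  thus ?thesis using distinct_card[OF distinct_hess_list] length_hess_list by simp
qed

text \<open>\<open>slQ8\<close> is the quaternion subgroup, \<open>slQ4\<close> represents it modulo
  -1, and the elements of \<open>slC6\<close> conjugate \<open>sV\<close> to the six different
  elements of order 4. \<open>vec3\<close> represents the vectors modulo the line of
  \<open>(1,0)\<close>, and \<open>vec9\<close> lists all vectors.\<close>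

definition slQ4 :: "sl list" where "slQ4 = [(1,0,0,1), (0,2,1,0), (2,1,1,1), (2,2,2,1)]"
definition slQ8 :: "sl list" where "slQ8 = slQ4 @ [(2,0,0,2), (0,1,2,0), (1,2,2,2), (1,1,1,2)]"
definition slC6 :: "sl list" where "slC6 = [(1,0,0,1), (2,1,1,1), (1,2,0,1), (1,0,1,1), (1,1,0,1), (0,2,1,1)]"
definition vec3 :: "(nat \<times> nat) list" where "vec3 = [(0,0), (0,1), (0,2)]"
definition vec9 :: "(nat \<times> nat) list" where "vec9 = List.product [0,1,2] [0,1,2]"

text \<open>An entry \<open>(m, v, \<sigma>, k, T, W)\<close> describes a class with representative \<open>(m, v, \<sigma>)\<close> whose trace is
  \<open>eps ^ m * trace_value k\<close>; the products \<open>weil \<tau> * heis w\<close> with \<open>\<tau>\<close> in \<open>T\<close> and \<open>w\<close> in \<open>W\<close> form, up to scalars,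
  a transversal of its centralizer.\<close>

definition class_data :: "(nat \<times> (nat \<times> nat) \<times> sl \<times> nat \<times> sl list \<times> (nat \<times> nat) list) list" where
  "class_data =
    [(0,(0,0),(1,0,0,1),0,[(1,0,0,1)],[(0,0)]), (3,(0,0),(1,0,0,1),0,[(1,0,0,1)],[(0,0)]),
     (6,(0,0),(1,0,0,1),0,[(1,0,0,1)],[(0,0)]), (0,(1,0),(1,0,0,1),1,slQ8,vec3),
     (0,(0,0),(2,0,0,2),2,[(1,0,0,1)],vec9), (3,(0,0),(2,0,0,2),2,[(1,0,0,1)],vec9),
     (6,(0,0),(2,0,0,2),2,[(1,0,0,1)],vec9), (0,(0,0),(0,2,1,0),3,slC6,vec9),
     (3,(0,0),(0,2,1,0),3,slC6,vec9), (6,(0,0),(0,2,1,0),3,slC6,vec9),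
     (1,(0,0),(1,2,0,1),4,slQ4,vec3), (4,(0,0),(1,2,0,1),4,slQ4,vec3),
     (7,(0,0),(1,2,0,1),4,slQ4,vec3), (1,(0,1),(1,2,0,1),1,slQ8,vec9),
     (2,(0,0),(1,1,0,1),5,slQ4,vec3), (5,(0,0),(1,1,0,1),5,slQ4,vec3),
     (8,(0,0),(1,1,0,1),5,slQ4,vec3), (2,(0,1),(1,1,0,1),1,slQ8,vec9),
     (1,(0,0),(2,1,0,2),2,slQ4,vec9), (4,(0,0),(2,1,0,2),2,slQ4,vec9),
     (7,(0,0),(2,1,0,2),2,slQ4,vec9), (2,(0,0),(2,2,0,2),2,slQ4,vec9),
     (5,(0,0),(2,2,0,2),2,slQ4,vec9), (8,(0,0),(2,2,0,2),2,slQ4,vec9)]"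

fun class_rep_of where "class_rep_of (m,v,\<sigma>,k,T,W) = ((m,v,\<sigma>) :: hess)"

text \<open>Each conjugate is paired with the element that conjugates to it. The middle entry is
  \<open>sl_act \<tau> w\<close> since \<open>weil \<tau> * heis w\<close> has normal form
  \<open>heis (sl_act \<tau> w) * weil \<tau>\<close>, and \<open>sl_char \<tau>\<close> is an
  admissible power of \<open>eps\<close>.\<close>

fun orbit_of :: "nat \<times> (nat \<times> nat) \<times> sl \<times> nat \<times> sl list \<times> (nat \<times> nat) list \<Rightarrow> (hess \<times> hess) list" where
  "orbit_of (m,v,\<sigma>,k,T,W) = map (\<lambda>(\<tau>,w).
    (hess_mult (hess_mult (sl_char \<tau>, sl_act \<tau> w, \<tau>) (m,v,\<sigma>)) (hess_inv (sl_char \<tau>, sl_act \<tau> w, \<tau>)),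
     (sl_char \<tau>, sl_act \<tau> w, \<tau>))) (List.product T W)"

lemma length_orbit_of: "length (orbit_of (m,v,\<sigma>,k,T,W)) = length T * length W"
  by simp

lemma class_sizes:
  "map (\<lambda>d. length (orbit_of d)) class_data =
    [1,1,1,24,9,9,9,54,54,54,12,12,12,72,12,12,12,72,36,36,36,36,36,36]"
  by (simp add: class_data_def length_orbit_of slQ8_def slQ4_def slC6_def vec3_def vec9_def del: orbit_of.simps)

text \<open>Gives a lower bound for each class size by computation inside one class at a time; no
  list is tested for closure under conjugation.\<close>

lemma class_orbits_distinct: "list_all (\<lambda>d. distinct (map fst (orbit_of d))) class_data"
  unfolding class_data_def slQ8_def slQ4_def slC6_def vec3_def vec9_def heis_form_def heis_add_def sl_inv_def
  by code_simp

interpretation Hess: finite_matrix_group HessG by (rule finite_matrix_group_HessG)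

fun class_m where "class_m (m,v,\<sigma>,k,T,W) = (m :: nat)"
fun class_k where "class_k (m,v,\<sigma>,k,T,W) = (k :: nat)"

definition class_rep :: "nat \<Rightarrow> complex mat" where
  "class_rep c = hess_mat (class_rep_of (class_data ! c))"

definition class_size :: "nat \<Rightarrow> nat" where
  "class_size c = length (orbit_of (class_data ! c))"

text \<open>The last two entries are \<open>-i\<close> and \<open>i\<close> times the square root of
  3.\<close>

definition trace_value :: "nat \<Rightarrow> complex" where
  "trace_value k = [3, 0, -1, 1, - 1 - 2 * omega, 1 + 2 * omega] ! k"

lemma length_class_data: "length class_data = 24"
  by (simp add: class_data_def)

lemma class_data_check:
  "list_all (\<lambda>(m,v,\<sigma>,k,T,W). m < 9 \<and> k < 6 \<and> fst v \<in> {0,1,2} \<and> snd v \<in> {0,1,2} \<and>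
     \<sigma> \<in> set SL \<and> m mod 3 = sl_char \<sigma> \<and> list_all (\<lambda>\<tau>. \<tau> \<in> set SL) T) class_data"
  unfolding class_data_def slQ8_def slQ4_def slC6_def vec3_def vec9_def by code_simp

text \<open>A nonzero trace with known \<open>k\<close> reveals \<open>m\<close> itself, whereas for
  trace 0, that is \<open>k = 1\<close>, only \<open>m\<close> modulo 3 is available; hence the
  disjunction.\<close>

lemma class_data_separated:
  "list_all (\<lambda>c. list_all (\<lambda>c'. class_k (class_data ! c) = class_k (class_data ! c') \<longrightarrow>
      class_m (class_data ! c) mod 3 = class_m (class_data ! c') mod 3 \<longrightarrow>
      class_k (class_data ! c) = 1 \<or> class_m (class_data ! c) = class_m (class_data ! c') \<longrightarrow> c = c') [0..<24]) [0..<24]"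
  unfolding class_data_def by code_simp

lemma class_dataD:
  assumes "(m,v,\<sigma>,k,T,W) \<in> set class_data"
  shows "m < 9 \<and> fst v \<in> {0,1,2} \<and> snd v \<in> {0,1,2} \<and> \<sigma> \<in> set SL \<and> m mod 3 = sl_char \<sigma>"
    and "k < 6" and "\<And>\<tau>. \<tau> \<in> set T \<Longrightarrow> \<tau> \<in> set SL"
proof -
  note check = bspec[OF class_data_check[unfolded list_all_iff] assms, unfolded prod.case]
  show "m < 9 \<and> fst v \<in> {0,1,2} \<and> snd v \<in> {0,1,2} \<and> \<sigma> \<in> set SL \<and> m mod 3 = sl_char \<sigma>"
    "k < 6" using check by (simp_all only: simp_thms)
  show "\<tau> \<in> set SL" if "\<tau> \<in> set T" for \<tau>
    using check that by (simp only: simp_thms)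
qed

lemma class_rep_of_in: "d \<in> set class_data \<Longrightarrow> class_rep_of d \<in> set hess_list"
  by (cases d) (simp only: class_rep_of.simps in_hess_list_iff class_dataD)

lemma orbit_of:
  assumes d: "d \<in> set class_data" and xy: "(x,y) \<in> set (orbit_of d)"
  shows "x \<in> set hess_list" "y \<in> set hess_list"
    "hess_mat x * hess_mat y = hess_mat y * hess_mat (class_rep_of d)"
proof -
  obtain m v \<sigma> k T W where d': "d = (m,v,\<sigma>,k,T,W)" by (cases d)
  define R where "R = class_rep_of d"
  have R: "R \<in> set hess_list" using class_rep_of_in[OF d] by (simp add: R_def)
  from xy obtain \<tau> w where \<tau>: "\<tau> \<in> set T" and y: "y = (sl_char \<tau>, sl_act \<tau> w, \<tau>)"
    and x: "x = hess_mult (hess_mult y R) (hess_inv y)"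
    unfolding d' R_def by (auto simp del: hess_mult.simps sl_act.simps sl_char.simps)
  have ch: "sl_char \<tau> < 9" "sl_char \<tau> mod 3 = sl_char \<tau>" using sl_char_less[of \<tau>] by simp_all
  have SL: "\<tau> \<in> set SL" using class_dataD(3)[OF d[unfolded d'] \<tau>] .
  have rng: "fst (sl_act \<tau> w) \<in> {0,1,2}" "snd (sl_act \<tau> w) \<in> {0,1,2}"
    using mod_3_in by (cases \<tau>; cases w; simp only: sl_act.simps fst_conv snd_conv)+
  show yin: "y \<in> set hess_list"
    unfolding y in_hess_list_iff by (intro conjI ch rng SL)
  note yi = hess_inv[OF yin]
  show "x \<in> set hess_list" unfolding x using yin yi(1) R by (intro hess_mult_closed)
  have 1: "hess_mat (hess_inv y) * hess_mat y = 1\<^sub>m 3"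
    using mat_mult_left_right_inverse[OF hess_mat_carrier hess_mat_carrier yi(3)] .
  have "hess_mat x = hess_mat y * hess_mat R * hess_mat (hess_inv y)"
    unfolding x using yin yi(1) R by (simp only: hess_mat_hess_mult hess_mult_closed)
  also have "\<dots> * hess_mat y = hess_mat y * hess_mat R * (hess_mat (hess_inv y) * hess_mat y)"
    by (rule assoc_mult_mat) (rule mult_carrier_mat hess_mat_carrier)+
  also have "\<dots> = hess_mat y * hess_mat R"
    unfolding 1 by (rule right_mult_one_mat) (rule mult_carrier_mat hess_mat_carrier)+
  finally show "hess_mat x * hess_mat y = hess_mat y * hess_mat (class_rep_of d)" by (simp only: R_def)
qed

lemma mtrace_hess_mat:
  "mtrace (hess_mat (m,(a,b),\<sigma>)) = eps ^ m * (omega ^ (2 * a * b) * weil \<sigma> $$ (b mod 3, 0)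
     + omega ^ (a + 2 * a * b) * weil \<sigma> $$ ((1 + b) mod 3, 1) + omega ^ (2 * a + 2 * a * b) * weil \<sigma> $$ ((2 + b) mod 3, 2))"
proof -
  define A where "A = heis (a,b) * weil \<sigma>"
  have A: "A \<in> carrier_mat 3 3" unfolding A_def by (rule mult_carrier_mat[OF heis_carrier weil_carrier])
  have "mtrace (hess_mat (m,(a,b),\<sigma>)) = (\<Sum>i<3. eps ^ m * A $$ (i,i))"
    using A unfolding hess_mat.simps A_def[symmetric] mtrace_def by simp
  also have "\<dots> = eps ^ m * (A $$ (0,0) + A $$ (1,1) + A $$ (2,2))"
    by (simp add: numeral_3_eq_3 numeral_2_eq_2 algebra_simps)
  finally show ?thesis
    unfolding A_def by (simp add: heis_mult_index[OF weil_carrier] mult_ac del: weil.simps)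
qed

lemma mtrace_class_rep:
  assumes "d \<in> set class_data"
  shows "mtrace (hess_mat (class_rep_of d)) = eps ^ class_m d * trace_value (class_k d)"
proof -
  have "list_all (\<lambda>d. mtrace (hess_mat (class_rep_of d)) = eps ^ class_m d * trace_value (class_k d)) class_data"
    unfolding class_data_def
    by (simp add: mtrace_hess_mat trace_value_def omega_pow_numeral omega_square omega_square' inv_theta_def
        algebra_simps del: hess_mat.simps) (simp add: field_simps)
  thus ?thesis using assms by (simp add: list_all_iff del: hess_mat.simps)
qed

text \<open>The ninth powers are 19683, 0, -1, 1 and two opposite imaginary numbers; the odd
  exponent preserves signs.\<close>

lemma trace_value_pow_inj:
  assumes "trace_value k ^ 9 = trace_value l ^ 9" "k < 6" "l < 6"
  shows "k = l"
proof -
  have th: "(1 + 2 * omega) ^ 9 = Complex 0 (81 * sqrt 3)"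
  proof -
    have "1 + 2 * omega = Complex 0 (sqrt 3)" by (simp add: omega_Complex complex_eq_iff)
    hence "(1 + 2 * omega) ^ 2 = - 3" by (simp add: power2_eq_square complex_eq_iff)
    hence "((1 + 2 * omega) ^ 2) ^ 4 * (1 + 2 * omega) = 81 * Complex 0 (sqrt 3)"
      using \<open>1 + 2 * omega = Complex 0 (sqrt 3)\<close> by simp
    thus ?thesis by (simp add: complex_eq_iff flip: power_mult power_Suc2)
  qed
  have th': "(- 1 - 2 * omega) ^ 9 = Complex 0 (- 81 * sqrt 3)"
  proof -
    have "(- 1 - 2 * omega) ^ 9 = (- (1 + 2 * omega)) ^ 9" by simp
    also have "\<dots> = - ((1 + 2 * omega) ^ 9)" by (rule power_minus_odd) simp
    finally show ?thesis unfolding th by (simp add: complex_eq_iff)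
  qed
  have "trace_value k ^ 9 = [Complex 19683 0, 0, Complex (-1) 0, 1, Complex 0 (- 81 * sqrt 3), Complex 0 (81 * sqrt 3)] ! k"
    if "k < 6" for k
  proof -
    have "k = 0 \<or> k = 1 \<or> k = 2 \<or> k = 3 \<or> k = 4 \<or> k = 5" using that by auto
    thus ?thesis using th th' by (auto simp: trace_value_def complex_eq_iff)
  qed
  moreover have "k = 0 \<or> k = 1 \<or> k = 2 \<or> k = 3 \<or> k = 4 \<or> k = 5" "l = 0 \<or> l = 1 \<or> l = 2 \<or> l = 3 \<or> l = 4 \<or> l = 5"
    using assms by auto
  ultimately show ?thesis using assms(1) by (elim disjE) (simp_all add: complex_eq_iff)
qed

text \<open>Since \<open>eps ^ 9 = 1\<close>, the ninth power of the trace determines \<open>k\<close>. Three classes have trace 0;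
  they are told apart by \<open>m mod 3\<close>, which is a homomorphism on the group.\<close>

lemma class_rep_separated:
  assumes c: "c < 24" and c': "c' < 24"
    and tr: "mtrace (class_rep c) = mtrace (class_rep c')"
    and mod: "class_m (class_data ! c) mod 3 = class_m (class_data ! c') mod 3"
  shows "c = c'"
proof -
  define d d' where "d = class_data ! c" and "d' = class_data ! c'"
  have d: "d \<in> set class_data" "d' \<in> set class_data" using c c' length_class_data by (simp_all add: d_def d'_def)
  have bounds: "class_m d < 9" "class_k d < 6" "class_m d' < 9" "class_k d' < 6"
  proof -
    have "class_m d < 9 \<and> class_k d < 6" if "d \<in> set class_data" for d
      using class_dataD that by (cases d) (metis class_m.simps class_k.simps)
    thus "class_m d < 9" "class_k d < 6" "class_m d' < 9" "class_k d' < 6" using d by blast+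
  qed
  have eq: "eps ^ class_m d * trace_value (class_k d) = eps ^ class_m d' * trace_value (class_k d')"
    using tr mtrace_class_rep d by (simp add: class_rep_def d_def d'_def)
  have pow: "(eps ^ m * t) ^ 9 = t ^ 9" for m t
  proof -
    have "(eps ^ m) ^ 9 = (eps ^ 9) ^ m" by (simp only: power_mult[symmetric] mult.commute)
    thus ?thesis by (simp add: power_mult_distrib eps_powr_9)
  qed
  have "trace_value (class_k d) ^ 9 = trace_value (class_k d') ^ 9"
    using arg_cong[OF eq, of "\<lambda>x. x ^ 9"] by (simp only: pow)
  hence k: "class_k d = class_k d'" using trace_value_pow_inj bounds by blast
  have "class_k d = 1 \<or> class_m d = class_m d'"
  proof (rule disjCI)
    assume "class_m d \<noteq> class_m d'"
    hence "eps ^ class_m d \<noteq> eps ^ class_m d'" using eps_pow_inj bounds by blast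
    hence "trace_value (class_k d) = 0" using eq k by simp
    hence "trace_value (class_k d) ^ 9 = trace_value 1 ^ 9" by (simp add: trace_value_def)
    thus "class_k d = 1" using trace_value_pow_inj bounds by simp
  qed
  thus ?thesis using class_data_separated c c' k mod unfolding d_def d'_def list_all_iff by auto
qed

lemma mtrace_conjugate:
  assumes "g \<in> HessG" "s \<in> HessG" "k \<in> HessG" "k * g = s * k"
  shows "mtrace g = mtrace s"
proof -
  have "g = Hess.ginv k * (s * k)" using Hess.ginv_mult_cancel(1)[of k g] assms by simp
  also have "\<dots> = Hess.ginv k * s * k" using assms by (simp add: Hess.assoc_G Hess.ginv)
  finally show ?thesis
    using mtrace_conj[of "Hess.ginv k" 3 3 k s] assms Hess.carrier_G Hess.ginv by simp
qed

lemma class_rep_HessG: "c < 24 \<Longrightarrow> class_rep c \<in> HessG"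
  unfolding class_rep_def HessG_eq using class_rep_of_in length_class_data by simp

text \<open>A homomorphism to an abelian group is constant on classes. Injectivity of
  \<open>hess_mat\<close> carries the matrix equation over to normal forms.\<close>

lemma conjugate_mod_3:
  assumes x: "x \<in> set hess_list" and R: "R \<in> set hess_list" and k: "k \<in> HessG"
    and eq: "k * hess_mat x = hess_mat R * k"
  shows "fst x mod 3 = fst R mod 3"
proof -
  obtain y where y: "y \<in> set hess_list" "k = hess_mat y" using k unfolding HessG_eq by blast
  have "hess_mat (hess_mult y x) = hess_mat (hess_mult R y)"
    using eq x R y by (simp only: hess_mat_hess_mult)
  hence "hess_mult y x = hess_mult R y" using hess_mat_inj hess_mult_closed x R y by blast
  hence eq': "(fst y + fst x) mod 3 = (fst R + fst y) mod 3" by (metis fst_hess_mult_mod)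
  have "fst x mod 3 = (2 * fst y + (fst y + fst x)) mod 3"
    using mod_mult_self2[of "fst x" 3 "fst y"] by (simp add: algebra_simps)
  also have "\<dots> = (2 * fst y + (fst R + fst y)) mod 3" by (rule mod_add_cong[OF refl eq'])
  also have "\<dots> = fst R mod 3"
    using mod_mult_self2[of "fst R" 3 "fst y"] by (simp add: algebra_simps)
  finally show ?thesis .
qed

lemma fst_class_rep_of: "fst (class_rep_of d) = class_m d"
  by (cases d) simp

lemma class_unique:
  assumes g: "g \<in> HessG" and c: "c < 24" "k \<in> HessG" "k * g = class_rep c * k"
    and c': "c' < 24" "k' \<in> HessG" "k' * g = class_rep c' * k'"
  shows "c = c'"
proof (rule class_rep_separated[OF c(1) c'(1)])
  show "mtrace (class_rep c) = mtrace (class_rep c')"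
    using mtrace_conjugate[OF g class_rep_HessG[OF c(1)] c(2,3)]
      mtrace_conjugate[OF g class_rep_HessG[OF c'(1)] c'(2,3)] by simp
  obtain x where x: "x \<in> set hess_list" "g = hess_mat x" using g unfolding HessG_eq by blast
  have "class_data ! c \<in> set class_data" "class_data ! c' \<in> set class_data"
    using c c' length_class_data by simp_all
  note d = this
  have "fst x mod 3 = fst (class_rep_of (class_data ! c)) mod 3"
    by (rule conjugate_mod_3[OF x(1) class_rep_of_in[OF d(1)] c(2)])
      (use c(3) in \<open>simp only: x(2) class_rep_def\<close>)
  moreover have "fst x mod 3 = fst (class_rep_of (class_data ! c')) mod 3"
    by (rule conjugate_mod_3[OF x(1) class_rep_of_in[OF d(2)] c'(2)])
      (use c'(3) in \<open>simp only: x(2) class_rep_def\<close>)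
  ultimately have "class_m (class_data ! c) mod 3 = class_m (class_data ! c') mod 3"
    by (simp only: fst_class_rep_of)
  thus "class_m (class_data ! c) mod 3 = class_m (class_data ! c') mod 3" by simp
qed

definition class_orbit :: "nat \<Rightarrow> hess set" where
  "class_orbit c = fst ` set (orbit_of (class_data ! c))"

lemma class_orbit:
  assumes c: "c < 24" and x: "x \<in> class_orbit c"
  shows "x \<in> set hess_list" "\<exists>k\<in>HessG. k * hess_mat x = class_rep c * k"
proof -
  have d: "class_data ! c \<in> set class_data" using c length_class_data by simp
  obtain y where xy: "(x,y) \<in> set (orbit_of (class_data ! c))" using x unfolding class_orbit_def by force
  note o = orbit_of[OF d xy]
  show "x \<in> set hess_list" by (rule o(1))
  define k where "k = hess_mat y"
  have k: "k \<in> HessG" "hess_mat x \<in> HessG" using o by (simp_all add: HessG_eq k_def)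
  have "hess_mat x * k = k * class_rep c" using o(3) by (simp only: k_def class_rep_def)
  hence "Hess.ginv k * (hess_mat x * k) * Hess.ginv k = Hess.ginv k * (k * class_rep c) * Hess.ginv k" by simp
  hence "Hess.ginv k * hess_mat x = class_rep c * Hess.ginv k"
    using k class_rep_HessG[OF c] by (simp add: Hess.assoc_G Hess.ginv Hess.mult_G)
  thus "\<exists>k\<in>HessG. k * hess_mat x = class_rep c * k" using Hess.ginv k by blast
qed

lemma card_class_orbit: "c < 24 \<Longrightarrow> card (class_orbit c) = class_size c"
proof -
  assume c: "c < 24"
  hence "distinct (map fst (orbit_of (class_data ! c)))"
    using class_orbits_distinct length_class_data by (simp add: list_all_length del: orbit_of.simps)
  from distinct_card[OF this] show ?thesis by (simp add: class_orbit_def class_size_def)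
qed

lemma sum_class_size: "(\<Sum>c<24. class_size c) = 648"
proof -
  have "(\<Sum>c<24. class_size c) = sum_list (map (\<lambda>d. length (orbit_of d)) class_data)"
    by (simp add: sum_list_sum_nth length_class_data class_size_def atLeast0LessThan)
  thus ?thesis unfolding class_sizes by simp
qed

text \<open>The lists are pairwise disjoint because a class has only one representative, and their
  sizes add up to 648, so nothing is left over. It follows that each list is a complete
  class.\<close>

lemma class_orbits_cover: "(\<Union>c<24. class_orbit c) = set hess_list"
proof (rule card_subset_eq)
  show "(\<Union>c<24. class_orbit c) \<subseteq> set hess_list" using class_orbit by blast
  have "class_orbit c \<inter> class_orbit c' = {}" if "c < 24" "c' < 24" "c \<noteq> c'" for c c'
  proof (rule ccontr)
    assume "class_orbit c \<inter> class_orbit c' \<noteq> {}"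
    then obtain x where x: "x \<in> class_orbit c" "x \<in> class_orbit c'" by blast
    have "hess_mat x \<in> HessG" unfolding HessG_eq using class_orbit(1)[OF that(1) x(1)] by blast
    thus False
      using class_unique class_orbit(2)[OF that(1) x(1)] class_orbit(2)[OF that(2) x(2)] that by blast
  qed
  hence "card (\<Union>c<24. class_orbit c) = (\<Sum>c<24. card (class_orbit c))"
    by (intro card_UN_disjoint) (auto simp: class_orbit_def)
  also have "\<dots> = card (set hess_list)"
    using sum_class_size distinct_card[OF distinct_hess_list] length_hess_list by (simp add: card_class_orbit)
  finally show "card (\<Union>c<24. class_orbit c) = card (set hess_list)" .
qed simp

lemma matrix_group_classes_HessG: "matrix_group_classes HessG 24 class_rep class_size"
proof
  show "class_rep c \<in> HessG" if "c < 24" for c using class_rep_HessG that .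
  have ex: "\<exists>c<24. x \<in> class_orbit c" if "x \<in> set hess_list" for x
    using class_orbits_cover that by blast
  show "\<exists>!c. c < 24 \<and> (\<exists>k\<in>HessG. k * g = class_rep c * k)" if g: "g \<in> HessG" for g
  proof -
    obtain x where x: "x \<in> set hess_list" "g = hess_mat x" using g unfolding HessG_eq by blast
    obtain c where "c < 24" "x \<in> class_orbit c" using ex[OF x(1)] by blast
    thus ?thesis using class_orbit(2) class_unique[OF g] x by blast
  qed
  show "class_size c = card {g \<in> HessG. \<exists>k\<in>HessG. k * g = class_rep c * k}" if c: "c < 24" for c
  proof -
    have "{g \<in> HessG. \<exists>k\<in>HessG. k * g = class_rep c * k} = hess_mat ` class_orbit c"
    proof (intro equalityI subsetI)
      fix g assume g: "g \<in> {g \<in> HessG. \<exists>k\<in>HessG. k * g = class_rep c * k}"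
      then obtain x where x: "x \<in> set hess_list" "g = hess_mat x" unfolding HessG_eq by blast
      obtain c' where c': "c' < 24" "x \<in> class_orbit c'" using ex[OF x(1)] by blast
      have "c' = c" using class_orbit(2)[OF c'] class_unique[of g] g c' c x(2) by blast
      thus "g \<in> hess_mat ` class_orbit c" using c' x by blast
    next
      fix g assume "g \<in> hess_mat ` class_orbit c"
      then obtain x where "x \<in> class_orbit c" "g = hess_mat x" by blast
      thus "g \<in> {g \<in> HessG. \<exists>k\<in>HessG. k * g = class_rep c * k}"
        using class_orbit[OF c] HessG_eq by blast
    qed
    moreover have "inj_on hess_mat (class_orbit c)"
      using class_orbit(1)[OF c] by (intro inj_onI hess_mat_inj)
    ultimately show ?thesis using card_class_orbit[OF c] by (simp add: card_image)
  qed
qed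

section \<open>Evaluation of the determinants\<close>

interpretation Hess: matrix_group_classes HessG 24 class_rep class_size by (rule matrix_group_classes_HessG)

lemma grp_inv_eq: "grp_inv = Hess.ginv"
  by (intro ext) (simp add: grp_inv_def Hess.ginv_def)

lemma mtrace_class_fun: "Hess.class_fun mtrace"
proof -
  have "is_rep HessG 3 (\<lambda>g. g)" by (simp add: is_rep_def Hess.carrier_G)
  from Hess.mtrace_rep_class_fun[OF this] show ?thesis .
qed

lemma mtrace_grp_inv: "g \<in> HessG \<Longrightarrow> mtrace (grp_inv g) = cnj (mtrace g)"
proof -
  have "is_rep HessG 3 (\<lambda>g. g)" by (simp add: is_rep_def Hess.carrier_G)
  from Hess.mtrace_rep_ginv[OF this] show "g \<in> HessG \<Longrightarrow> mtrace (grp_inv g) = cnj (mtrace g)"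
    by (simp add: grp_inv_eq)
qed

text \<open>For \<open>g\<close> of determinant 1 this is the value at \<open>t\<close> of \<open>det (1 - t g)\<close>.\<close>

definition mckay_fun :: "complex \<Rightarrow> complex mat \<Rightarrow> complex" where
  "mckay_fun t g = 1 - t ^ 3 - t * mtrace g + t ^ 2 * mtrace (grp_inv g)"

lemma mckay_fun_class_fun: "Hess.class_fun (mckay_fun t)"
  using mtrace_class_fun unfolding Hess.class_fun_def mckay_fun_def
  by (metis Hess.class_index(1) Hess.r_G mtrace_grp_inv)

text \<open>Linearity of the multiplicity in the class function; \<open>\<delta>\<close> becomes the
  entry of the identity matrix in \<open>Mt\<close> by orthonormality.\<close>

lemma mult_in_mckay_fun:
  assumes "mult_in HessG \<chi> \<psi> = \<delta>"
  shows "mult_in HessG \<chi> (\<lambda>g. \<psi> g * mckay_fun t g) = (1 - t ^ 3) * \<delta> - t * bB \<chi> \<psi> + t ^ 2 * bBs \<chi> \<psi>"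
proof -
  have "(\<Sum>g\<in>HessG. \<psi> g * mckay_fun t g * cnj (\<chi> g)) =
      (1 - t ^ 3) * (\<Sum>g\<in>HessG. \<psi> g * cnj (\<chi> g)) - t * (\<Sum>g\<in>HessG. \<psi> g * mtrace g * cnj (\<chi> g))
      + t ^ 2 * (\<Sum>g\<in>HessG. \<psi> g * mtrace (grp_inv g) * cnj (\<chi> g))"
    unfolding sum_distrib_left sum_subtractf[symmetric] sum.distrib[symmetric] mckay_fun_def
    by (intro sum.cong) (simp_all add: algebra_simps)
  thus ?thesis unfolding bB_def bBs_def mult_in_def assms[symmetric]
    by (simp add: add_divide_distrib diff_divide_distrib)
qed

lemma Mt_eq:
  assumes e: "bij_betw e {..<N} (irr_chars HessG)"
  shows "Mt N e t = mat N N (\<lambda>(i,j). mult_in HessG (e i) (\<lambda>g. e j g * mckay_fun t g))"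
  unfolding Mt_def
  by (intro cong_mat refl) (simp add: mult_in_mckay_fun[OF Hess.e_orthonormal[OF e]])

section \<open>Products and weighted sums over the 24 classes\<close>

lemma sum_prod_others_Suc:
  fixes z p :: "nat \<Rightarrow> 'a :: comm_semiring_1"
  shows "(\<Sum>c<Suc n. z c * (\<Prod>d\<in>{..<Suc n} - {c}. p d)) =
    (\<Sum>c<n. z c * (\<Prod>d\<in>{..<n} - {c}. p d)) * p n + z n * (\<Prod>d<n. p d)"
proof -
  have "(\<Prod>d\<in>{..<Suc n} - {c}. p d) = (\<Prod>d\<in>{..<n} - {c}. p d) * p n" if "c < n" for c
  proof -
    have "{..<Suc n} - {c} = insert n ({..<n} - {c})" using that by auto
    thus ?thesis by (simp add: mult.commute)
  qed
  moreover have "{..<Suc n} - {n} = {..<n}" by auto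
  ultimately show ?thesis by (simp add: sum_distrib_right mult.assoc)
qed

text \<open>The product rule for three factors of equal weight: only their product \<open>q\<close>
  and their sum of pairwise products \<open>r\<close> enter.\<close>

lemma sum_prod_others_triple:
  fixes z p :: "nat \<Rightarrow> 'a :: comm_ring_1"
  assumes "z n = w" "z (Suc n) = w" "z (Suc (Suc n)) = w"
    and "p n * p (Suc n) * p (Suc (Suc n)) = q"
    and "p n * p (Suc n) + p n * p (Suc (Suc n)) + p (Suc n) * p (Suc (Suc n)) = r"
  shows "(\<Sum>c<n+3. z c * (\<Prod>d\<in>{..<n+3} - {c}. p d)) =
      (\<Sum>c<n. z c * (\<Prod>d\<in>{..<n} - {c}. p d)) * q + w * r * (\<Prod>d<n. p d)"
    and "(\<Prod>d<n+3. p d) = (\<Prod>d<n. p d) * q"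
proof -
  have 3: "n + 3 = Suc (Suc (Suc n))" by simp
  show "(\<Sum>c<n+3. z c * (\<Prod>d\<in>{..<n+3} - {c}. p d)) =
      (\<Sum>c<n. z c * (\<Prod>d\<in>{..<n} - {c}. p d)) * q + w * r * (\<Prod>d<n. p d)"
    unfolding 3 sum_prod_others_Suc assms(1-3) unfolding assms(4,5)[symmetric]
    by (simp add: algebra_simps)
  show "(\<Prod>d<n+3. p d) = (\<Prod>d<n. p d) * q"
    unfolding 3 by (simp add: assms(4)[symmetric] mult_ac)
qed

lemma eps_cube: "eps ^ 3 = - 1 - omega"
proof -
  have "eps ^ 3 = eps ^ (12 mod 9)" by simp
  also have "\<dots> = (eps ^ 6) ^ 2" unfolding eps_pow_mod by (simp flip: power_mult)
  finally show ?thesis by (simp add: omega_eq_eps[symmetric] power2_eq_square omega_square)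
qed

lemma cnj_omega: "cnj omega = - 1 - omega"
  by (simp add: omega_Complex complex_eq_iff)

lemma eps_cnj: "eps * cnj eps = 1"
  by (simp add: eps_def cis_cnj cis_mult)

text \<open>The factors of three classes that differ by a central element are
  \<open>A - a \<zeta> t + b \<zeta>\<^sup>-\<^sup>1 t\<^sup>2\<close> with \<open>\<zeta>\<close> running over the cube roots of unity, so their product is
  the norm form \<open>X\<^sup>3 + Y\<^sup>3 + Z\<^sup>3 - 3 X Y Z\<close>.\<close>

lemma cube_roots_prod:
  fixes A a b t :: complex
  defines "f0 \<equiv> A - a * t + b * t ^ 2"
    and "f1 \<equiv> A - a * (- 1 - omega) * t + b * omega * t ^ 2"
    and "f2 \<equiv> A - a * omega * t + b * (- 1 - omega) * t ^ 2"
  shows "f0 * f1 * f2 = A ^ 3 - a ^ 3 * t ^ 3 + b ^ 3 * (t ^ 3) ^ 2 + 3 * A * (a * b) * t ^ 3"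
    and "f0 * f1 + f0 * f2 + f1 * f2 = 3 * A ^ 2 + 3 * (a * b) * t ^ 3"
proof -
  show "f0 * f1 * f2 = A ^ 3 - a ^ 3 * t ^ 3 + b ^ 3 * (t ^ 3) ^ 2 + 3 * A * (a * b) * t ^ 3"
    unfolding f0_def f1_def f2_def
    by (simp add: power2_eq_square power3_eq_cube omega_square omega_square' algebra_simps)
  show "f0 * f1 + f0 * f2 + f1 * f2 = 3 * A ^ 2 + 3 * (a * b) * t ^ 3"
    unfolding f0_def f1_def f2_def
    by (simp add: power2_eq_square power3_eq_cube omega_square omega_square' algebra_simps)
qed

lemma mckay_fun_class_rep:
  assumes "c < 24"
  shows "mckay_fun t (class_rep c) = (1 - t ^ 3) -
     (eps ^ class_m (class_data ! c) * trace_value (class_k (class_data ! c))) * t +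
     cnj (eps ^ class_m (class_data ! c) * trace_value (class_k (class_data ! c))) * t ^ 2"
proof -
  have "class_data ! c \<in> set class_data" using assms length_class_data by simp
  from mtrace_class_rep[OF this] show ?thesis
    using assms by (simp add: mckay_fun_def mtrace_grp_inv class_rep_HessG) (simp add: class_rep_def algebra_simps)
qed

text \<open>Consecutive classes of a triple differ by the scalar \<open>eps ^ 3\<close>, a primitive
  cube root of unity, so with \<open>u = eps ^ m * trace_value k\<close> the symmetric functions
  depend only on \<open>u ^ 3\<close> and on \<open>u * cnj u\<close>.\<close>

lemma mckay_fun_triple:
  fixes t :: complex
  assumes c: "c + 2 < 24" and m: "class_m (class_data ! c) = m" "class_m (class_data ! Suc c) = m + 3"
      "class_m (class_data ! Suc (Suc c)) = m + 6"
    and k: "class_k (class_data ! c) = k" "class_k (class_data ! Suc c) = k" "class_k (class_data ! Suc (Suc c)) = k"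
    and a: "(eps ^ m * trace_value k) ^ 3 = a3" and ab: "trace_value k * cnj (trace_value k) = n"
  defines "x \<equiv> t ^ 3" and "f \<equiv> \<lambda>c. mckay_fun t (class_rep c)"
  shows "f c * f (Suc c) * f (Suc (Suc c)) = (1 - x) ^ 3 - a3 * x + cnj a3 * x ^ 2 + 3 * (1 - x) * n * x"
    and "f c * f (Suc c) + f c * f (Suc (Suc c)) + f (Suc c) * f (Suc (Suc c)) = 3 * (1 - x) ^ 2 + 3 * n * x"
proof -
  define u where "u = eps ^ m * trace_value k"
  have e6: "eps ^ 6 = omega" by (rule omega_eq_eps[symmetric])
  have f0: "f c = (1 - x) - u * t + cnj u * t ^ 2"
    using c by (simp add: f_def x_def mckay_fun_class_rep m k u_def)
  have f1: "f (Suc c) = (1 - x) - u * (- 1 - omega) * t + cnj u * omega * t ^ 2"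
    using c by (simp add: f_def x_def mckay_fun_class_rep m k u_def power_add eps_cube cnj_omega del: complex_cnj_power)
  have f2: "f (Suc (Suc c)) = (1 - x) - u * omega * t + cnj u * (- 1 - omega) * t ^ 2"
    using c by (simp add: f_def x_def mckay_fun_class_rep m k u_def power_add e6 cnj_omega del: complex_cnj_power)
  have "eps ^ m * cnj (eps ^ m) = (eps * cnj eps) ^ m" by (simp add: power_mult_distrib)
  hence "u * cnj u = n" unfolding u_def ab[symmetric] by (simp add: eps_cnj mult_ac)
  moreover have "u ^ 3 = a3" "cnj u ^ 3 = cnj a3" using a unfolding u_def by (simp_all flip: a)
  ultimately show "f c * f (Suc c) * f (Suc (Suc c)) = (1 - x) ^ 3 - a3 * x + cnj a3 * x ^ 2 + 3 * (1 - x) * n * x"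
    and "f c * f (Suc c) + f c * f (Suc (Suc c)) + f (Suc c) * f (Suc (Suc c)) = 3 * (1 - x) ^ 2 + 3 * n * x"
    unfolding f0 f1 f2 cube_roots_prod by (simp_all add: x_def)
qed

lemma class_size_nth:
  "c < 24 \<Longrightarrow> class_size c = [1,1,1,24,9,9,9,54,54,54,12,12,12,72,12,12,12,72,36,36,36,36,36,36] ! c"
  unfolding class_sizes[symmetric] by (simp add: class_size_def length_class_data)

text \<open>The left side is the recursion over the classes unrolled: \<open>q\<close> and
  \<open>r\<close> are product and pair sum of a triple, \<open>A\<close> is the factor of a class
  of trace 0. The right side isolates \<open>e1 + e2\<close>, \<open>e1 * e2\<close>,
  \<open>g1 + g2\<close> and \<open>g1 * g2\<close>, which turn out to be free of
  \<open>omega\<close>.\<close>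

lemma class_sum_assemble:
  fixes A x qA rA qC rC qD rD e1 rE e2 g1 rG g2 :: complex
  shows "((((((((((rA) * A + 24 * qA) * qC + 9 * rC * (qA * A)) * qD + 54 * rD * (qA * A * qC)) * e1 + 12 * rE * (qA * A * qC * qD)) * A
      + 72 * (qA * A * qC * qD * e1)) * e2 + 12 * rE * (qA * A * qC * qD * e1 * A)) * A + 72 * (qA * A * qC * qD * e1 * A * e2)) * g1
      + 36 * rG * (qA * A * qC * qD * e1 * A * e2 * A)) * g2 + 36 * rG * (qA * A * qC * qD * e1 * A * e2 * A * g1)) =
    (rA * A * qC * qD + 24 * qA * qC * qD + 9 * rC * (qA * A * qD) + 54 * rD * (qA * A * qC)) * A ^ 2 * (e1 * e2) * (g1 * g2)
    + qA * A * qC * qD * (12 * rE * (e1 + e2) * A ^ 2 * (g1 * g2) + 144 * A * (e1 * e2) * (g1 * g2)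
      + 36 * rG * (g1 + g2) * A ^ 2 * (e1 * e2))"
  by (simp add: power2_eq_square algebra_simps)

text \<open>What remains of the class sum after the common factors are removed: degree 12 in
  \<open>x\<close>, low enough for plain expansion. The constant 648 is the group order.\<close>

lemma molien_identity_reduced:
  fixes x :: complex
  defines "A \<equiv> 1 - x" and "s \<equiv> 1 + x + x ^ 2" and "d \<equiv> 1 - x + x ^ 2" and "y \<equiv> x ^ 2"
  defines "W \<equiv> (1 + x) ^ 2 * (1 + y)"
  shows "((3 * A ^ 2 + 27 * x) * W + 24 * A ^ 2 * W + 27 * d * A ^ 2 * (1 + y) + 162 * d * A ^ 2 * (1 + x) ^ 2) * s ^ 2 * d
      + W * (36 * A ^ 4 * (2 + 5 * x + 2 * y) * d + 144 * A ^ 2 * s ^ 2 * d + 108 * A ^ 4 * (2 + x + 2 * y) * s) =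
    648 * ((1 - 2 * y - 2 * y ^ 2 + y ^ 3) * (1 + y) * (s * d) + y ^ 2 * (s * d + 3 * (1 + y) ^ 2))"
  unfolding assms by (simp add: algebra_simps power_numeral_reduce)

text \<open>Stated for independent variables, so that the factor \<open>A ^ 5 * s ^ 2 * d\<close>
  comes out without expanding anything in \<open>x\<close>.\<close>

lemma molien_common_factor:
  fixes A s d p q r k l :: complex
  shows "(r * A * (A * p) * (A * q) + 24 * A ^ 3 * (A * p) * (A * q) + 9 * (3 * d) * (A ^ 3 * A * (A * q))
      + 54 * (3 * d) * (A ^ 3 * A * (A * p))) * A ^ 2 * s ^ 3 * (d ^ 2 * s)
    + A ^ 3 * A * (A * p) * (A * q) * (12 * (3 * s) * (A * k) * A ^ 2 * (d ^ 2 * s) + 144 * A * s ^ 3 * (d ^ 2 * s)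
      + 36 * (3 * d) * (A * l) * A ^ 2 * s ^ 3) =
    A ^ 5 * s ^ 2 * d * ((r * (p * q) + 24 * A ^ 2 * (p * q) + 27 * d * A ^ 2 * q + 162 * d * A ^ 2 * p) * s ^ 2 * d
      + (p * q) * (36 * A ^ 4 * k * d + 144 * A ^ 2 * s ^ 2 * d + 108 * A ^ 4 * l * s))"
  by (simp add: algebra_simps power_numeral_reduce)

lemma molien_identity:
  fixes x :: complex
  defines "A \<equiv> 1 - x" and "s \<equiv> 1 + x + x ^ 2" and "d \<equiv> 1 - x + x ^ 2" and "y \<equiv> x ^ 2"
  defines "qA \<equiv> A ^ 3" and "rA \<equiv> 3 * A ^ 2 + 27 * x" and "qC \<equiv> A * (1 + x) ^ 2"
    and "qD \<equiv> A * (1 + y)"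
  shows "((rA * A * qC * qD + 24 * qA * qC * qD + 9 * (3 * d) * (qA * A * qD) + 54 * (3 * d) * (qA * A * qC)) * A ^ 2 * s ^ 3 * (d ^ 2 * s)
    + qA * A * qC * qD * (12 * (3 * s) * (A * (2 + 5 * x + 2 * y)) * A ^ 2 * (d ^ 2 * s) + 144 * A * s ^ 3 * (d ^ 2 * s)
      + 36 * (3 * d) * (A * (2 + x + 2 * y)) * A ^ 2 * s ^ 3)) * (1 - x ^ 6) =
    648 * ((1 - x) ^ 4 * (1 - x ^ 2) * (1 - x ^ 3) *
      ((1 - 2 * y - 2 * y ^ 2 + y ^ 3) * ((1 + y) * (1 + y + y ^ 2) ^ 3) +
       y ^ 2 * ((1 + y + y ^ 2) ^ 3 + 3 * (1 + y) ^ 2 * (1 + y + y ^ 2) ^ 2)))"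
    (is "?L * (1 - x ^ 6) = 648 * (?c * ?R)")
proof -
  define J where "J = ((3 * A ^ 2 + 27 * x) * ((1 + x) ^ 2 * (1 + y)) + 24 * A ^ 2 * ((1 + x) ^ 2 * (1 + y)) + 27 * d * A ^ 2 * (1 + y)
      + 162 * d * A ^ 2 * (1 + x) ^ 2) * s ^ 2 * d
      + ((1 + x) ^ 2 * (1 + y)) * (36 * A ^ 4 * (2 + 5 * x + 2 * y) * d + 144 * A ^ 2 * s ^ 2 * d + 108 * A ^ 4 * (2 + x + 2 * y) * s)"
  define B where "B = (1 - 2 * y - 2 * y ^ 2 + y ^ 3) * (1 + y) * (s * d) + y ^ 2 * (s * d + 3 * (1 + y) ^ 2)"
  have J: "J = 648 * B"
    unfolding J_def B_def A_def s_def d_def y_def by (rule molien_identity_reduced)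
  have L: "?L = A ^ 5 * s ^ 2 * d * J"
    unfolding J_def rA_def qA_def qC_def qD_def by (rule molien_common_factor)
  have x6: "1 - x ^ 6 = A * (1 + x) * s * d"
    unfolding A_def s_def d_def by (simp add: algebra_simps power_numeral_reduce)
  have C: "?c = A ^ 6 * (1 + x) * s"
    unfolding A_def s_def by (simp add: algebra_simps power_numeral_reduce)
  have sd: "1 + y + y ^ 2 = s * d"
    unfolding s_def d_def y_def by (simp add: algebra_simps power_numeral_reduce)
  have R: "?R = (s * d) ^ 2 * B"
    unfolding sd B_def by (simp add: algebra_simps power_numeral_reduce)
  have "?L * (1 - x ^ 6) = (A ^ 5 * s ^ 2 * d * (648 * B)) * (A * (1 + x) * s * d)"
    by (simp only: L J x6)
  also have "\<dots> = 648 * (A ^ 6 * (1 + x) * s * ((s * d) ^ 2 * B))"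
    by (simp add: power_numeral_reduce mult_ac)
  also have "\<dots> = 648 * (?c * ?R)" by (simp only: C R)
  finally show ?thesis .
qed

lemma mckay_products:
  fixes t :: complex
  defines "x \<equiv> t ^ 3" and "f \<equiv> \<lambda>c. mckay_fun t (class_rep c)"
  defines "s \<equiv> 1 + x + x ^ 2" and "d \<equiv> 1 - x + x ^ 2" and "y \<equiv> x ^ 2"
  shows "(\<Prod>c<24. f c) = (1 - x) ^ 8 * (1 + x) ^ 2 * (1 + x ^ 2) * s ^ 4 * d ^ 2"
    and "(\<Sum>c<24. of_nat (class_size c) * (\<Prod>d\<in>{..<24} - {c}. f d)) * (1 - x ^ 6) =
      648 * ((1 - x) ^ 4 * (1 - x ^ 2) * (1 - x ^ 3) *
      ((1 - 2 * y - 2 * y ^ 2 + y ^ 3) * ((1 + y) * (1 + y + y ^ 2) ^ 3) +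
       y ^ 2 * ((1 + y + y ^ 2) ^ 3 + 3 * (1 + y) ^ 2 * (1 + y + y ^ 2) ^ 2)))"
proof -
  define z where "z c = (of_nat (class_size c) :: complex)" for c
  define P where "P n = (\<Prod>d<n. f d)" for n
  define S where "S n = (\<Sum>c<n. z c * (\<Prod>d\<in>{..<n} - {c}. f d))" for n
  define A where "A = 1 - x"
  \<comment> \<open>The products of the four triples with non-real \<open>a3\<close>. The cubes in
    \<open>e1\<close> and \<open>e2\<close> are complex conjugates of each other, and so are those
    in \<open>g1\<close> and \<open>g2\<close>.\<close>
  define e1 e2 g1 g2 where "e1 = A ^ 3 - 3 * (1 - omega) * x + 3 * (2 + omega) * x ^ 2 + 9 * A * x"
    and "e2 = A ^ 3 - 3 * (2 + omega) * x + 3 * (1 - omega) * x ^ 2 + 9 * A * x"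
    and "g1 = A ^ 3 - (1 + omega) * x - omega * x ^ 2 + 3 * A * x"
    and "g2 = A ^ 3 + omega * x + (1 + omega) * x ^ 2 + 3 * A * x"
  have triple: "S (n + 3) = S n * q + w * r * P n \<and> P (n + 3) = P n * q"
    if "n + 2 < 24" "z n = w" "z (Suc n) = w" "z (Suc (Suc n)) = w"
      "class_m (class_data ! n) = m" "class_m (class_data ! Suc n) = m + 3"
      "class_m (class_data ! Suc (Suc n)) = m + 6"
      "class_k (class_data ! n) = k" "class_k (class_data ! Suc n) = k" "class_k (class_data ! Suc (Suc n)) = k"
      "(eps ^ m * trace_value k) ^ 3 = a3" "trace_value k * cnj (trace_value k) = j"
      "A ^ 3 - a3 * x + cnj a3 * x ^ 2 + 3 * A * j * x = q" "3 * A ^ 2 + 3 * j * x = r"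
    for n w m k a3 j q r
  proof -
    note products = mckay_fun_triple[OF that(1,5-12), of t]
    have "f n * f (Suc n) * f (Suc (Suc n)) = q"
      using products(1) that(13) by (simp only: f_def x_def A_def)
    moreover have "f n * f (Suc n) + f n * f (Suc (Suc n)) + f (Suc n) * f (Suc (Suc n)) = r"
      using products(2) that(14) by (simp only: f_def x_def A_def)
    ultimately show ?thesis
      unfolding S_def P_def using sum_prod_others_triple[of z n w f q r, OF that(2-4)] by simp
  qed
  have single: "S (Suc n) = S n * A + z n * P n \<and> P (Suc n) = P n * A"
    if "n < 24" "class_k (class_data ! n) = 1" for n
  proof -
    have "f n = A" using that by (simp add: f_def A_def x_def mckay_fun_class_rep trace_value_def)
    thus ?thesis unfolding S_def P_def sum_prod_others_Suc by simp
  qed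
  note ring = algebra_simps power_numeral_reduce
  note roots = power_mult_distrib eps_cube omega_square omega_square' cnj_omega
  have eps6: "eps ^ 6 = omega" by (rule omega_eq_eps[symmetric])
  have cubes: "(eps ^ 0 * trace_value 0) ^ 3 = 27" "(eps ^ 0 * trace_value 2) ^ 3 = - 1" "(eps ^ 0 * trace_value 3) ^ 3 = 1"
    "(eps ^ 1 * trace_value 4) ^ 3 = 3 * (1 - omega)" "(eps ^ 2 * trace_value 5) ^ 3 = 3 * (2 + omega)"
    "(eps ^ 1 * trace_value 2) ^ 3 = 1 + omega" "(eps ^ 2 * trace_value 2) ^ 3 = - omega"
    by (simp_all add: trace_value_def power_mult_distrib eps_cube eps6) (simp_all add: ring roots)
  have norms: "trace_value 0 * cnj (trace_value 0) = 9" "trace_value 2 * cnj (trace_value 2) = 1"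
    "trace_value 3 * cnj (trace_value 3) = 1" "trace_value 4 * cnj (trace_value 4) = 3" "trace_value 5 * cnj (trace_value 5) = 3"
    by (simp_all add: trace_value_def ring roots)
  have products: "A ^ 3 - 27 * x + cnj 27 * x ^ 2 + 3 * A * 9 * x = A ^ 3"
    "A ^ 3 - - 1 * x + cnj (- 1) * x ^ 2 + 3 * A * 1 * x = A * (1 + x) ^ 2"
    "A ^ 3 - 1 * x + cnj 1 * x ^ 2 + 3 * A * 1 * x = A * (1 + y)"
    "A ^ 3 - 3 * (1 - omega) * x + cnj (3 * (1 - omega)) * x ^ 2 + 3 * A * 3 * x = e1"
    "A ^ 3 - 3 * (2 + omega) * x + cnj (3 * (2 + omega)) * x ^ 2 + 3 * A * 3 * x = e2"
    "A ^ 3 - (1 + omega) * x + cnj (1 + omega) * x ^ 2 + 3 * A * 1 * x = g1"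
    "A ^ 3 - - omega * x + cnj (- omega) * x ^ 2 + 3 * A * 1 * x = g2"
    unfolding e1_def e2_def g1_def g2_def A_def y_def by (simp_all add: cnj_omega ring)
  have pairs: "3 * A ^ 2 + 3 * 9 * x = 3 * A ^ 2 + 27 * x" "3 * A ^ 2 + 3 * 1 * x = 3 * d" "3 * A ^ 2 + 3 * 3 * x = 3 * s"
    unfolding A_def s_def d_def by (simp_all add: ring)
  note data = class_data_def z_def class_size_nth
  have "S 0 = 0 \<and> P 0 = 1" by (simp add: S_def P_def)
  moreover have "S 3 = S 0 * A ^ 3 + 1 * (3 * A ^ 2 + 27 * x) * P 0 \<and> P 3 = P 0 * A ^ 3"
    using triple[OF _ _ _ _ _ _ _ _ _ _ cubes(1) norms(1) products(1) pairs(1), of 0 1] by (simp add: data)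
  moreover have "S 4 = S 3 * A + 24 * P 3 \<and> P 4 = P 3 * A"
    using single[of 3] by (simp add: data)
  moreover have "S 7 = S 4 * (A * (1 + x) ^ 2) + 9 * (3 * d) * P 4 \<and> P 7 = P 4 * (A * (1 + x) ^ 2)"
    using triple[OF _ _ _ _ _ _ _ _ _ _ cubes(2) norms(2) products(2) pairs(2), of 4 9] by (simp add: data)
  moreover have "S 10 = S 7 * (A * (1 + y)) + 54 * (3 * d) * P 7 \<and> P 10 = P 7 * (A * (1 + y))"
    using triple[OF _ _ _ _ _ _ _ _ _ _ cubes(3) norms(3) products(3) pairs(2), of 7 54] by (simp add: data)
  moreover have "S 13 = S 10 * e1 + 12 * (3 * s) * P 10 \<and> P 13 = P 10 * e1"
    using triple[OF _ _ _ _ _ _ _ _ _ _ cubes(4) norms(4) products(4) pairs(3), of 10 12] by (simp add: data)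
  moreover have "S 14 = S 13 * A + 72 * P 13 \<and> P 14 = P 13 * A"
    using single[of 13] by (simp add: data)
  moreover have "S 17 = S 14 * e2 + 12 * (3 * s) * P 14 \<and> P 17 = P 14 * e2"
    using triple[OF _ _ _ _ _ _ _ _ _ _ cubes(5) norms(5) products(5) pairs(3), of 14 12] by (simp add: data)
  moreover have "S 18 = S 17 * A + 72 * P 17 \<and> P 18 = P 17 * A"
    using single[of 17] by (simp add: data)
  moreover have "S 21 = S 18 * g1 + 36 * (3 * d) * P 18 \<and> P 21 = P 18 * g1"
    using triple[OF _ _ _ _ _ _ _ _ _ _ cubes(6) norms(2) products(6) pairs(2), of 18 36] by (simp add: data)
  moreover have "S 24 = S 21 * g2 + 36 * (3 * d) * P 21 \<and> P 24 = P 21 * g2"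
    using triple[OF _ _ _ _ _ _ _ _ _ _ cubes(7) norms(2) products(7) pairs(2), of 21 36] by (simp add: data)
  ultimately have P24: "P 24 = A ^ 3 * A * (A * (1 + x) ^ 2) * (A * (1 + y)) * e1 * A * e2 * A * g1 * g2"
    and S24: "S 24 = (((((((((3 * A ^ 2 + 27 * x) * A + 24 * A ^ 3) * (A * (1 + x) ^ 2) + 9 * (3 * d) * (A ^ 3 * A)) * (A * (1 + y))
      + 54 * (3 * d) * (A ^ 3 * A * (A * (1 + x) ^ 2))) * e1 + 12 * (3 * s) * (A ^ 3 * A * (A * (1 + x) ^ 2) * (A * (1 + y)))) * A
      + 72 * (A ^ 3 * A * (A * (1 + x) ^ 2) * (A * (1 + y)) * e1)) * e2
      + 12 * (3 * s) * (A ^ 3 * A * (A * (1 + x) ^ 2) * (A * (1 + y)) * e1 * A)) * A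
      + 72 * (A ^ 3 * A * (A * (1 + x) ^ 2) * (A * (1 + y)) * e1 * A * e2)) * g1
      + 36 * (3 * d) * (A ^ 3 * A * (A * (1 + x) ^ 2) * (A * (1 + y)) * e1 * A * e2 * A)) * g2
      + 36 * (3 * d) * (A ^ 3 * A * (A * (1 + x) ^ 2) * (A * (1 + y)) * e1 * A * e2 * A * g1)"
    by simp_all
  \<comment> \<open>Combining the conjugate triples removes \<open>omega\<close>; from here on
    everything is a polynomial in \<open>x\<close> with integer coefficients.\<close>
  have e: "e1 + e2 = A * (2 + 5 * x + 2 * y)" "e1 * e2 = s ^ 3"
    unfolding e1_def e2_def A_def s_def y_def by (simp_all add: ring roots)
  have g: "g1 + g2 = A * (2 + x + 2 * y)" "g1 * g2 = d ^ 2 * s"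
    unfolding g1_def g2_def A_def s_def d_def y_def by (simp_all add: ring roots)
  have "P 24 = A ^ 3 * A * (A * (1 + x) ^ 2) * (A * (1 + y)) * A ^ 2 * (e1 * e2) * (g1 * g2)"
    unfolding P24 by (simp only: power2_eq_square mult_ac)
  also have "\<dots> = A ^ 8 * (1 + x) ^ 2 * (1 + x ^ 2) * s ^ 4 * d ^ 2"
    unfolding e g y_def by (simp add: power_numeral_reduce mult_ac)
  finally show "(\<Prod>c<24. f c) = (1 - x) ^ 8 * (1 + x) ^ 2 * (1 + x ^ 2) * s ^ 4 * d ^ 2"
    by (simp only: P_def A_def)
  have "S 24 * (1 - x ^ 6) = 648 * ((1 - x) ^ 4 * (1 - x ^ 2) * (1 - x ^ 3) *
      ((1 - 2 * y - 2 * y ^ 2 + y ^ 3) * ((1 + y) * (1 + y + y ^ 2) ^ 3) +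
       y ^ 2 * ((1 + y + y ^ 2) ^ 3 + 3 * (1 + y) ^ 2 * (1 + y + y ^ 2) ^ 2)))"
    unfolding S24 class_sum_assemble e g
    unfolding A_def s_def d_def y_def by (rule molien_identity)
  thus "(\<Sum>c<24. of_nat (class_size c) * (\<Prod>d\<in>{..<24} - {c}. f d)) * (1 - x ^ 6) =
      648 * ((1 - x) ^ 4 * (1 - x ^ 2) * (1 - x ^ 3) *
      ((1 - 2 * y - 2 * y ^ 2 + y ^ 3) * ((1 + y) * (1 + y + y ^ 2) ^ 3) +
       y ^ 2 * ((1 + y + y ^ 2) ^ 3 + 3 * (1 + y) ^ 2 * (1 + y + y ^ 2) ^ 2)))"
    by (simp only: S_def z_def)
qed


section \<open>The polynomials for 2, 3, 3, 3 and the conclusion\<close>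

lemma Delta_2333:
  assumes "y \<noteq> 1"
  shows "Delta [2,3,3,3] y = (1 - y ^ 2) * (1 - y ^ 3) ^ 3 / (1 - y) ^ 2"
  by (simp add: Delta_def power_int_def power3_eq_cube field_simps)

lemma DeltaP_2333:
  assumes "y \<noteq> 1"
  shows "DeltaP [2,3,3,3] y = (1 - 2 * y - 2 * y ^ 2 + y ^ 3) * ((1 + y) * (1 + y + y ^ 2) ^ 3) +
    y ^ 2 * ((1 + y + y ^ 2) ^ 3 + 3 * (1 + y) ^ 2 * (1 + y + y ^ 2) ^ 2)"
proof -
  have q: "qint 1 y = 1" "qint 2 y = 1 + y" "qint 3 y = 1 + y + y ^ 2"
    using assms by (simp_all add: qint_def field_simps power2_eq_square power3_eq_cube)
  have sets: "{..<4} - {0} = {1,2,3::nat}" "{..<4} - {1} = {0,2,3::nat}"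
    "{..<4} - {2} = {0,1,3::nat}" "{..<4} - {3} = {0,1,2::nat}" "{..<4} = {0,1,2,3::nat}" by auto
  have len: "length [2,3,3,3::nat] = 4" by simp
  define w where "w i = (\<Prod>j\<in>{..<4} - {i}. qint ([2,3,3,3] ! j) y)" for i
  have w: "w 0 = (1 + y + y ^ 2) ^ 3" "w 1 = (1 + y) * (1 + y + y ^ 2) ^ 2"
    "w 2 = (1 + y) * (1 + y + y ^ 2) ^ 2" "w 3 = (1 + y) * (1 + y + y ^ 2) ^ 2"
    unfolding w_def sets(1-4) by (simp_all add: q power2_eq_square power3_eq_cube)
  have "(\<Sum>i<length [2,3,3,3::nat]. qint ([2,3,3,3] ! i - 1) y * (\<Prod>j\<in>{..<length [2,3,3,3::nat]} - {i}. qint ([2,3,3,3] ! j) y))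
      = (\<Sum>i\<in>{0,1,2,3}. qint ([2,3,3,3] ! i - 1) y * w i)"
    unfolding len w_def sets(5)[symmetric] by (rule refl)
  also have "\<dots> = (1 + y + y ^ 2) ^ 3 + 3 * (1 + y) ^ 2 * (1 + y + y ^ 2) ^ 2"
    using q w by (simp add: power2_eq_square)
  finally show ?thesis unfolding DeltaP_def by (simp add: q power3_eq_cube)
qed

theorem theorem2:
  fixes e :: "nat \<Rightarrow> complex mat \<Rightarrow> complex" and t :: complex
  assumes "bij_betw e {..<card (irr_chars HessG)} (irr_chars HessG)"
    and "e 0 = triv_char HessG"
    and "t ^ 18 \<noteq> 1"
  shows "det (M0t (card (irr_chars HessG)) e t)
           = (1 - t^3)^4 * (1 - t^6) * (1 - t^9) / (1 - t^18) * DeltaP [2,3,3,3] (t^6)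
         \<and> det (Mt (card (irr_chars HessG)) e t)
           = (1 - t^3)^4 * (1 - t^6) * (1 - t^9)^2 / (1 - t^18) * Delta [2,3,3,3] (t^6)"
proof -
  define N where "N = card (irr_chars HessG)"
  note e = assms(1)[folded N_def]
  define x y where "x = t ^ 3" and "y = t ^ 6"
  have x: "t ^ 6 = x ^ 2" "t ^ 9 = x ^ 3" "t ^ 18 = x ^ 6" "y = x ^ 2"
    by (simp_all add: x_def y_def flip: power_mult)
  have x6: "1 - x ^ 6 \<noteq> 0" using assms(3) by (simp add: x)
  have "y ^ 3 = x ^ 6" by (simp add: x flip: power_mult)
  \<comment> \<open>\<open>y ^ 3 = t ^ 18\<close> is not 1 by assumption, so the denominators
    \<open>1 - y\<close> in \<open>qint\<close> and \<open>Delta\<close> do not vanish.\<close>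
  hence y: "y \<noteq> 1" using x6 by auto
  note dets = Hess.det_mult_operator[OF e mckay_fun_class_fun[of t], folded Mt_eq[OF e]]
  have M: "det (Mt N e t) = (1 - x) ^ 8 * (1 + x) ^ 2 * (1 + x ^ 2) * (1 + x + x ^ 2) ^ 4 * (1 - x + x ^ 2) ^ 2"
    using dets(1) mckay_products(1)[of t] by (simp only: x_def)
  have M0: "det (M0t N e t) * (1 - x ^ 6) = (1 - x) ^ 4 * (1 - x ^ 2) * (1 - x ^ 3) * DeltaP [2,3,3,3] y"
  proof -
    define T where "T = (\<Sum>c<24. of_nat (class_size c) * (\<Prod>d\<in>{..<24} - {c}. mckay_fun t (class_rep d)))"
    have a: "det (M0t N e t) = T / 648"
      using dets(2)[OF assms(2)] by (simp add: M0t_def card_HessG sum_divide_distrib T_def)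
    have b: "T * (1 - x ^ 6) = 648 * ((1 - x) ^ 4 * (1 - x ^ 2) * (1 - x ^ 3) * DeltaP [2,3,3,3] y)"
      unfolding DeltaP_2333[OF y] unfolding x(4) x_def T_def by (rule mckay_products(2))
    have "det (M0t N e t) * (1 - x ^ 6) = T * (1 - x ^ 6) / 648" unfolding a by simp
    thus ?thesis unfolding b by simp
  qed
  have "det (M0t N e t) = (1 - x) ^ 4 * (1 - x ^ 2) * (1 - x ^ 3) / (1 - x ^ 6) * DeltaP [2,3,3,3] y"
    using M0 x6 by (simp add: field_simps)
  moreover have "det (Mt N e t) = (1 - x) ^ 4 * (1 - x ^ 2) * (1 - x ^ 3) ^ 2 / (1 - x ^ 6) * Delta [2,3,3,3] y"
  proof -
    define A s d where "A = 1 - x" and "s = 1 + x + x ^ 2" and "d = 1 - x + x ^ 2"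
    have fac: "1 - x ^ 2 = A * (1 + x)" "1 - x ^ 3 = A * s" "1 - x ^ 6 = A * (1 + x) * s * d"
      "1 - y ^ 2 = A * (1 + x) * (1 + x ^ 2)" "1 - y ^ 3 = A * (1 + x) * s * d" "1 - y = A * (1 + x)"
      unfolding A_def s_def d_def x(4) by (simp_all add: algebra_simps power_numeral_reduce)
    \<comment> \<open>All denominators are products of these four factors, and they are nonzero
      because their product is \<open>1 - x ^ 6\<close>.\<close>
    have nz: "A \<noteq> 0" "1 + x \<noteq> 0" "s \<noteq> 0" "d \<noteq> 0" using x6 unfolding fac by auto
    have "A ^ 4 * (A * b) * (A * s) ^ 2 / (A * b * s * d) * (A * b * c * (A * b * s * d) ^ 3 / (A * b) ^ 2) =
        A ^ 8 * b ^ 2 * c * s ^ 4 * d ^ 2" if "b \<noteq> 0" for b c :: complex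
    proof -
      have "A ^ 4 * (A * b) * (A * s) ^ 2 * (A * b * c * (A * b * s * d) ^ 3) =
          A ^ 8 * b ^ 2 * c * s ^ 4 * d ^ 2 * ((A * b * s * d) * (A * b) ^ 2)"
        by (simp add: power_numeral_reduce mult_ac)
      thus ?thesis using nz that by (simp add: divide_simps)
    qed
    from this[OF nz(2), of "1 + x ^ 2", symmetric] show ?thesis
      unfolding M Delta_2333[OF y] fac s_def[symmetric] d_def[symmetric] unfolding A_def[symmetric] .
  qed
  ultimately show ?thesis unfolding N_def[symmetric] x(1-3) x_def[symmetric] x(4) by simp
qed

end
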